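(* Let $0<\gamma<1$, $A,p\in\mathbb{R}$, $u_0>0$, and let $u$ be the strong solution, on its maximal interval of existence $[0,T_b)$ with $T_b\in(0,\infty]$, of $$D_c^\gamma u=Au^p,\qquad u(0)=u_0>0 .$$ If $A=0$, then $u(t)=u_0$. If $A>0$, then $u$ is strictly increasing on $(0,T_b)$. If $A<0$, then $u$ is strictly decreasing before it touches $0$. Moreover: (i) Suppose $A>0$. - If $p>1$, then $T_b<\infty$ and $$u(t)\sim\left[\frac{\Gamma\left(\frac{p\gamma}{p-1}\right)}{A\,\Gamma\left(\frac{\gamma}{p-1}\right)}\right]^{\frac1{p-1}}(T_b-t)^{-\frac{\gamma}{p-1}}\quad\text{as }t\to T_b^-.$$ - If $p=1$, then $u(t)=u_0E_\gamma(At^\gamma)$. - If $p<1$, then there exist $c_1>0$ and $c_2>0$ such that $c_1t^{\frac{\gamma}{1-p}}\le u(t)\le c_2t^{\frac{\gamma}{1-p}}$ for all $t\ge1$. (ii) Suppose $A<0$. - If $p<0$, the solution curve touches $u=0$ in finite time (i.e. $T_b<\infty$ and $\lim_{t\to T_b^-}u(t)=0$), where the right-hand side blows up. - If $p=0$, then $u=u_0+Ag_{1+\gamma}$, where $g_{1+\gamma}(t)=\frac{t^\gamma}{\Gamma(1+\gamma)}$ for $t\geq 0$. - If $p>0$, then $T_b=\infty$ and there exist $c_1>0$, $c_2>0$ such that $c_1t^{-\frac{\gamma}{p}}\le u(t)\le c_2t^{-\frac{\gamma}{p}}$ for all $t\ge1$.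
   Context: Generalized Caputo derivative. For $0<\gamma<1$, $u\in L^1_{\mathrm{loc}}[0,T)$ (integrable on $[0,T']$ for every $T'<T$) and $u_0\in\mathbb{R}$, the $\gamma$-th order generalized Caputo derivative of $u$ associated with initial value $u_0$ is the distribution in $\mathscr{D}'(-\infty,T)$, supported in $[0,T)$, $$D_c^\gamma u=g_{-\gamma}*\big((u-u_0)\theta\big),\qquad g_{-\gamma}=\frac{1}{\Gamma(1-\gamma)}D\big(\theta(t)t^{-\gamma}\big),$$ where $\theta$ is the Heaviside function and $D$ the distributional derivative. Equivalently, $D_c^\gamma u$ is the distributional derivative on $(-\infty,T)$ of the locally integrable function equal to $\frac{1}{\Gamma(1-\gamma)}\int_0^t(t-s)^{-\gamma}(u(s)-u_0)\,ds$ for $t>0$ and $0$ for $t<0$. Strong solution. $u\in L^1_{\mathrm{loc}}[0,T)$ is a strong solution of $D_c^\gamma u=f(t,u)$ on $[0,T)$ with initial value $u_0$ if $\lim_{t\to0^+}\frac1t\int_0^t|u(s)-u_0|\,ds=0$, both $D_c^\gamma u$ and $f(t,u(t))$ are locally integrable on $[0,T)$, and the equation holds in $\mathscr{D}'(-\infty,T)$ (with $f(t,u(t))$ extended by zero to $t<0$). Here $f(t,u)=Au^p$ is considered on $u\in(0,\infty)$. It is known that there is a unique strong solution with values in $(0,\infty)$, continuous on its maximal interval of existence $[0,T_b)$; it satisfies $u(t)=u_0+\frac{A}{\Gamma(\gamma)}\int_0^t(t-s)^{\gamma-1}u(s)^p\,ds$, and if $T_b<\infty$ then either $\lim_{t\to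 T_b^-}u(t)=0$ or $\lim_{t\to T_b^-}u(t)=\infty$. $E_\gamma(z)=\sum_{n=0}^\infty\frac{z^n}{\Gamma(n\gamma+1)}$ is the Mittag-Leffler function. $a(t)\sim b(t)$ means $a(t)/b(t)\to1$. Bounds asserted for all $t\ge1$ include the assertion that $u$ is defined for all such $t$. *)

theory Defs
  imports "HOL-Analysis.Analysis" "HOL-Library.Landau_Symbols"
begin

text \<open>
  The end point \<open>T\<close> of an interval lives in \<^typ>\<open>ereal\<close>, so that \<open>[0,\<infinity>)\<close> is covered.
  A function on \<open>[0,T)\<close> is a total function on \<^typ>\<open>real\<close> of which only the values on
  \<open>[0,T)\<close> are used.
\<close>

definition Ico0 :: "ereal \<Rightarrow> real set" where
  "Ico0 T = {t. 0 \<le> t \<and> ereal t < T}"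

definition loc_integrable :: "ereal \<Rightarrow> (real \<Rightarrow> real) \<Rightarrow> bool" where
  "loc_integrable T f \<longleftrightarrow>
     (\<forall>T'. 0 < T' \<longrightarrow> ereal T' < T \<longrightarrow> f absolutely_integrable_on {0..T'})"

text \<open>
  Elements of \<open>\<D>'(-\<infinity>,T)\<close> are represented by functionals on the real test functions
  \<open>C\<^sub>c\<^sup>\<infinity>(-\<infinity>,T)\<close>. All functionals below are iterated distributional derivatives of locally
  integrable functions, so linearity and continuity are automatic.
\<close>

definition test_functions :: "ereal \<Rightarrow> (real \<Rightarrow> real) set" where
  "test_functions T =
     {\<phi>. (\<forall>n t. (deriv ^^ n) \<phi> differentiable (at t)) \<and>
         compact (closure {t. \<phi> t \<noteq> 0}) \<and>
         closure {t. \<phi> t \<noteq> 0} \<subseteq> {t. ereal t < T}}"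

type_synonym distribution = "(real \<Rightarrow> real) \<Rightarrow> real"

definition distr_eq :: "ereal \<Rightarrow> distribution \<Rightarrow> distribution \<Rightarrow> bool" where
  "distr_eq T \<Lambda> \<Lambda>' \<longleftrightarrow> (\<forall>\<phi> \<in> test_functions T. \<Lambda> \<phi> = \<Lambda>' \<phi>)"

definition regular_distr :: "ereal \<Rightarrow> (real \<Rightarrow> real) \<Rightarrow> distribution" where
  "regular_distr T f = (\<lambda>\<phi>. LINT t:{t. ereal t < T}|lebesgue. f t * \<phi> t)"

definition distr_deriv :: "distribution \<Rightarrow> distribution" where
  "distr_deriv \<Lambda> = (\<lambda>\<phi>. - \<Lambda> (deriv \<phi>))"

definition zero_ext :: "(real \<Rightarrow> real) \<Rightarrow> real \<Rightarrow> real" where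
  "zero_ext f t = (if t < 0 then 0 else f t)"

text \<open>
  \<open>g\<^sub>1\<^sub>-\<^sub>\<gamma> * ((u - u\<^sub>0)\<theta>)\<close>, where \<open>g\<^sub>1\<^sub>-\<^sub>\<gamma>(t) = \<theta>(t) t\<^sup>-\<^sup>\<gamma> / \<Gamma>(1-\<gamma>)\<close>; the integral exists for almost
  every \<open>t\<close> in \<open>(0,T)\<close> when \<open>u\<close> is locally integrable on \<open>[0,T)\<close>.
\<close>

definition caputo_primitive :: "real \<Rightarrow> real \<Rightarrow> (real \<Rightarrow> real) \<Rightarrow> real \<Rightarrow> real" where
  "caputo_primitive \<gamma> u0 u t =
     (if 0 < t
      then 1 / Gamma (1 - \<gamma>) * (LINT s:{0..t}|lebesgue. (t - s) powr (-\<gamma>) * (u s - u0))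
      else 0)"

text \<open>
  Since \<open>g\<^sub>-\<^sub>\<gamma> = D g\<^sub>1\<^sub>-\<^sub>\<gamma>\<close>, the convolution \<open>g\<^sub>-\<^sub>\<gamma> * ((u - u\<^sub>0)\<theta>)\<close> is the distributional derivative of
  the function above.
\<close>

definition caputo_deriv :: "real \<Rightarrow> ereal \<Rightarrow> real \<Rightarrow> (real \<Rightarrow> real) \<Rightarrow> distribution" where
  "caputo_deriv \<gamma> T u0 u = distr_deriv (regular_distr T (caputo_primitive \<gamma> u0 u))"

definition strong_solution ::
  "real \<Rightarrow> (real \<Rightarrow> real \<Rightarrow> real) \<Rightarrow> real \<Rightarrow> ereal \<Rightarrow> (real \<Rightarrow> real) \<Rightarrow> bool" where
  "strong_solution \<gamma> f u0 T u \<longleftrightarrow>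
     loc_integrable T u \<and>
     ((\<lambda>t. 1 / t * (LINT s:{0..t}|lebesgue. \<bar>u s - u0\<bar>)) \<longlongrightarrow> 0) (at_right 0) \<and>
     (\<exists>w. loc_integrable T w \<and> distr_eq T (caputo_deriv \<gamma> T u0 u) (regular_distr T (zero_ext w))) \<and>
     loc_integrable T (\<lambda>t. f t (u t)) \<and>
     distr_eq T (caputo_deriv \<gamma> T u0 u) (regular_distr T (zero_ext (\<lambda>t. f t (u t))))"

text \<open>
  Strong solutions with values in \<open>(0,\<infinity>)\<close>, represented by their continuous version. The initial
  value \<open>u 0 = u0\<close> follows from continuity and the averaged limit in \<^const>\<open>strong_solution\<close>.
\<close>

definition positive_solution ::
  "real \<Rightarrow> (real \<Rightarrow> real \<Rightarrow> real) \<Rightarrow> real \<Rightarrow> ereal \<Rightarrow> (real \<Rightarrow> real) \<Rightarrow> bool" where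
  "positive_solution \<gamma> f u0 T u \<longleftrightarrow>
     0 < T \<and> strong_solution \<gamma> f u0 T u \<and>
     continuous_on (Ico0 T) u \<and> (\<forall>t \<in> Ico0 T. 0 < u t)"

definition maximal_positive_solution ::
  "real \<Rightarrow> (real \<Rightarrow> real \<Rightarrow> real) \<Rightarrow> real \<Rightarrow> ereal \<Rightarrow> (real \<Rightarrow> real) \<Rightarrow> bool" where
  "maximal_positive_solution \<gamma> f u0 T u \<longleftrightarrow>
     positive_solution \<gamma> f u0 T u \<and>
     \<not> (\<exists>T' v. T < T' \<and> positive_solution \<gamma> f u0 T' v \<and> (\<forall>t \<in> Ico0 T. v t = u t))"

definition mittag_leffler :: "real \<Rightarrow> real \<Rightarrow> real" where
  "mittag_leffler \<gamma> z = (\<Sum>n. z ^ n / Gamma (real n * \<gamma> + 1))"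

end

theory Submission
  imports Defs
begin

text \<open>
  Inverting the Caputo derivative turns the problem into \<open>u = u\<^sub>0 + I\<^sub>\<gamma> (A u\<^sup>p)\<close> with the fractional integral
  \<open>I\<^sub>\<gamma>\<close>, whose kernel is decreasing and log-convex. Comparing \<open>u\<close> with its time shifts gives
  monotonicity. For monotone \<open>u\<close>, the equation \<open>I\<^sub>1\<^sub>-\<^sub>\<gamma> (u - u\<^sub>0) = I\<^sub>1 (A u\<^sup>p)\<close> gives
  \<open>\<bar>A\<bar> u(t)\<^sup>p \<ge> \<bar>u(t) - u\<^sub>0\<bar> t\<^sup>-\<^sup>\<gamma> / \<Gamma>(1 - \<gamma>)\<close>, and together with crude lower bounds for the integral this
  yields all power rates. For \<open>p > 1\<close> put \<open>\<beta> = \<gamma> / (p - 1)\<close>; the equation is invariant under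
  \<open>u(t) \<mapsto> l\<^sup>\<beta> u(l t)\<close>. Comparing shifts with scalings that have the same blow-up time shows that
  \<open>u(t) (T - t)\<^sup>\<beta>\<close>, seen in logarithmic time, changes its direction of monotonicity at most once. It
  is bounded and bounded away from zero, so it converges, and its limit is identified by dominated
  convergence in the integral equation.
\<close>

section \<open>Fractional integrals\<close>

text \<open>The memory is the obstacle: a comparison cannot be restarted at a later time as for an
  ODE, because the past persists as a forcing term. No derivative of u is at hand either, so
  monotonicity is proved for finite differences D: \<open>u (t + h) - u t\<close> or
  \<open>u (t + h) - l powr \<beta> * u (l * t)\<close>. For plain shifts the delicate case is a
  nonlinearity that pushes D back to 0; there log-convexity makes the accumulated damping fade at
  least as fast as the forcing. For scaled shifts with p > 1 the nonlinearity reinforces the sign of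
  D: once D has dropped to 0, the forcing and the earlier contributions can only fade, and D stays
  nonpositive. With T - h = T / l both functions blow up together, and in the variable - ln (T - t)
  such a D is, up to a positive factor, an increment of the weighted solution. Its limit L satisfies
  L = A * B(\<beta>, \<gamma>) / \<Gamma>(\<gamma>) * L^p with Euler's Beta function B, and \<beta>
  + \<gamma> = p * \<gamma> / (p - 1); this gives the constant in the asymptotics.\<close>

lemma has_integral_powr_kernel:
  fixes a c t :: real
  assumes "0 < a" "c \<le> t"
  shows "((\<lambda>s. (t - s) powr (a - 1)) has_integral (t - c) powr a / a) {c..t}"
proof -
  have "((\<lambda>s. (t - s) powr (a - 1)) has_integral (- ((t - t) powr a / a) - - ((t - c) powr a / a))) {c..t}"
  proof (rule fundamental_theorem_of_calculus_interior[OF assms(2)])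
    show "continuous_on {c..t} (\<lambda>s. - ((t - s) powr a / a))"
      using assms by (intro continuous_intros continuous_on_powr') auto
    fix s assume s: "s \<in> {c<..<t}"
    have "((\<lambda>s. - ((t - s) powr a / a)) has_real_derivative (t - s) powr (a - 1)) (at s)"
      using s assms by (auto intro!: derivative_eq_intros)
    then show "((\<lambda>s. - ((t - s) powr a / a)) has_vector_derivative (t - s) powr (a - 1)) (at s)"
      by (simp add: has_real_derivative_iff_has_vector_derivative)
  qed
  then show ?thesis using assms by simp
qed

text \<open>The kernel may be singular at d or only later, at t > d: the comparison arguments weight
  an early piece of the history with a kernel seen from a later time. Absolute integrability links
  \<open>rl\<close> to the Lebesgue integral in \<open>caputo_primitive\<close>.\<close>

lemma absolutely_integrable_kernel:
  fixes a c d t :: real and f :: "real \<Rightarrow> real"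
  assumes "0 < a" "d \<le> t" "continuous_on {c..d} f"
  shows "(\<lambda>s. (t - s) powr (a - 1) * f s) absolutely_integrable_on {c..d}"
proof (cases "c \<le> d")
  case True
  have k: "(\<lambda>s. (t - s) powr (a - 1)) absolutely_integrable_on {c..d}"
  proof (rule absolutely_integrable_on_subinterval)
    show "(\<lambda>s. (t - s) powr (a - 1)) absolutely_integrable_on {c..t}"
      by (rule nonnegative_absolutely_integrable_1)
        (use has_integral_powr_kernel[of a c t] True assms in \<open>auto intro: has_integral_integrable\<close>)
  qed (use assms in auto)
  have "(\<lambda>s. f s * (t - s) powr (a - 1)) absolutely_integrable_on {c..d}"
  proof (rule absolutely_integrable_bounded_measurable_product_real[OF _ _ _ k])
    show "f \<in> borel_measurable (lebesgue_on {c..d})"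
      by (rule continuous_imp_measurable_on_sets_lebesgue) (use assms in auto)
    show "bounded (f ` {c..d})"
      using assms by (intro compact_imp_bounded compact_continuous_image) auto
  qed auto
  then show ?thesis by (simp add: mult.commute)
qed auto

lemmas integrable_kernel = absolutely_integrable_kernel[THEN set_lebesgue_integral_eq_integral(1)]

text \<open>The Riemann--Liouville fractional integral of order \<open>a\<close>, as a Henstock--Kurzweil integral.\<close>

definition rl :: "real \<Rightarrow> (real \<Rightarrow> real) \<Rightarrow> real \<Rightarrow> real" where
  "rl a f t = integral {0..t} (\<lambda>s. (t - s) powr (a - 1) * f s) / Gamma a"

text \<open>The point s = 0 is exempt because \<open>0 powr 0 = 0\<close>, so that
  \<open>s ^ n = s powr real n\<close> fails there for n = 0.\<close>

lemma rl_cong: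
  assumes "\<And>s. 0 < s \<Longrightarrow> s \<le> t \<Longrightarrow> f s = g s"
  shows "rl a f t = rl a g t"
proof -
  have "integral {0..t} (\<lambda>s. (t - s) powr (a - 1) * f s) = integral {0..t} (\<lambda>s. (t - s) powr (a - 1) * g s)"
    by (rule integral_spike[of "{0}"]) (use assms in auto)
  then show ?thesis by (simp add: rl_def)
qed

lemma rl_cmult: "rl a (\<lambda>s. c * f s) t = c * rl a f t"
  using integral_mult_right[of "{0..t}" c "\<lambda>s. (t - s) powr (a - 1) * f s"]
  by (simp add: rl_def mult.left_commute)

lemma rl_minus: "rl a (\<lambda>s. - f s) t = - rl a f t"
  using rl_cmult[of a "-1" f t] by simp

lemma rl_add:
  assumes "0 < a" "continuous_on {0..t} f" "continuous_on {0..t} g"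
  shows "rl a (\<lambda>s. f s + g s) t = rl a f t + rl a g t"
  using integral_add[OF integrable_kernel[OF assms(1) order_refl assms(2)] integrable_kernel[OF assms(1) order_refl assms(3)]]
  by (simp add: rl_def ring_distribs add_divide_distrib)

lemma rl_diff:
  assumes "0 < a" "continuous_on {0..t} f" "continuous_on {0..t} g"
  shows "rl a (\<lambda>s. f s - g s) t = rl a f t - rl a g t"
  using integral_diff[OF integrable_kernel[OF assms(1) order_refl assms(2)] integrable_kernel[OF assms(1) order_refl assms(3)]]
  by (simp add: rl_def ring_distribs diff_divide_distrib)

lemma rl_sum:
  assumes "0 < a" "\<And>i. i \<in> I \<Longrightarrow> continuous_on {0..t} (f i)"
  shows "rl a (\<lambda>s. \<Sum>i\<in>I. f i s) t = (\<Sum>i\<in>I. rl a (f i) t)"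
  using assms(2)
proof (induction I rule: infinite_finite_induct)
  case (insert x F)
  then show ?case
    using rl_add[OF assms(1), of t "f x" "\<lambda>s. \<Sum>i\<in>F. f i s"] by (auto intro!: continuous_intros)
qed (auto simp: rl_def)

lemma rl_mono:
  assumes "0 < a" "continuous_on {0..t} f" "continuous_on {0..t} g"
    and "\<And>s. 0 \<le> s \<Longrightarrow> s \<le> t \<Longrightarrow> f s \<le> g s"
  shows "rl a f t \<le> rl a g t"
  unfolding rl_def
  by (intro divide_right_mono integral_le integrable_kernel[OF assms(1) order_refl] assms mult_left_mono)
    (use assms in \<open>auto simp: Gamma_real_nonneg less_imp_le\<close>)

lemma rl_nonneg:
  assumes "0 < a" "continuous_on {0..t} f" "\<And>s. 0 \<le> s \<Longrightarrow> s \<le> t \<Longrightarrow> 0 \<le> f s"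
  shows "0 \<le> rl a f t"
  using rl_mono[OF assms(1), of t "\<lambda>_. 0" f] assms by (simp add: rl_def)

lemma rl_const:
  assumes "0 < a" "0 \<le> t"
  shows "rl a (\<lambda>_. c) t = c * t powr a / Gamma (a + 1)"
proof -
  have "integral {0..t} (\<lambda>s. (t - s) powr (a - 1)) = t powr a / a"
    using has_integral_powr_kernel[OF assms, THEN integral_unique] by simp
  moreover have "Gamma (a + 1) = a * Gamma a"
    using assms by (intro Gamma_plus1) (auto simp: nonpos_Ints_def)
  ultimately show ?thesis
    by (simp add: rl_def)
qed

lemma rl_bound:
  assumes "0 < a" "0 \<le> t" "continuous_on {0..t} f" "\<And>s. 0 \<le> s \<Longrightarrow> s \<le> t \<Longrightarrow> \<bar>f s\<bar> \<le> M"
  shows "\<bar>rl a f t\<bar> \<le> M * t powr a / Gamma (a + 1)"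
proof -
  have "rl a f t \<le> rl a (\<lambda>_. M) t"
    by (rule rl_mono) (use assms in \<open>auto simp: abs_le_iff\<close>)
  moreover have "rl a (\<lambda>_. - M) t \<le> rl a f t"
    by (rule rl_mono) (use assms in \<open>force simp: abs_le_iff\<close>)+
  ultimately show ?thesis
    using assms by (simp add: rl_const abs_le_iff)
qed

lemma integral_split_kernel:
  assumes "0 < a" "0 \<le> c" "c \<le> t" "continuous_on {0..t} f"
  shows "rl a f t = (integral {0..c} (\<lambda>s. (t - s) powr (a - 1) * f s)
                   + integral {c..t} (\<lambda>s. (t - s) powr (a - 1) * f s)) / Gamma a"
  using Henstock_Kurzweil_Integration.integral_combine[OF assms(2,3) integrable_kernel[OF assms(1) order_refl assms(4)]]
  by (simp add: rl_def)

lemma rl_scale: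
  assumes "0 < l" "0 \<le> t"
  shows "rl a (\<lambda>s. f (l * s)) t = l powr (- a) * rl a f (l * t)"
proof -
  have "integral {0..t} (\<lambda>s. (\<lambda>r. (l * t - r) powr (a - 1) * f r) (l * s))
        = integral {0..l * t} (\<lambda>r. (l * t - r) powr (a - 1) * f r) / l"
    using integral_stretch_real[of l 0 "l * t" "\<lambda>r. (l * t - r) powr (a - 1) * f r"] assms
    by (simp add: image_mult_atLeastAtMost_if divide_simps field_simps)
  moreover have "(l * t - l * s) powr (a - 1) = l powr (a - 1) * (t - s) powr (a - 1)" if "s \<le> t" for s
    using assms that by (simp add: powr_mult flip: right_diff_distrib)
  then have "integral {0..t} (\<lambda>s. (l * t - l * s) powr (a - 1) * f (l * s))
      = integral {0..t} (\<lambda>s. l powr (a - 1) * ((t - s) powr (a - 1) * f (l * s)))"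
    by (intro integral_cong) simp
  ultimately have "l powr (a - 1) * integral {0..t} (\<lambda>s. (t - s) powr (a - 1) * f (l * s))
        = integral {0..l * t} (\<lambda>r. (l * t - r) powr (a - 1) * f r) / l"
    by simp
  moreover have "l powr a = l * l powr (a - 1)"
    using assms by (simp add: powr_diff)
  ultimately have "l powr a * integral {0..t} (\<lambda>s. (t - s) powr (a - 1) * f (l * s))
        = integral {0..l * t} (\<lambda>r. (l * t - r) powr (a - 1) * f r)"
    using assms by (simp add: mult.assoc)
  \<comment> \<open>At a pole of Gamma the value \<open>Gamma a\<close> is 0, and both sides vanish
    by division by zero; that case is separated off.\<close>
  then have "Gamma a * (l powr a * rl a (\<lambda>s. f (l * s)) t) = Gamma a * rl a f (l * t)" if "Gamma a \<noteq> 0"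
    using that by (simp add: rl_def)
  then show ?thesis
    using assms by (cases "Gamma a = 0") (simp_all add: rl_def powr_minus divide_simps mult.commute)
qed

text \<open>At t = 1 this is Euler's Beta integral; the homogeneity of the kernel,
  \<open>rl_scale\<close>, carries the value to every t > 0.\<close>

lemma rl_powr:
  assumes "0 < a" "0 \<le> b" "0 \<le> t"
  shows "rl a (\<lambda>s. s powr b) t = Gamma (b + 1) / Gamma (a + b + 1) * t powr (a + b)"
proof (cases "t = 0")
  case True
  then show ?thesis using assms by (simp add: rl_def)
next
  case False
  have 1: "rl a (\<lambda>s. s powr b) 1 = Beta (b + 1) a / Gamma a"
    using has_integral_Beta_real[of "b + 1" a, THEN integral_unique] assms by (simp add: rl_def mult.commute)
  also have "\<dots> = Gamma (b + 1) / Gamma (a + b + 1)"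
    using Gamma_real_pos[OF assms(1)] by (simp add: Beta_def add_ac)
  finally have 1: "rl a (\<lambda>s. s powr b) 1 = Gamma (b + 1) / Gamma (a + b + 1)" .
  have "rl a (\<lambda>s. (t * s) powr b) 1 = t powr (- a) * rl a (\<lambda>s. s powr b) t"
    using rl_scale[of t 1 a "\<lambda>s. s powr b"] False assms by simp
  moreover have "rl a (\<lambda>s. (t * s) powr b) 1 = t powr b * rl a (\<lambda>s. s powr b) 1"
    unfolding rl_cmult[symmetric] by (rule rl_cong) (use assms in \<open>auto simp: powr_mult\<close>)
  ultimately show ?thesis using 1 False assms by (simp add: powr_minus powr_add field_simps)
qed

lemma rl_power:
  assumes "0 < a" "0 \<le> t"
  shows "rl a (\<lambda>s. s ^ n) t = Gamma (real n + 1) / Gamma (a + real n + 1) * t powr (a + real n)"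
proof -
  have "rl a (\<lambda>s. s ^ n) t = rl a (\<lambda>s. s powr real n) t"
    by (rule rl_cong) (simp add: powr_realpow)
  then show ?thesis using rl_powr[OF assms(1) _ assms(2)] by simp
qed

lemma rl_polynomial:
  assumes "0 < a" "0 \<le> t"
  shows "rl a (\<lambda>s. \<Sum>i\<le>n. c i * s ^ i) t
       = (\<Sum>i\<le>n::nat. c i * (Gamma (real i + 1) / Gamma (a + real i + 1) * t powr (a + real i)))"
  using assms by (subst rl_sum) (auto simp: rl_cmult rl_power intro!: continuous_intros)

section \<open>Continuity and the semigroup law by polynomial approximation\<close>

lemma polynomial_uniform_limit:
  fixes f :: "real \<Rightarrow> real"
  assumes "continuous_on {0..S} f"
  obtains c and N :: "nat \<Rightarrow> nat"
  where "uniform_limit {0..S} (\<lambda>n s. \<Sum>i\<le>N n. c n i * s ^ i) f sequentially"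
proof -
  obtain F where F: "uniform_limit {0..S} F f sequentially" "\<And>n. polynomial_function (F n)"
    using Stone_Weierstrass_uniform_limit[OF _ assms] by auto
  have "\<exists>c N. F n = (\<lambda>s. \<Sum>i\<le>N. c i * s ^ i)" for n
    using F(2)[of n] by (simp only: real_polynomial_function_eq[symmetric] real_polynomial_function_iff_sum)
  then obtain c N where "\<And>n. F n = (\<lambda>s. \<Sum>i\<le>N n. c n i * s ^ i)" by metis
  then have "F = (\<lambda>n s. \<Sum>i\<le>N n. c n i * s ^ i)" by blast
  then show ?thesis using F(1) that by simp
qed

text \<open>The constant C, the mass of the kernel, bounds the operator \<open>rl a\<close> on
  [0, S] in the sup norm; dividing by C + 1 is safe even when C = 0.\<close>

lemma rl_uniform_limit:
  assumes "0 < a" "\<And>n. continuous_on {0..S} (F n)" "continuous_on {0..S} f"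
    and "uniform_limit {0..S} F f sequentially"
  shows "uniform_limit {0..S} (\<lambda>n. rl a (F n)) (rl a f) sequentially"
proof (rule uniform_limitI)
  fix e :: real assume e: "0 < e"
  define C where "C = S powr a / Gamma (a + 1)"
  have G: "0 < Gamma (a + 1)" using assms(1) by (intro Gamma_real_pos) simp
  then have C: "0 \<le> C" by (simp add: C_def)
  have "\<forall>\<^sub>F n in sequentially. \<forall>s\<in>{0..S}. dist (F n s) (f s) < e / (C + 1)"
    using assms(4) e C by (intro uniform_limitD) auto
  then show "\<forall>\<^sub>F n in sequentially. \<forall>t\<in>{0..S}. dist (rl a (F n) t) (rl a f t) < e"
  proof (eventually_elim, intro ballI)
    fix n t assume n: "\<forall>s\<in>{0..S}. dist (F n s) (f s) < e / (C + 1)" and t: "t \<in> {0..S}"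
    have c: "continuous_on {0..t} (F n)" "continuous_on {0..t} f"
      using t by (auto intro: continuous_on_subset[OF assms(2)] continuous_on_subset[OF assms(3)])
    have "\<bar>rl a (F n) t - rl a f t\<bar> = \<bar>rl a (\<lambda>s. F n s - f s) t\<bar>"
      by (simp add: rl_diff assms(1) c)
    also have "\<dots> \<le> e / (C + 1) * t powr a / Gamma (a + 1)"
    proof (rule rl_bound[OF assms(1) _ continuous_on_diff[OF c]])
      show "\<bar>F n s - f s\<bar> \<le> e / (C + 1)" if "0 \<le> s" "s \<le> t" for s
        using n that t by (auto simp: dist_real_def intro: less_imp_le)
    qed (use t in auto)
    also have "\<dots> \<le> e / (C + 1) * S powr a / Gamma (a + 1)"
      using t e C G assms(1) by (intro divide_right_mono mult_left_mono powr_mono2) auto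
    also have "\<dots> = e / (C + 1) * C" by (simp add: C_def)
    also have "\<dots> < e" using C e by (simp add: field_simps)
    finally show "dist (rl a (F n) t) (rl a f t) < e" by (simp add: dist_real_def)
  qed
qed

text \<open>For a polynomial the result is a finite sum of powers with positive exponents, hence
  continuous up to 0; uniform limits do the rest.\<close>

lemma continuous_on_rl:
  assumes "0 < a" "continuous_on {0..S} f"
  shows "continuous_on {0..S} (rl a f)"
proof -
  obtain c N where lim: "uniform_limit {0..S} (\<lambda>n s. \<Sum>i\<le>N n. c n i * s ^ i) f sequentially"
    using polynomial_uniform_limit[OF assms(2)] .
  have "uniform_limit {0..S} (\<lambda>n. rl a (\<lambda>s. \<Sum>i\<le>N n. c n i * s ^ i)) (rl a f) sequentially"
    by (intro rl_uniform_limit assms lim continuous_intros)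
  moreover have "continuous_on {0..S} (rl a (\<lambda>s. \<Sum>i\<le>N. c i * s ^ i))" for c and N :: nat
  proof (rule continuous_on_eq)
    show "continuous_on {0..S} (\<lambda>t. \<Sum>i\<le>N. c i * (Gamma (real i + 1) / Gamma (a + real i + 1) * t powr (a + real i)))"
      using assms(1) by (intro continuous_intros continuous_on_powr') auto
  qed (use rl_polynomial[OF assms(1)] in auto)
  ultimately show ?thesis
    by (intro uniform_limit_theorem[of _ "\<lambda>n. rl a (\<lambda>s. \<Sum>i\<le>N n. c n i * s ^ i)"]) auto
qed

text \<open>On the monomial of degree i the factor \<Gamma>(b + i + 1) produced by the inner
  integral cancels against the one produced by the outer integral.\<close>

lemma rl_semigroup_polynomial:
  assumes "0 < a" "0 < b" "0 \<le> t"
  shows "rl a (rl b (\<lambda>s. \<Sum>i\<le>N. c i * s ^ i)) t = rl (a + b) (\<lambda>s. \<Sum>i\<le>N::nat. c i * s ^ i) t"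
proof -
  have Gb: "Gamma (b + real i + 1) \<noteq> 0" for i
    using Gamma_real_pos[of "b + real i + 1"] assms by (smt (verit) of_nat_0_le_iff)
  have "rl a (rl b (\<lambda>s. \<Sum>i\<le>N. c i * s ^ i)) t = rl a (\<lambda>s. \<Sum>i\<le>N. (c i * (Gamma (real i + 1) / Gamma (b + real i + 1))) * s powr (b + real i)) t"
    by (rule rl_cong) (simp add: rl_polynomial[OF assms(2)] mult.assoc)
  also have "\<dots> = (\<Sum>i\<le>N. (c i * (Gamma (real i + 1) / Gamma (b + real i + 1))) * rl a (\<lambda>s. s powr (b + real i)) t)"
    unfolding rl_cmult[symmetric] using assms
    by (intro rl_sum continuous_intros continuous_on_powr') auto
  also have "\<dots> = rl (a + b) (\<lambda>s. \<Sum>i\<le>N. c i * s ^ i) t"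
    unfolding rl_polynomial[OF add_pos_pos[OF assms(1,2)] assms(3)]
  proof (rule sum.cong[OF refl])
    fix i
    have "rl a (\<lambda>s. s powr (b + real i)) t = Gamma (b + real i + 1) / Gamma (a + b + real i + 1) * t powr (a + b + real i)"
      using rl_powr[of a "b + real i" t] assms by (simp only: add.assoc)
    moreover have "x * (g / h) * (h / k * y) = x * (g / k * y)" if "h \<noteq> 0" for x g h k y :: real
      using that by simp
    ultimately show "c i * (Gamma (real i + 1) / Gamma (b + real i + 1)) * rl a (\<lambda>s. s powr (b + real i)) t =
        c i * (Gamma (real i + 1) / Gamma (a + b + real i + 1) * t powr (a + b + real i))"
      using Gb[of i] by (simp only:)
  qed
  finally show ?thesis .
qed

text \<open>Both sides are continuous in f for the sup norm, so the Gamma identity for monomials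
  extends by Weierstrass approximation; this replaces an exchange of two singular integrals.\<close>

lemma rl_semigroup:
  assumes "0 < a" "0 < b" "0 \<le> t" "continuous_on {0..t} f"
  shows "rl a (rl b f) t = rl (a + b) f t"
proof -
  obtain c N where lim: "uniform_limit {0..t} (\<lambda>n s. \<Sum>i\<le>N n. c n i * s ^ i) f sequentially"
    using polynomial_uniform_limit[OF assms(4)] .
  let ?F = "\<lambda>n s. \<Sum>i\<le>N n. c n i * s ^ i"
  have t: "t \<in> {0..t}" using assms(3) by simp
  have q: "continuous_on {0..t} (?F n)" for n by (intro continuous_intros)
  have "uniform_limit {0..t} (\<lambda>n. rl a (rl b (?F n))) (rl a (rl b f)) sequentially"
    by (intro rl_uniform_limit continuous_on_rl assms lim q)
  then have "(\<lambda>n. rl a (rl b (?F n)) t) \<longlonglongrightarrow> rl a (rl b f) t"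
    by (rule tendsto_uniform_limitI[OF _ t])
  moreover have "uniform_limit {0..t} (\<lambda>n. rl (a + b) (?F n)) (rl (a + b) f) sequentially"
    by (intro rl_uniform_limit add_pos_pos assms lim q)
  then have "(\<lambda>n. rl (a + b) (?F n) t) \<longlonglongrightarrow> rl (a + b) f t"
    by (rule tendsto_uniform_limitI[OF _ t])
  ultimately show ?thesis
    unfolding rl_semigroup_polynomial[OF assms(1-3)] by (rule LIMSEQ_unique)
qed

lemma rl_one: "rl 1 f t = integral {0..t} f"
proof -
  have "integral {0..t} (\<lambda>s. (t - s) powr (1 - 1) * f s) = integral {0..t} f"
    by (rule integral_spike[of "{t}"]) auto
  then show ?thesis by (simp add: rl_def)
qed

text \<open>For l = 1, reflecting the variable turns \<open>rl a exp x\<close> into exp x times the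
  Gamma integral cut off at x, divided by its full value. The factor \<open>l powr (- a)\<close> is
  what makes large exponential weights turn \<open>rl\<close> into a contraction.\<close>

lemma rl_exp_le:
  assumes "0 < a" "0 < l" "0 \<le> t"
  shows "rl a (\<lambda>s. exp (l * s)) t \<le> l powr (- a) * exp (l * t)"
proof -
  have "rl a (\<lambda>s. exp (l * s)) t = l powr (- a) * rl a exp (l * t)"
    using rl_scale[of l t a exp] assms by simp
  moreover have "rl a exp x \<le> exp x" if "0 \<le> x" for x
  proof -
    have "((\<lambda>r. (\<lambda>t. t powr (a - 1) / exp t) (x - r)) has_integral i) {0..x}"
      if "((\<lambda>t. t powr (a - 1) / exp t) has_integral i) {0..x}" for i
      using has_integral_affinity[of "\<lambda>t. t powr (a - 1) / exp t" i 0 x "-1" x] that by (simp add: add.commute)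
    moreover have int: "(\<lambda>t. t powr (a - 1) / exp t) integrable_on {0..x}"
      by (rule integrable_on_subinterval[OF has_integral_integrable[OF Gamma_integral_real[OF assms(1)]]]) auto
    ultimately have "integral {0..x} (\<lambda>r. (x - r) powr (a - 1) / exp (x - r)) = integral {0..x} (\<lambda>t. t powr (a - 1) / exp t)"
      by (blast intro: integral_unique integrable_integral)
    also have "\<dots> \<le> integral {0..} (\<lambda>t. t powr (a - 1) / exp t)"
      by (rule integral_subset_le) (use int Gamma_integral_real[OF assms(1)] in \<open>auto intro: has_integral_integrable\<close>)
    also have "\<dots> = Gamma a"
      using Gamma_integral_real[OF assms(1)] by (rule integral_unique)
    finally have "exp x * integral {0..x} (\<lambda>r. (x - r) powr (a - 1) / exp (x - r)) \<le> exp x * Gamma a" by simp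
    also have "exp x * integral {0..x} (\<lambda>r. (x - r) powr (a - 1) / exp (x - r)) = integral {0..x} (\<lambda>r. (x - r) powr (a - 1) * exp r)"
      by (subst integral_mult_right[symmetric]) (simp add: exp_diff)
    finally show ?thesis using assms by (simp add: rl_def divide_le_eq)
  qed
  ultimately show ?thesis using assms by simp
qed

section \<open>Volterra equations with a Lipschitz nonlinearity\<close>

lemma continuous_on_Icc_bounded:
  fixes f :: "real \<Rightarrow> real"
  assumes "continuous_on {a..b} f"
  obtains C where "0 < C" "\<And>t. a \<le> t \<Longrightarrow> t \<le> b \<Longrightarrow> \<bar>f t\<bar> \<le> C"
proof -
  have "bounded (f ` {a..b})"
    using assms by (intro compact_imp_bounded compact_continuous_image) auto
  then obtain C where "0 < C" "\<forall>x\<in>f ` {a..b}. norm x \<le> C"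
    unfolding bounded_pos by blast
  with that show ?thesis by simp
qed

lemma rl_abs_le:
  assumes "0 < a" "continuous_on {0..t} f" "continuous_on {0..t} g"
    and "\<And>s. 0 \<le> s \<Longrightarrow> s \<le> t \<Longrightarrow> \<bar>f s\<bar> \<le> g s"
  shows "\<bar>rl a f t\<bar> \<le> rl a g t"
proof -
  have "rl a f t \<le> rl a g t"
    by (rule rl_mono[OF assms(1-3)]) (meson assms(4) abs_le_iff)
  moreover have "rl a (\<lambda>s. - f s) t \<le> rl a g t"
    by (rule rl_mono[OF assms(1) continuous_on_minus[OF assms(2)] assms(3)]) (meson assms(4) abs_le_iff)
  ultimately show ?thesis by (simp add: rl_minus)
qed

text \<open>In the sup norm weighted by exp (- l t), this l gives B times the fractional integral a
  norm of at most 1/2. Taking \<open>2 * B + 1\<close> instead of \<open>2 * B\<close> covers B =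
  0.\<close>

lemma weight_exists:
  fixes a B :: real
  assumes "0 < a" "0 \<le> B"
  obtains l where "0 < l" "B * l powr (- a) \<le> 1 / 2"
proof
  show "0 < (2 * B + 1) powr (1 / a)" using assms by simp
  have eq: "((2 * B + 1) powr (1 / a)) powr (- a) = inverse (2 * B + 1)"
    using assms by (simp add: powr_powr powr_minus)
  show "B * ((2 * B + 1) powr (1 / a)) powr (- a) \<le> 1 / 2"
    unfolding eq using assms by (simp add: field_simps)
qed

text \<open>At a maximum point x of exp (- l t) D t, the hypothesis bounds the maximum by half of
  itself, because \<open>rl_exp_le\<close> gains the factor \<open>l powr (- a)\<close>. This is the
  Gronwall inequality for the singular kernel.\<close>

lemma rl_gronwall:
  assumes "0 < a" "0 \<le> B" "continuous_on {0..S} D"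
    and nonneg: "\<And>t. 0 \<le> t \<Longrightarrow> t \<le> S \<Longrightarrow> 0 \<le> D t"
    and le: "\<And>t. 0 \<le> t \<Longrightarrow> t \<le> S \<Longrightarrow> D t \<le> B * rl a D t"
    and "0 \<le> t" "t \<le> S"
  shows "D t = 0"
proof -
  obtain l where l: "0 < l" "B * l powr (- a) \<le> 1 / 2"
    using weight_exists assms(1,2) by blast
  have "\<exists>x\<in>{0..S}. \<forall>y\<in>{0..S}. exp (- l * y) * D y \<le> exp (- l * x) * D x"
    by (rule continuous_attains_sup) (use assms in \<open>auto intro!: continuous_intros\<close>)
  then obtain x where x: "0 \<le> x" "x \<le> S" "\<And>y. 0 \<le> y \<Longrightarrow> y \<le> S \<Longrightarrow> exp (- l * y) * D y \<le> exp (- l * x) * D x"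
    by auto
  define M where "M = exp (- l * x) * D x"
  have D: "D y \<le> M * exp (l * y)" if "0 \<le> y" "y \<le> S" for y
  proof -
    have "exp (l * y) * (exp (- l * y) * D y) \<le> exp (l * y) * M"
      unfolding M_def using x(3)[OF that] by (intro mult_left_mono) auto
    moreover have "exp (l * y) * (exp (- l * y) * D y) = D y"
      by (simp add: exp_minus)
    ultimately show ?thesis by (simp only: mult.commute)
  qed
  have M0: "0 \<le> M" using nonneg x by (simp add: M_def)
  have "D x \<le> B * rl a D x" using le x by simp
  also have "\<dots> \<le> B * rl a (\<lambda>s. M * exp (l * s)) x"
    by (intro mult_left_mono rl_mono assms D continuous_on_subset[OF assms(3)])
      (use x in \<open>auto intro!: continuous_intros\<close>)
  also have "\<dots> \<le> B * (M * (l powr (- a) * exp (l * x)))"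
    unfolding rl_cmult using M0 assms l x by (intro mult_left_mono rl_exp_le) auto
  also have "\<dots> = (B * l powr (- a)) * (M * exp (l * x))" by simp
  also have "\<dots> \<le> 1 / 2 * (M * exp (l * x))"
    using l M0 by (intro mult_right_mono) auto
  also have "M * exp (l * x) = D x"
    by (simp add: M_def exp_minus)
  finally have "D x \<le> 0" by simp
  then have "M \<le> 0" by (simp add: M_def mult_nonneg_nonpos)
  then have "D t \<le> 0" using D[OF assms(6,7)] by (smt (verit) exp_gt_zero mult_nonpos_nonneg)
  then show ?thesis using nonneg assms by force
qed

lemma volterra_unique:
  assumes "0 < a" "0 \<le> B" "continuous_on {0..S} v" "continuous_on {0..S} w"
    and F: "\<And>x y. \<bar>F x - F y\<bar> \<le> B * \<bar>x - y\<bar>" "continuous_on UNIV F"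
    and v: "\<And>t. 0 \<le> t \<Longrightarrow> t \<le> S \<Longrightarrow> v t = u0 + rl a (\<lambda>s. F (v s)) t"
    and w: "\<And>t. 0 \<le> t \<Longrightarrow> t \<le> S \<Longrightarrow> w t = u0 + rl a (\<lambda>s. F (w s)) t"
    and "0 \<le> t" "t \<le> S"
  shows "v t = w t"
proof -
  have Fc: "continuous_on {0..S} (\<lambda>s. F (v s))" "continuous_on {0..S} (\<lambda>s. F (w s))"
    using assms by (auto intro: continuous_on_compose2[OF F(2)])
  have "\<bar>v t - w t\<bar> = 0"
  proof (rule rl_gronwall[OF assms(1,2) _ _ _ assms(9,10)])
    show "continuous_on {0..S} (\<lambda>t. \<bar>v t - w t\<bar>)"
      by (intro continuous_intros assms)
    fix x assume x: "0 \<le> x" "x \<le> S"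
    then have sub: "{0..x} \<subseteq> {0..S}" by auto
    have "v x - w x = rl a (\<lambda>s. F (v s) - F (w s)) x"
      using v[OF x] w[OF x] rl_diff[OF assms(1) Fc[THEN continuous_on_subset[OF _ sub]]] by simp
    also have "\<bar>\<dots>\<bar> \<le> rl a (\<lambda>s. B * \<bar>v s - w s\<bar>) x"
      by (intro rl_abs_le assms continuous_intros Fc[THEN continuous_on_subset[OF _ sub]]
          assms(3,4)[THEN continuous_on_subset[OF _ sub]])
    finally show "\<bar>v x - w x\<bar> \<le> B * rl a (\<lambda>s. \<bar>v s - w s\<bar>) x"
      by (simp add: rl_cmult)
  qed auto
  then show ?thesis by simp
qed

fun picard :: "real \<Rightarrow> (real \<Rightarrow> real) \<Rightarrow> real \<Rightarrow> nat \<Rightarrow> real \<Rightarrow> real" where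
  "picard a F u0 0 = (\<lambda>_. u0)"
| "picard a F u0 (Suc n) = (\<lambda>t. u0 + rl a (\<lambda>s. F (picard a F u0 n s)) t)"

text \<open>Successive Picard iterates differ by terms that halve in the norm weighted by exp (- l
  t). The series therefore converges on all of [0, S] at once; gluing short intervals would have to
  carry the memory along.\<close>

lemma volterra_exists:
  assumes "0 < a" "0 \<le> B" "0 \<le> S"
    and F: "\<And>x y. \<bar>F x - F y\<bar> \<le> B * \<bar>x - y\<bar>" "continuous_on UNIV F"
  obtains v where "continuous_on {0..S} v"
    "\<And>t. 0 \<le> t \<Longrightarrow> t \<le> S \<Longrightarrow> v t = u0 + rl a (\<lambda>s. F (v s)) t"
proof -
  obtain l where l: "0 < l" "B * l powr (- a) \<le> 1 / 2"
    using weight_exists assms(1,2) by blast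
  let ?v = "picard a F u0"
  have vc: "continuous_on {0..S} (?v n)" for n
  proof (induction n)
    case (Suc n)
    then show ?case
      using continuous_on_compose2[OF F(2)]
      by (auto intro!: continuous_intros continuous_on_rl assms)
  qed auto
  have Fc: "continuous_on {0..S} (\<lambda>s. F (?v n s))" for n
    using vc continuous_on_compose2[OF F(2)] by blast
  obtain C where C0: "0 < C" and C: "\<And>t. 0 \<le> t \<Longrightarrow> t \<le> S \<Longrightarrow> \<bar>?v 1 t - ?v 0 t\<bar> \<le> C"
    using continuous_on_Icc_bounded[OF continuous_on_diff[OF vc[of 1] vc[of 0]]] by blast
  have step: "\<bar>?v (Suc n) t - ?v n t\<bar> \<le> C * (1 / 2) ^ n * exp (l * t)" if "0 \<le> t" "t \<le> S" for n t
    using that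
  proof (induction n arbitrary: t)
    case 0
    have "\<bar>?v 1 t - ?v 0 t\<bar> \<le> C" by (rule C) (use 0 in auto)
    also have "\<dots> \<le> C * exp (l * t)" using C0 l 0 by (simp add: mult_le_cancel_left1)
    finally show ?case by simp
  next
    case (Suc n)
    have sub: "{0..t} \<subseteq> {0..S}" using Suc.prems by auto
    have "?v (Suc (Suc n)) t - ?v (Suc n) t = rl a (\<lambda>s. F (?v (Suc n) s) - F (?v n s)) t"
      using rl_diff[OF assms(1) Fc[of "Suc n", THEN continuous_on_subset[OF _ sub]] Fc[of n, THEN continuous_on_subset[OF _ sub]]]
      by simp
    also have "\<bar>\<dots>\<bar> \<le> rl a (\<lambda>s. B * (C * (1 / 2) ^ n) * exp (l * s)) t"
    proof (rule rl_abs_le[OF assms(1)])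
      show "continuous_on {0..t} (\<lambda>s. F (?v (Suc n) s) - F (?v n s))"
        by (intro continuous_intros Fc[THEN continuous_on_subset[OF _ sub]])
      show "continuous_on {0..t} (\<lambda>s. B * (C * (1 / 2) ^ n) * exp (l * s))"
        by (intro continuous_intros)
      fix s assume s: "0 \<le> s" "s \<le> t"
      have "\<bar>F (?v (Suc n) s) - F (?v n s)\<bar> \<le> B * \<bar>?v (Suc n) s - ?v n s\<bar>" by (rule F)
      also have "\<dots> \<le> B * (C * (1 / 2) ^ n * exp (l * s))"
        using Suc.IH[of s] s Suc.prems assms(2) by (intro mult_left_mono) linarith+
      finally show "\<bar>F (?v (Suc n) s) - F (?v n s)\<bar> \<le> B * (C * (1 / 2) ^ n) * exp (l * s)"
        by (simp only: mult.assoc)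
    qed
    also have "\<dots> \<le> B * (C * (1 / 2) ^ n) * (l powr (- a) * exp (l * t))"
      unfolding rl_cmult using C0 assms l Suc.prems by (intro mult_left_mono rl_exp_le) auto
    also have "\<dots> = (B * l powr (- a)) * (C * (1 / 2) ^ n * exp (l * t))" by simp
    also have "\<dots> \<le> 1 / 2 * (C * (1 / 2) ^ n * exp (l * t))"
      using l C0 by (intro mult_right_mono) auto
    finally show ?case by (simp only: power_Suc mult_ac)
  qed
  define V where "V = (\<lambda>t. u0 + (\<Sum>n. ?v (Suc n) t - ?v n t))"
  have "uniform_limit {0..S} (\<lambda>n t. \<Sum>i<n. ?v (Suc i) t - ?v i t) (\<lambda>t. \<Sum>n. ?v (Suc n) t - ?v n t) sequentially"
  proof (rule Weierstrass_m_test)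
    show "summable (\<lambda>n. C * (1 / 2) ^ n * exp (l * S))"
      by (intro summable_mult2 summable_mult summable_geometric) auto
    fix n t assume t: "t \<in> {0..S}"
    have "\<bar>?v (Suc n) t - ?v n t\<bar> \<le> C * (1 / 2) ^ n * exp (l * t)" by (rule step) (use t in auto)
    also have "\<dots> \<le> C * (1 / 2) ^ n * exp (l * S)"
      using t l C0 by (intro mult_left_mono) auto
    finally show "norm (?v (Suc n) t - ?v n t) \<le> C * (1 / 2) ^ n * exp (l * S)" by simp
  qed
  then have "uniform_limit {0..S} (\<lambda>n t. u0 + (\<Sum>i<n. ?v (Suc i) t - ?v i t)) V sequentially"
    unfolding V_def by (intro uniform_limit_intros)
  moreover have "u0 + (\<Sum>i<n. ?v (Suc i) t - ?v i t) = ?v n t" for n t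
    using sum_lessThan_telescope[of "\<lambda>i. ?v i t" n] by (simp del: picard.simps(2))
  ultimately have lim: "uniform_limit {0..S} ?v V sequentially" by simp
  have Vc: "continuous_on {0..S} V"
    by (rule uniform_limit_theorem[OF _ lim]) (use vc in auto)
  have FV: "continuous_on {0..S} (\<lambda>s. F (V s))"
    using Vc continuous_on_compose2[OF F(2)] by blast
  have "uniform_limit {0..S} (\<lambda>n s. F (?v n s)) (\<lambda>s. F (V s)) sequentially"
  proof (rule uniform_limitI)
    fix e :: real assume e: "0 < e"
    have "\<forall>\<^sub>F n in sequentially. \<forall>s\<in>{0..S}. dist (?v n s) (V s) < e / (B + 1)"
      using lim e assms(2) by (intro uniform_limitD) auto
    then show "\<forall>\<^sub>F n in sequentially. \<forall>s\<in>{0..S}. dist (F (?v n s)) (F (V s)) < e"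
    proof (eventually_elim, intro ballI)
      fix n s assume "\<forall>s\<in>{0..S}. dist (?v n s) (V s) < e / (B + 1)" "s \<in> {0..S}"
      then have "B * \<bar>?v n s - V s\<bar> \<le> B * (e / (B + 1))"
        using assms(2) by (intro mult_left_mono) (auto simp: dist_real_def intro: less_imp_le)
      also have "\<dots> < e" using assms(2) e by (simp add: field_simps)
      finally show "dist (F (?v n s)) (F (V s)) < e"
        unfolding dist_real_def using F(1)[of "?v n s" "V s"] by linarith
    qed
  qed
  then have rl_lim: "uniform_limit {0..S} (\<lambda>n. rl a (\<lambda>s. F (?v n s))) (rl a (\<lambda>s. F (V s))) sequentially"
    by (intro rl_uniform_limit assms(1) Fc FV)
  have "V t = u0 + rl a (\<lambda>s. F (V s)) t" if t: "0 \<le> t" "t \<le> S" for t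
  proof (rule LIMSEQ_unique)
    have tS: "t \<in> {0..S}" using t by simp
    show "(\<lambda>n. ?v (Suc n) t) \<longlonglongrightarrow> V t"
      by (rule LIMSEQ_Suc[OF tendsto_uniform_limitI[OF lim tS]])
    show "(\<lambda>n. ?v (Suc n) t) \<longlonglongrightarrow> u0 + rl a (\<lambda>s. F (V s)) t"
      unfolding picard.simps(2) by (intro tendsto_add tendsto_const tendsto_uniform_limitI[OF rl_lim tS])
  qed
  with Vc that show ?thesis by blast
qed

text \<open>The exponent is arbitrary, so the interval has to stay away from 0, where for p < 1 the
  slope may be unbounded.\<close>

lemma powr_Lipschitz:
  fixes m M p :: real
  assumes "0 < m"
  obtains B where "0 \<le> B" "\<And>x y. m \<le> x \<Longrightarrow> x \<le> M \<Longrightarrow> m \<le> y \<Longrightarrow> y \<le> M \<Longrightarrow> \<bar>x powr p - y powr p\<bar> \<le> B * \<bar>x - y\<bar>"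
proof -
  have "continuous_on {m..M} (\<lambda>x. p * x powr (p - 1))"
    using assms by (intro continuous_intros) auto
  then obtain B where B: "0 < B" "\<And>x. m \<le> x \<Longrightarrow> x \<le> M \<Longrightarrow> \<bar>p * x powr (p - 1)\<bar> \<le> B"
    using continuous_on_Icc_bounded by blast
  have "\<bar>x powr p - y powr p\<bar> \<le> B * \<bar>x - y\<bar>"
    if "m \<le> x" "x \<le> M" "m \<le> y" "y \<le> M" for x y
  proof -
    have "norm (x powr p - y powr p) \<le> B * norm (x - y)"
    proof (rule field_differentiable_bound[of "{m..M}"])
      fix z assume z: "z \<in> {m..M}"
      show "((\<lambda>z. z powr p) has_field_derivative p * z powr (p - 1)) (at z within {m..M})"
        using z assms by (auto intro!: derivative_eq_intros)
      show "norm (p * z powr (p - 1)) \<le> B"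
        using B(2)[of z] z by auto
    qed (use that in auto)
    then show ?thesis by simp
  qed
  then show ?thesis using that[of B] B(1) by auto
qed

section \<open>Smooth bumps and test functions\<close>

text \<open>\<open>flat 0\<close> is the classical function exp (- 1 / x), flat at 0. The factors
  \<open>inverse x ^ n\<close> are there because differentiation produces them, so that the family
  is closed under derivatives up to linear combinations.\<close>

definition flat :: "nat \<Rightarrow> real \<Rightarrow> real" where
  "flat n x = (if 0 < x then inverse x ^ n * exp (- inverse x) else 0)"

lemma flat_tendsto_0: "(flat n \<longlongrightarrow> 0) (at 0)"
proof (rule filterlim_split_at_real)
  have "((\<lambda>x. inverse x ^ n / exp (inverse x)) \<longlongrightarrow> 0) (at_right (0::real))"
    by (rule filterlim_compose[OF tendsto_power_div_exp_0 filterlim_inverse_at_top_right])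
  moreover have "\<forall>\<^sub>F x in at_right 0. inverse x ^ n / exp (inverse x) = flat n x"
    by (rule eventually_mono[OF eventually_at_right_less[of 0]])
      (simp add: flat_def exp_minus divide_inverse)
  ultimately show "(flat n \<longlongrightarrow> 0) (at_right 0)"
    by (rule Lim_transform_eventually)
  have "\<forall>\<^sub>F x in at_left 0. 0 = flat n x"
    by (auto simp: flat_def eventually_at_filter)
  then show "(flat n \<longlongrightarrow> 0) (at_left 0)"
    by (rule Lim_transform_eventually[OF tendsto_const])
qed

lemma flat_has_derivative:
  "(flat n has_real_derivative flat (n + 2) x + - real n * flat (n + 1) x) (at x)"
proof -
  consider "x < 0" | "x = 0" | "0 < x" by linarith
  then show ?thesis
  proof cases
    case 1
    have "((\<lambda>_. 0) has_real_derivative flat (n + 2) x + - real n * flat (n + 1) x) (at x)"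
      using 1 by (auto simp: flat_def)
    then show ?thesis
      by (rule has_field_derivative_transform_within_open[of _ _ _ "{..<0}"]) (use 1 in \<open>auto simp: flat_def\<close>)
  next
    case 2
    have "(flat (Suc n) \<longlongrightarrow> 0) (at 0)" by (rule flat_tendsto_0)
    then have "((\<lambda>h. (flat n (0 + h) - flat n 0) / h) \<longlongrightarrow> 0) (at 0)"
      by (rule Lim_transform_eventually) (auto simp: flat_def eventually_at_filter divide_inverse mult_ac)
    then show ?thesis using 2 by (simp add: DERIV_def flat_def)
  next
    case 3
    have inv: "(inverse has_real_derivative - (inverse x * inverse x)) (at x)"
      using DERIV_inverse[of x UNIV] 3 by (simp add: power2_eq_square)
    have "((\<lambda>x. inverse x ^ n * exp (- inverse x)) has_real_derivative
        (real n * (- (inverse x * inverse x) * inverse x ^ (n - Suc 0))) * exp (- inverse x)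
        + exp (- inverse x) * (- (- (inverse x * inverse x))) * inverse x ^ n) (at x)"
      by (intro DERIV_mult DERIV_power DERIV_fun_exp DERIV_minus inv)
    moreover have "(real n * (- (inverse x * inverse x) * inverse x ^ (n - Suc 0))) * exp (- inverse x)
        + exp (- inverse x) * (- (- (inverse x * inverse x))) * inverse x ^ n
        = flat (n + 2) x + - real n * flat (n + 1) x"
      using 3 by (cases n) (simp_all add: flat_def algebra_simps)
    ultimately have "((\<lambda>x. inverse x ^ n * exp (- inverse x)) has_real_derivative
        flat (n + 2) x + - real n * flat (n + 1) x) (at x)" by simp
    then show ?thesis
      by (rule has_field_derivative_transform_within_open[of _ _ _ "{0<..}"]) (use 3 in \<open>auto simp: flat_def\<close>)
  qed
qed

text \<open>Smoothness by closure: every member has a derivative that is again a member, so no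
  higher derivative is ever written out. Affine arguments allow for translation and reflection,
  which build a bump with two ends.\<close>

inductive flat_algebra :: "(real \<Rightarrow> real) \<Rightarrow> bool" where
  base: "flat_algebra (\<lambda>x. flat n (a * x + b))"
| cmult: "flat_algebra f \<Longrightarrow> flat_algebra (\<lambda>x. c * f x)"
| add: "flat_algebra f \<Longrightarrow> flat_algebra g \<Longrightarrow> flat_algebra (\<lambda>x. f x + g x)"
| mult: "flat_algebra f \<Longrightarrow> flat_algebra g \<Longrightarrow> flat_algebra (\<lambda>x. f x * g x)"

lemma flat_algebra_deriv:
  assumes "flat_algebra f"
  shows "\<exists>f'. flat_algebra f' \<and> (\<forall>x. (f has_real_derivative f' x) (at x))"
  using assms
proof induction
  case (base n a b)
  have "((\<lambda>x. flat n (a * x + b)) has_real_derivative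
          a * (flat (n + 2) (a * x + b) + - real n * flat (n + 1) (a * x + b))) (at x)" for x
  proof -
    have "((\<lambda>x. a * x + b) has_real_derivative a) (at x)"
      by (auto intro!: derivative_eq_intros)
    from DERIV_chain2[OF flat_has_derivative this] show ?thesis by (simp only: mult.commute)
  qed
  moreover have "flat_algebra (\<lambda>x. a * (flat (n + 2) (a * x + b) + - real n * flat (n + 1) (a * x + b)))"
    by (intro flat_algebra.intros)
  ultimately show ?case by blast
next
  case (cmult f c)
  then obtain f' where "flat_algebra f'" "\<And>x. (f has_real_derivative f' x) (at x)" by blast
  then show ?case
    by (intro exI[of _ "\<lambda>x. c * f' x"]) (auto intro!: flat_algebra.intros DERIV_cmult)
next
  case (add f g)
  then obtain f' g' where "flat_algebra f'" "\<And>x. (f has_real_derivative f' x) (at x)"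
    "flat_algebra g'" "\<And>x. (g has_real_derivative g' x) (at x)" by blast
  then show ?case
    by (intro exI[of _ "\<lambda>x. f' x + g' x"]) (auto intro!: flat_algebra.intros DERIV_add)
next
  case (mult f g)
  then obtain f' g' where *: "flat_algebra f'" "\<And>x. (f has_real_derivative f' x) (at x)"
    "flat_algebra g'" "\<And>x. (g has_real_derivative g' x) (at x)" by blast
  show ?case
    by (intro exI[of _ "\<lambda>x. f' x * g x + g' x * f x"] conjI allI DERIV_mult)
      (use * mult.hyps in \<open>auto intro!: flat_algebra.intros\<close>)
qed

lemma flat_algebra_smooth:
  assumes "flat_algebra f"
  shows "(deriv ^^ n) f differentiable (at t)"
  using assms
proof (induction n arbitrary: f)
  case 0
  then show ?case
    using flat_algebra_deriv real_differentiable_def by force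
next
  case (Suc n)
  obtain f' where f': "flat_algebra f'" "\<And>x. (f has_real_derivative f' x) (at x)"
    using flat_algebra_deriv[OF Suc.prems] by blast
  then have "deriv f = f'" by (auto intro!: DERIV_imp_deriv)
  then show ?case
    using Suc.IH[OF f'(1)] by (simp only: funpow_Suc_right o_apply)
qed

lemma smooth_bump_exists:
  fixes a b :: real
  assumes "a < b"
  obtains \<psi> where "flat_algebra \<psi>" "\<And>x. 0 \<le> \<psi> x" "\<And>x. 0 < \<psi> x \<longleftrightarrow> a < x \<and> x < b"
proof
  let ?\<psi> = "\<lambda>x. flat 0 (1 * x + - a) * flat 0 (- 1 * x + b)"
  show "flat_algebra ?\<psi>" by (intro flat_algebra.intros)
  show "0 \<le> ?\<psi> x" "0 < ?\<psi> x \<longleftrightarrow> a < x \<and> x < b" for x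
    by (auto simp: flat_def)
qed

lemma flat_algebra_continuous:
  assumes "flat_algebra f" shows "continuous_on A f"
  using flat_algebra_deriv[OF assms] DERIV_isCont continuous_at_imp_continuous_on by blast

lemma smooth_antiderivative:
  assumes "flat_algebra \<psi>" "\<And>x. x < a \<Longrightarrow> \<psi> x = 0" "\<And>x. b < x \<Longrightarrow> \<psi> x = 0"
  obtains \<Psi> where "\<And>x. (\<Psi> has_real_derivative \<psi> x) (at x)"
    "\<And>x. x \<le> a \<Longrightarrow> \<Psi> x = 0" "\<And>x y. b \<le> x \<Longrightarrow> b \<le> y \<Longrightarrow> \<Psi> x = \<Psi> y"
proof -
  \<comment> \<open>Starting at a - 1 makes every x \<ge> a interior to the interval on which the
    fundamental theorem is applied; to the left of a the primitive is locally 0.\<close>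
  define \<Psi> where "\<Psi> x = integral {a - 1..x} \<psi>" for x
  have zero: "\<Psi> x = 0" if "x \<le> a" for x
  proof -
    have "integral {a - 1..x} \<psi> = integral {a - 1..x} (\<lambda>_. 0)"
      by (rule integral_spike[of "{a}"]) (use that assms in auto)
    then show ?thesis by (simp add: \<Psi>_def)
  qed
  have der: "(\<Psi> has_real_derivative \<psi> x) (at x)" for x
  proof (cases "x < a")
    case True
    have "((\<lambda>_. 0) has_real_derivative \<psi> x) (at x)" using True assms by simp
    then show ?thesis
      by (rule has_field_derivative_transform_within_open[of _ _ _ "{..<a}"]) (use True zero in auto)
  next
    case False
    have "(\<Psi> has_real_derivative \<psi> x) (at x within {a - 1..x + 1})"
      unfolding \<Psi>_def
      by (rule integral_has_real_derivative) (use False flat_algebra_continuous[OF assms(1)] in auto)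
    moreover have "at x within {a - 1..x + 1} = at x"
      by (rule at_within_Icc_at) (use False in auto)
    ultimately show ?thesis by simp
  qed
  have const: "\<Psi> x = \<Psi> y" if "b \<le> x" "x < y" for x y
  proof (rule sym, rule DERIV_isconst_end[OF that(2)])
    show "continuous_on {x..y} \<Psi>"
      using der DERIV_isCont continuous_at_imp_continuous_on by blast
    show "(\<Psi> has_real_derivative 0) (at z)" if "x < z" "z < y" for z
      using der[of z] assms(3)[of z] that \<open>b \<le> x\<close> by simp
  qed
  show ?thesis
  proof (rule that[of \<Psi>])
    fix x y assume "b \<le> x" "b \<le> y"
    then show "\<Psi> x = \<Psi> y" using const[of x y] const[of y x] by (metis linorder_cases)
  qed (fact der zero)+
qed

section \<open>Distributions on (-\<infinity>, T) tested on a bounded interval [0, b]\<close>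

lemma Ico0_down: "t \<in> Ico0 T \<Longrightarrow> 0 \<le> s \<Longrightarrow> s \<le> t \<Longrightarrow> s \<in> Ico0 T"
  by (auto simp: Ico0_def intro: le_less_trans[of "ereal s" "ereal t"])

lemma Icc_subset_Ico0: "b \<in> Ico0 T \<Longrightarrow> {0..b} \<subseteq> Ico0 T"
  using Ico0_down by auto

lemma Ico0_less_exists:
  assumes "t \<in> Ico0 T"
  obtains S where "t < S" "S \<in> Ico0 T"
proof -
  obtain z where "ereal t < ereal z" "ereal z < T"
    using assms ereal_dense2 unfolding Ico0_def by blast
  then show ?thesis using that[of z] assms by (auto simp: Ico0_def)
qed

lemma test_function_props:
  assumes "\<phi> \<in> test_functions T" "0 < T"
  obtains b where "0 < b" "b \<in> Ico0 T" "\<And>t. b \<le> t \<Longrightarrow> \<phi> t = 0" "\<And>t. b \<le> t \<Longrightarrow> deriv \<phi> t = 0"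
    "\<And>t. (\<phi> has_real_derivative deriv \<phi> t) (at t)" "continuous_on UNIV (deriv \<phi>)"
proof -
  define K where "K = closure {t. \<phi> t \<noteq> 0}"
  have K: "compact K" "K \<subseteq> {t. ereal t < T}" and d: "(deriv ^^ n) \<phi> differentiable (at t)" for n t
    using assms by (auto simp: test_functions_def K_def)
  \<comment> \<open>Inserting 0 provides a maximum even for empty support and makes the later b
    positive.\<close>
  have "\<exists>m\<in>insert 0 K. \<forall>x\<in>insert 0 K. x \<le> m"
    by (rule compact_attains_sup) (use K in auto)
  then obtain m where m: "m \<in> insert 0 K" "\<And>x. x \<in> insert 0 K \<Longrightarrow> x \<le> m" by blast
  have "m \<in> Ico0 T"
    using m K assms(2) by (auto simp: Ico0_def zero_ereal_def)
  then obtain b where b: "m < b" "b \<in> Ico0 T" by (rule Ico0_less_exists)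
  have nK: "t \<notin> K" if "m < t" for t using m(2)[of t] that by auto
  have z: "\<phi> t = 0" if "m < t" for t
    using nK[OF that] closure_subset[of "{t. \<phi> t \<noteq> 0}"] unfolding K_def by blast
  have z': "deriv \<phi> t = 0" if "m < t" for t
  proof -
    have "((\<lambda>_. 0) has_real_derivative 0) (at t)" by simp
    then have "(\<phi> has_real_derivative 0) (at t)"
      by (rule has_field_derivative_transform_within_open[of _ _ _ "{m<..}"]) (use that z in auto)
    then show ?thesis by (rule DERIV_imp_deriv)
  qed
  have "(\<phi> has_real_derivative deriv \<phi> t) (at t)" for t
    using d[of 0 t] by (simp add: DERIV_deriv_iff_real_differentiable)
  moreover have "continuous_on UNIV (deriv \<phi>)"
    using d[of 1] by (intro continuous_at_imp_continuous_on) (simp add: differentiable_imp_continuous_within)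
  moreover have "0 < b" using m(2)[of 0] b(1) by simp
  moreover have "\<phi> t = 0" "deriv \<phi> t = 0" if "b \<le> t" for t
    using z[of t] z'[of t] b(1) that by simp_all
  ultimately show ?thesis using that b(2) by blast
qed

lemma regular_distr_eq_integral:
  assumes "b \<in> Ico0 T" "\<And>t. t < 0 \<Longrightarrow> f t = 0" "\<And>t. b \<le> t \<Longrightarrow> \<phi> t = 0"
    and "\<And>t. 0 \<le> t \<Longrightarrow> t \<le> b \<Longrightarrow> f t = g t" "continuous_on {0..b} (\<lambda>t. g t * \<phi> t)"
  shows "regular_distr T f \<phi> = integral {0..b} (\<lambda>t. g t * \<phi> t)"
proof -
  have "regular_distr T f \<phi> = (LINT t:{0..b}|lebesgue. g t * \<phi> t)"
    unfolding regular_distr_def set_lebesgue_integral_def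
  proof (rule Bochner_Integration.integral_cong[OF refl])
    fix t
    consider "t < 0" | "0 \<le> t" "t \<le> b" | "b < t" by linarith
    then show "indicat_real {t. ereal t < T} t *\<^sub>R (f t * \<phi> t) = indicat_real {0..b} t *\<^sub>R (g t * \<phi> t)"
      using assms(2)[of t] assms(3)[of t] assms(4)[of t] Ico0_down[OF assms(1), of t]
      by cases (auto simp: indicator_def Ico0_def)
  qed
  also have "\<dots> = integral {0..b} (\<lambda>t. g t * \<phi> t)"
    by (rule set_lebesgue_integral_eq_integral(2)) (rule absolutely_integrable_continuous_real[OF assms(5)])
  finally show ?thesis .
qed

lemma caputo_primitive_eq_rl:
  assumes "0 < \<gamma>" "\<gamma> < 1" "0 \<le> t" "continuous_on {0..t} u"
  shows "caputo_primitive \<gamma> u0 u t = rl (1 - \<gamma>) (\<lambda>s. u s - u0) t"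
proof -
  have "(\<lambda>s. (t - s) powr (1 - \<gamma> - 1) * (u s - u0)) absolutely_integrable_on {0..t}"
    by (rule absolutely_integrable_kernel) (use assms in \<open>auto intro!: continuous_intros\<close>)
  then show ?thesis
    using set_lebesgue_integral_eq_integral(2) assms by (fastforce simp: caputo_primitive_def rl_def)
qed

text \<open>Nothing is asked of \<phi> at 0: the boundary term there vanishes with the primitive of
  w, and the one at b with \<phi>.\<close>

lemma integral_primitive_by_parts:
  fixes w \<phi> \<phi>' :: "real \<Rightarrow> real"
  assumes "0 < b" "continuous_on {0..b} w" "\<And>t. (\<phi> has_real_derivative \<phi>' t) (at t)"
    and "continuous_on {0..b} \<phi>'" "\<phi> b = 0"
  shows "integral {0..b} (\<lambda>t. w t * \<phi> t) = - integral {0..b} (\<lambda>t. integral {0..t} w * \<phi>' t)"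
proof -
  let ?W = "\<lambda>t. integral {0..t} w"
  have W: "(?W has_real_derivative w t) (at t within {0..b})" if "t \<in> {0..b}" for t
    by (rule integral_has_real_derivative[OF assms(2) that])
  have Wc: "continuous_on {0..b} ?W"
    using W DERIV_continuous_on by blast
  have \<phi>c: "continuous_on {0..b} \<phi>"
    using assms(3) DERIV_isCont continuous_at_imp_continuous_on by blast
  have "((\<lambda>t. w t * \<phi> t + \<phi>' t * ?W t) has_integral ?W b * \<phi> b - ?W 0 * \<phi> 0) {0..b}"
  proof (rule fundamental_theorem_of_calculus)
    fix t assume t: "t \<in> {0..b}"
    show "((\<lambda>t. ?W t * \<phi> t) has_vector_derivative w t * \<phi> t + \<phi>' t * ?W t) (at t within {0..b})"
      unfolding has_real_derivative_iff_has_vector_derivative[symmetric]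
      by (rule DERIV_mult[OF W[OF t] has_field_derivative_at_within[OF assms(3)]])
  qed (use assms in auto)
  then have "integral {0..b} (\<lambda>t. w t * \<phi> t + \<phi>' t * ?W t) = 0"
    using assms(5) by (simp add: integral_unique)
  moreover have "integral {0..b} (\<lambda>t. w t * \<phi> t + \<phi>' t * ?W t) =
      integral {0..b} (\<lambda>t. w t * \<phi> t) + integral {0..b} (\<lambda>t. \<phi>' t * ?W t)"
    by (intro integral_add integrable_continuous_real continuous_intros assms Wc \<phi>c)
  ultimately show ?thesis by (simp add: mult.commute)
qed

text \<open>Both distributions are moved onto the derivative of \<phi>: the left one has this form
  by definition, and w is integrated by parts. Hence the equation says that one continuous function
  on [0, T), the difference of \<open>rl (1 - \<gamma>) (\<lambda>s. u s - u0)\<close> and the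
  primitive of w, is orthogonal to the derivatives of all test functions. Since test functions may
  be nonzero at 0, this leaves no free constant.\<close>

lemma caputo_distr_eq_iff_tested:
  assumes "0 < \<gamma>" "\<gamma> < 1" "0 < T" "continuous_on (Ico0 T) u" "continuous_on (Ico0 T) w"
    and "\<phi> \<in> test_functions T" "0 < b" "b \<in> Ico0 T"
    and z: "\<And>t. b \<le> t \<Longrightarrow> \<phi> t = 0" "\<And>t. b \<le> t \<Longrightarrow> deriv \<phi> t = 0"
    and der: "\<And>t. (\<phi> has_real_derivative deriv \<phi> t) (at t)" "continuous_on UNIV (deriv \<phi>)"
  shows "caputo_deriv \<gamma> T u0 u \<phi> = regular_distr T (zero_ext w) \<phi> \<longleftrightarrow>
    integral {0..b} (\<lambda>t. (rl (1 - \<gamma>) (\<lambda>s. u s - u0) t - integral {0..t} w) * deriv \<phi> t) = 0"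
proof -
  let ?P = "rl (1 - \<gamma>) (\<lambda>s. u s - u0)" and ?W = "\<lambda>t. integral {0..t} w"
  have sub: "{0..b} \<subseteq> Ico0 T" using assms(8) by (rule Icc_subset_Ico0)
  have u: "continuous_on {0..b} u" and w: "continuous_on {0..b} w"
    using continuous_on_subset[OF assms(4) sub] continuous_on_subset[OF assms(5) sub] .
  have d: "continuous_on {0..b} (deriv \<phi>)" using der(2) continuous_on_subset by blast
  have \<phi>c: "continuous_on {0..b} \<phi>"
    using der(1) DERIV_isCont continuous_at_imp_continuous_on by blast
  have P: "continuous_on {0..b} ?P"
    using assms by (intro continuous_on_rl continuous_intros u) auto
  have Wc: "continuous_on {0..b} ?W"
    using integral_has_real_derivative[OF w] DERIV_continuous_on by blast
  have "caputo_deriv \<gamma> T u0 u \<phi> = - integral {0..b} (\<lambda>t. ?P t * deriv \<phi> t)"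
    unfolding caputo_deriv_def distr_deriv_def
  proof (subst regular_distr_eq_integral[OF assms(8)])
    fix t assume t: "0 \<le> t" "t \<le> b"
    show "caputo_primitive \<gamma> u0 u t = ?P t"
      by (rule caputo_primitive_eq_rl) (use assms t in \<open>auto intro: continuous_on_subset[OF u]\<close>)
  qed (use z P d in \<open>auto intro!: continuous_intros simp: caputo_primitive_def\<close>)
  moreover have "regular_distr T (zero_ext w) \<phi> = integral {0..b} (\<lambda>t. w t * \<phi> t)"
    by (rule regular_distr_eq_integral[OF assms(8)])
      (use z w \<phi>c in \<open>auto intro!: continuous_intros simp: zero_ext_def\<close>)
  moreover have "integral {0..b} (\<lambda>t. w t * \<phi> t) = - integral {0..b} (\<lambda>t. ?W t * deriv \<phi> t)"
    by (rule integral_primitive_by_parts) (use assms w d in auto)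
  moreover have "integral {0..b} (\<lambda>t. (?P t - ?W t) * deriv \<phi> t) =
      integral {0..b} (\<lambda>t. ?P t * deriv \<phi> t) - integral {0..b} (\<lambda>t. ?W t * deriv \<phi> t)"
    unfolding left_diff_distrib
    by (intro integral_diff integrable_continuous_real continuous_intros P Wc d)
  ultimately show ?thesis by auto
qed

text \<open>The test function \<open>\<phi>\<close> is a primitive of a bump moved to the left of \<open>0\<close>, minus the bump itself. The
  difference has integral zero, so \<open>\<phi>\<close> has compact support, and only the second bump meets \<open>h\<close>.\<close>

lemma du_Bois_Reymond_half_line:
  assumes "0 < T" and cont: "\<And>S. S \<in> Ico0 T \<Longrightarrow> continuous_on {0..S} h"
    and test: "\<And>\<phi> b. \<phi> \<in> test_functions T \<Longrightarrow> 0 < b \<Longrightarrow> b \<in> Ico0 T \<Longrightarrow> (\<And>t. b \<le> t \<Longrightarrow> \<phi> t = 0) \<Longrightarrow>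
      (\<And>t. b \<le> t \<Longrightarrow> deriv \<phi> t = 0) \<Longrightarrow> (\<And>t. (\<phi> has_real_derivative deriv \<phi> t) (at t)) \<Longrightarrow>
      continuous_on UNIV (deriv \<phi>) \<Longrightarrow> integral {0..b} (\<lambda>t. h t * deriv \<phi> t) = 0"
    and t: "t \<in> Ico0 T" "0 < t"
  shows "h t \<le> 0"
proof (rule ccontr)
  assume "\<not> h t \<le> 0"
  then have ht: "0 < h t" by simp
  obtain S where S: "t < S" "S \<in> Ico0 T" using t Ico0_less_exists by blast
  have hS: "continuous_on {0..S} h" by (rule cont[OF S(2)])
  then have "isCont h t"
    using t S by (intro continuous_on_interior[of "{0..S}"]) auto
  then have "\<forall>\<^sub>F s in at t. 0 < h s"
    using ht by (intro order_tendstoD[of h "h t"]) (auto simp: isCont_def)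
  then obtain d where d: "0 < d" "\<And>s. s \<noteq> t \<Longrightarrow> \<bar>s - t\<bar> < d \<Longrightarrow> 0 < h s"
    unfolding eventually_at dist_real_def by auto
  \<comment> \<open>a stays positive and b at most S; halving d keeps the closed interval [a, b]
    inside the region where h is positive.\<close>
  define a where "a = max (t / 2) (t - d / 2)"
  define b where "b = min S (t + d / 2)"
  have ab: "0 < a" "a < t" "t < b" "b \<le> S" "0 < b" using t S d by (auto simp: a_def b_def)
  have bT: "b \<in> Ico0 T" using Ico0_down[OF S(2)] ab by simp
  have hpos: "0 < h s" if "a \<le> s" "s \<le> b" for s
    using d ht that by (cases "s = t") (auto simp: a_def b_def)
  obtain \<psi> where \<psi>: "flat_algebra \<psi>" "\<And>x. 0 \<le> \<psi> x" "\<And>x. 0 < \<psi> x \<longleftrightarrow> a < x \<and> x < b"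
    using smooth_bump_exists[of a b] ab by auto
  have \<psi>0: "\<psi> x = 0" if "x \<le> a \<or> b \<le> x" for x
    using \<psi>(2)[of x] \<psi>(3)[of x] that by linarith
  have \<psi>lo: "\<psi> x = 0" if "x < a" for x using \<psi>0 that by simp
  have \<psi>hi: "\<psi> x = 0" if "b < x" for x using \<psi>0 that by simp
  obtain \<Psi> where \<Psi>: "\<And>x. (\<Psi> has_real_derivative \<psi> x) (at x)"
    "\<And>x. x \<le> a \<Longrightarrow> \<Psi> x = 0" "\<And>x y. b \<le> x \<Longrightarrow> b \<le> y \<Longrightarrow> \<Psi> x = \<Psi> y"
    using smooth_antiderivative[OF \<psi>(1) \<psi>lo \<psi>hi] by blast
  define \<phi> where "\<phi> = (\<lambda>x. \<Psi> (x + b) - \<Psi> x)"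
  define \<psi>2 where "\<psi>2 = (\<lambda>x. \<psi> (x + b) + - 1 * \<psi> x)"
  have shift: "flat_algebra (\<lambda>x. flat n (c * (x + b) + e))" for n c e
    using flat_algebra.base[of n c "c * b + e"] by (simp add: distrib_left add.assoc)
  have "flat_algebra (\<lambda>x. f (x + b))" if "flat_algebra f" for f
    using that by induction (auto intro: flat_algebra.intros shift)
  then have \<psi>2: "flat_algebra \<psi>2"
    unfolding \<psi>2_def using \<psi>(1) by (intro flat_algebra.intros) auto
  have der: "(\<phi> has_real_derivative \<psi>2 x) (at x)" for x
  proof -
    have "((\<lambda>x. \<Psi> (x + b)) has_real_derivative \<psi> (x + b)) (at x)"
      using \<Psi>(1)[of "x + b"] by (simp add: DERIV_shift)
    from DERIV_diff[OF this \<Psi>(1)] show ?thesis by (simp add: \<phi>_def \<psi>2_def)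
  qed
  then have deriv: "deriv \<phi> = \<psi>2" by (auto intro!: DERIV_imp_deriv)
  have smooth: "(deriv ^^ n) \<phi> differentiable (at x)" for n x
  proof (cases n)
    case 0
    then show ?thesis using der[of x] by (auto simp: real_differentiable_def)
  next
    case (Suc m)
    have "(deriv ^^ n) \<phi> = (deriv ^^ m) \<psi>2"
      unfolding Suc funpow_Suc_right by (simp add: deriv)
    then show ?thesis using flat_algebra_smooth[OF \<psi>2] by simp
  qed
  have right: "\<phi> x = 0" if "b \<le> x" for x
    using \<Psi>(3)[of "x + b" x] that ab by (simp add: \<phi>_def)
  have left: "\<phi> x = 0" if "x \<le> a - b" for x
    using \<Psi>(2)[of "x + b"] \<Psi>(2)[of x] that ab by (simp add: \<phi>_def)
  have "{x. \<phi> x \<noteq> 0} \<subseteq> {a - b..b}"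
    using left right by (smt (verit) atLeastAtMost_iff mem_Collect_eq subsetI)
  then have cl: "closure {x. \<phi> x \<noteq> 0} \<subseteq> {a - b..b}"
    by (rule closure_minimal) auto
  moreover have "{a - b..b} \<subseteq> {t. ereal t < T}"
    using bT by (auto simp: Ico0_def intro: le_less_trans[of _ "ereal b"])
  moreover have "compact (closure {x. \<phi> x \<noteq> 0})"
    using cl by (metis bounded_closed_interval bounded_subset closed_closure compact_eq_bounded_closed)
  ultimately have "\<phi> \<in> test_functions T"
    using smooth by (simp add: test_functions_def)
  then have "integral {0..b} (\<lambda>t. h t * deriv \<phi> t) = 0"
  proof (rule test[OF _ \<open>0 < b\<close> bT])
    show "deriv \<phi> x = 0" if "b \<le> x" for x
      using \<psi>0[of "x + b"] \<psi>0[of x] that ab by (simp add: deriv \<psi>2_def)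
    show "(\<phi> has_real_derivative deriv \<phi> x) (at x)" for x using der deriv by simp
    show "continuous_on UNIV (deriv \<phi>)" using flat_algebra_continuous[OF \<psi>2] deriv by simp
  qed (fact right)
  also have "integral {0..b} (\<lambda>t. h t * deriv \<phi> t) = integral {0..b} (\<lambda>t. - (h t * \<psi> t))"
  proof (rule integral_cong)
    fix x assume "x \<in> {0..b}"
    then show "h x * deriv \<phi> x = - (h x * \<psi> x)"
      using \<psi>0[of "x + b"] by (simp add: deriv \<psi>2_def)
  qed
  finally have int0: "integral {0..b} (\<lambda>t. h t * \<psi> t) = 0" by simp
  have hb: "continuous_on {0..b} h" using hS ab by (auto intro: continuous_on_subset)
  have "h t * \<psi> t = 0"
  proof -
    have "\<forall>x\<in>{0..b}. h x * \<psi> x = 0"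
    proof (rule iffD1[OF integral_eq_0_iff int0])
      show "continuous_on {0..b} (\<lambda>t. h t * \<psi> t)"
        by (intro continuous_intros hb flat_algebra_continuous \<psi>)
      fix x assume x: "x \<in> {0..b}"
      show "0 \<le> h x * \<psi> x"
        using hpos[of x] \<psi>(2)[of x] \<psi>0[of x] x by (cases "a \<le> x") auto
    qed fact
    then show ?thesis using ab by auto
  qed
  then show False using ht \<psi>(3)[of t] ab by simp
qed

section \<open>Equivalence with the Volterra equation\<close>

lemma rl_at_0 [simp]: "rl a f 0 = 0"
  by (simp add: rl_def)

lemma continuous_integrals_eq_imp_eq:
  fixes f g :: "real \<Rightarrow> real"
  assumes "continuous_on {0..S} f" "continuous_on {0..S} g" "0 < S"
    and "\<And>t. 0 \<le> t \<Longrightarrow> t \<le> S \<Longrightarrow> integral {0..t} f = integral {0..t} g"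
    and "0 \<le> t" "t \<le> S"
  shows "f t = g t"
proof (rule vector_derivative_unique_within_closed_interval[of 0 S])
  have "((\<lambda>x. integral {0..x} g) has_real_derivative g t) (at t within {0..S})"
    by (rule integral_has_real_derivative) (use assms in auto)
  then show "((\<lambda>x. integral {0..x} g) has_vector_derivative g t) (at t within cbox 0 S)"
    by (simp add: has_real_derivative_iff_has_vector_derivative)
  have "((\<lambda>x. integral {0..x} f) has_real_derivative f t) (at t within {0..S})"
    by (rule integral_has_real_derivative) (use assms in auto)
  then have "((\<lambda>x. integral {0..x} g) has_real_derivative f t) (at t within {0..S})"
    by (rule has_field_derivative_transform_within[of _ _ _ _ 1]) (use assms in auto)
  then show "((\<lambda>x. integral {0..x} g) has_vector_derivative f t) (at t within cbox 0 S)"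
    by (simp add: has_real_derivative_iff_has_vector_derivative)
qed (use assms in auto)

text \<open>Applying \<open>rl \<gamma>\<close> to the first equation and using the semigroup law
  gives equality of the primitives of u - u0 and of \<open>rl \<gamma> w\<close>, which can be
  differentiated. Applying \<open>rl (1 - \<gamma>)\<close> to the second equation gives the
  converse at once.\<close>

lemma caputo_inverse_rl:
  assumes "0 < \<gamma>" "\<gamma> < 1" "continuous_on {0..S} u" "continuous_on {0..S} w" "0 < S"
  shows "(\<forall>t\<in>{0..S}. rl (1 - \<gamma>) (\<lambda>s. u s - u0) t = integral {0..t} w) \<longleftrightarrow>
    (\<forall>t\<in>{0..S}. u t = u0 + rl \<gamma> w t)"
proof -
  have sub: "continuous_on {0..t} w" "continuous_on {0..t} (\<lambda>s. u s - u0)"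
    if "t \<in> {0..S}" for t
    using that assms(3,4) by (auto intro!: continuous_intros elim: continuous_on_subset)
  show ?thesis
  proof (intro iffI ballI)
    assume eq: "\<forall>t\<in>{0..S}. rl (1 - \<gamma>) (\<lambda>s. u s - u0) t = integral {0..t} w"
    fix t assume t: "t \<in> {0..S}"
    have "u t - u0 = rl \<gamma> w t"
    proof (rule continuous_integrals_eq_imp_eq[where f = "\<lambda>t. u t - u0" and g = "rl \<gamma> w", OF _ _ assms(5)])
      show "continuous_on {0..S} (\<lambda>t. u t - u0)" by (intro continuous_intros assms)
      show "continuous_on {0..S} (rl \<gamma> w)" by (intro continuous_on_rl assms)
      fix r assume r: "0 \<le> r" "r \<le> S"
      then have r': "r \<in> {0..S}" by simp
      have "integral {0..r} (\<lambda>t. u t - u0) = rl (\<gamma> + (1 - \<gamma>)) (\<lambda>t. u t - u0) r"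
        by (simp add: rl_one)
      also have "\<dots> = rl \<gamma> (rl (1 - \<gamma>) (\<lambda>t. u t - u0)) r"
        by (rule rl_semigroup[symmetric]) (use assms r sub[OF r'] in auto)
      also have "\<dots> = rl \<gamma> (rl 1 w) r"
        unfolding rl_one by (rule rl_cong) (use eq r in auto)
      also have "\<dots> = rl (\<gamma> + 1) w r"
        by (rule rl_semigroup) (use assms r sub[OF r'] in auto)
      also have "\<dots> = rl (1 + \<gamma>) w r" by (simp add: add.commute)
      also have "\<dots> = rl 1 (rl \<gamma> w) r"
        by (rule rl_semigroup[symmetric]) (use assms r sub[OF r'] in auto)
      also have "\<dots> = integral {0..r} (rl \<gamma> w)" by (rule rl_one)
      finally show "integral {0..r} (\<lambda>t. u t - u0) = integral {0..r} (rl \<gamma> w)" .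
    qed (use t in auto)
    then show "u t = u0 + rl \<gamma> w t" by simp
  next
    assume eq: "\<forall>t\<in>{0..S}. u t = u0 + rl \<gamma> w t"
    fix t assume t: "t \<in> {0..S}"
    have "rl (1 - \<gamma>) (\<lambda>s. u s - u0) t = rl (1 - \<gamma>) (rl \<gamma> w) t"
      by (rule rl_cong) (use eq t in auto)
    also have "\<dots> = rl (1 - \<gamma> + \<gamma>) w t"
      by (rule rl_semigroup) (use assms t sub[OF t] in auto)
    finally show "rl (1 - \<gamma>) (\<lambda>s. u s - u0) t = integral {0..t} w" by (simp add: rl_one)
  qed
qed

text \<open>This is the gateway from distributions to analysis: from here on solutions are handled
  through the integral equation. The initial value u 0 = u0 is built into that equation, since
  \<open>rl\<close> vanishes at 0.\<close>

lemma positive_solution_iff_volterra: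
  assumes \<gamma>: "0 < \<gamma>" "\<gamma> < 1" and T: "0 < T" and F: "continuous_on {0<..} F"
  shows "positive_solution \<gamma> (\<lambda>t. F) u0 T u \<longleftrightarrow>
    continuous_on (Ico0 T) u \<and> (\<forall>t\<in>Ico0 T. 0 < u t \<and> u t = u0 + rl \<gamma> (\<lambda>s. F (u s)) t)"
    (is "?lhs \<longleftrightarrow> ?rhs")
proof -
  define w where "w = (\<lambda>s. F (u s))"
  let ?P = "rl (1 - \<gamma>) (\<lambda>s. u s - u0)"
  let ?W = "\<lambda>t. integral {0..t} w"
  have T0: "0 \<in> Ico0 T" using T by (simp add: Ico0_def zero_ereal_def)
  {
    assume u: "continuous_on (Ico0 T) u" "\<forall>t\<in>Ico0 T. 0 < u t"
    have w: "continuous_on (Ico0 T) w"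
      unfolding w_def by (rule continuous_on_compose2[OF F u(1)]) (use u in auto)
    have cS: "continuous_on {0..S} u" "continuous_on {0..S} w" if "S \<in> Ico0 T" for S
      using continuous_on_subset[OF u(1) Icc_subset_Ico0[OF that]]
        continuous_on_subset[OF w Icc_subset_Ico0[OF that]] .
    have PW: "continuous_on {0..S} (\<lambda>t. ?P t - ?W t)" if "S \<in> Ico0 T" for S
    proof -
      have "continuous_on {0..S} ?W"
        using integral_has_real_derivative[OF cS(2)[OF that]] DERIV_continuous_on by blast
      then show ?thesis
        using \<gamma> by (intro continuous_intros continuous_on_rl cS that) auto
    qed
    have "(\<forall>t\<in>Ico0 T. u t = u0 + rl \<gamma> w t) \<longleftrightarrow> (\<forall>t\<in>Ico0 T. ?P t = ?W t)"
    proof -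
      have "(\<forall>t\<in>Ico0 T. \<Phi> t) \<longleftrightarrow> (\<forall>S\<in>Ico0 T. 0 < S \<longrightarrow> (\<forall>t\<in>{0..S}. \<Phi> t))" for \<Phi> :: "real \<Rightarrow> bool"
      proof safe
        fix t assume *: "\<forall>S\<in>Ico0 T. 0 < S \<longrightarrow> (\<forall>t\<in>{0..S}. \<Phi> t)" "t \<in> Ico0 T"
        obtain S where "t < S" "S \<in> Ico0 T" using *(2) by (rule Ico0_less_exists)
        then show "\<Phi> t" using *(1)[rule_format, of S t] *(2) by (auto simp: Ico0_def)
      next
        fix S t assume "\<forall>t\<in>Ico0 T. \<Phi> t" "S \<in> Ico0 T" "t \<in> {0..S}"
        then show "\<Phi> t" using Icc_subset_Ico0 by blast
      qed
      note * = this
      show ?thesis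
        unfolding *[of "\<lambda>t. u t = u0 + rl \<gamma> w t"] *[of "\<lambda>t. ?P t = ?W t"]
        using caputo_inverse_rl[OF \<gamma> cS] by blast
    qed
    also have "\<dots> \<longleftrightarrow> distr_eq T (caputo_deriv \<gamma> T u0 u) (regular_distr T (zero_ext w))"
    proof
      assume eq: "\<forall>t\<in>Ico0 T. ?P t = ?W t"
      show "distr_eq T (caputo_deriv \<gamma> T u0 u) (regular_distr T (zero_ext w))"
        unfolding distr_eq_def
      proof
        fix \<phi> assume \<phi>: "\<phi> \<in> test_functions T"
        then obtain b where b: "0 < b" "b \<in> Ico0 T" "\<And>t. b \<le> t \<Longrightarrow> \<phi> t = 0" "\<And>t. b \<le> t \<Longrightarrow> deriv \<phi> t = 0"
          "\<And>t. (\<phi> has_real_derivative deriv \<phi> t) (at t)" "continuous_on UNIV (deriv \<phi>)"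
          using test_function_props[OF \<phi> T] by blast
        have "integral {0..b} (\<lambda>t. (?P t - ?W t) * deriv \<phi> t) = integral {0..b} (\<lambda>t. 0)"
          by (rule integral_cong) (use eq Icc_subset_Ico0[OF b(2)] in auto)
        then show "caputo_deriv \<gamma> T u0 u \<phi> = regular_distr T (zero_ext w) \<phi>"
          by (subst caputo_distr_eq_iff_tested[OF \<gamma> T u(1) w \<phi> b]) auto
      qed
    next
      assume eq: "distr_eq T (caputo_deriv \<gamma> T u0 u) (regular_distr T (zero_ext w))"
      show "\<forall>t\<in>Ico0 T. ?P t = ?W t"
      proof
        fix t assume t: "t \<in> Ico0 T"
        show "?P t = ?W t"
        proof (cases "t = 0")
          case False
          then have t0: "0 < t" using t by (auto simp: Ico0_def)
          \<comment> \<open>\<open>du_Bois_Reymond_half_line\<close> yields an inequality only;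
            applied to the difference and to its negative it yields equality.\<close>
          have "?P t - ?W t \<le> 0"
            using eq caputo_distr_eq_iff_tested[OF \<gamma> T u(1) w]
            by (intro du_Bois_Reymond_half_line[OF T PW _ t t0]) (auto simp: distr_eq_def)
          moreover have "- (?P t - ?W t) \<le> 0"
            using eq caputo_distr_eq_iff_tested[OF \<gamma> T u(1) w]
            by (intro du_Bois_Reymond_half_line[OF T continuous_on_minus[OF PW] _ t t0])
              (auto simp: distr_eq_def mult_minus_left simp del: minus_diff_eq)
          ultimately show ?thesis by simp
        qed auto
      qed
    qed
    finally have iff: "(\<forall>t\<in>Ico0 T. u t = u0 + rl \<gamma> w t) \<longleftrightarrow> distr_eq T (caputo_deriv \<gamma> T u0 u) (regular_distr T (zero_ext w))" .
    have loc: "loc_integrable T f" if f: "continuous_on (Ico0 T) f" for f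
      unfolding loc_integrable_def
    proof (intro allI impI)
      fix T' assume "0 < T'" "ereal T' < T"
      then have "{0..T'} \<subseteq> Ico0 T" by (intro Icc_subset_Ico0) (auto simp: Ico0_def)
      then show "f absolutely_integrable_on {0..T'}"
        using f by (intro absolutely_integrable_continuous_real) (auto elim: continuous_on_subset)
    qed
    have "((\<lambda>t. 1 / t * (LINT s:{0..t}|lebesgue. \<bar>u s - u0\<bar>)) \<longlongrightarrow> 0) (at_right 0)" if "u 0 = u0"
    proof -
      obtain S where S: "0 < S" "S \<in> Ico0 T" using T0 by (rule Ico0_less_exists)
      have c: "continuous_on {0..S} (\<lambda>s. \<bar>u s - u0\<bar>)" by (intro continuous_intros cS S)
      \<comment> \<open>The averaged initial condition is the derivative at 0 of a primitive whose
        integrand vanishes there.\<close>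
      have "((\<lambda>t. integral {0..t} (\<lambda>s. \<bar>u s - u0\<bar>)) has_real_derivative \<bar>u 0 - u0\<bar>) (at 0 within {0..S})"
        by (rule integral_has_real_derivative[OF c]) (use S in auto)
      then have "((\<lambda>t. integral {0..t} (\<lambda>s. \<bar>u s - u0\<bar>) / t) \<longlongrightarrow> 0) (at_right 0)"
        using S that by (simp add: has_field_derivative_iff at_within_Icc_at_right)
      then show ?thesis
      proof (rule Lim_transform_eventually)
        have "\<forall>\<^sub>F t in at_right 0. t \<in> {0<..<S}"
          using S(1) by (rule eventually_at_right_real)
        then show "\<forall>\<^sub>F t in at_right 0. integral {0..t} (\<lambda>s. \<bar>u s - u0\<bar>) / t =
            1 / t * (LINT s:{0..t}|lebesgue. \<bar>u s - u0\<bar>)"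
        proof (rule eventually_mono)
          fix t assume "t \<in> {0<..<S}"
          then have "continuous_on {0..t} (\<lambda>s. \<bar>u s - u0\<bar>)"
            using c by (auto elim: continuous_on_subset)
          then have "(LINT s:{0..t}|lebesgue. \<bar>u s - u0\<bar>) = integral {0..t} (\<lambda>s. \<bar>u s - u0\<bar>)"
            by (intro set_lebesgue_integral_eq_integral(2) absolutely_integrable_continuous_real)
          then show "integral {0..t} (\<lambda>s. \<bar>u s - u0\<bar>) / t = 1 / t * (LINT s:{0..t}|lebesgue. \<bar>u s - u0\<bar>)"
            by simp
        qed
      qed
    qed
    note avg = this
    have "?lhs \<longleftrightarrow> ?rhs"
    proof
      assume ?lhs
      then have "distr_eq T (caputo_deriv \<gamma> T u0 u) (regular_distr T (zero_ext w))"
        unfolding positive_solution_def strong_solution_def w_def by blast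
      then show ?rhs using iff u unfolding w_def by blast
    next
      assume rhs: ?rhs
      then have "\<forall>t\<in>Ico0 T. u t = u0 + rl \<gamma> w t" unfolding w_def by blast
      moreover from this have "u 0 = u0" using T0 by auto
      ultimately show ?lhs
        using iff loc[OF w] loc[OF u(1)] avg T u
        unfolding positive_solution_def strong_solution_def w_def by blast
    qed
  }
  then show ?thesis unfolding positive_solution_def by blast
qed

section \<open>Comparison, rate and continuation for Volterra equations\<close>

text \<open>Restarting at time h leaves the memory of [0, h] behind as an explicit integral; this
  term is the forcing in the comparison arguments.\<close>

lemma rl_shift:
  assumes "0 < a" "0 \<le> h" "0 \<le> t" "continuous_on {0..t + h} f"
  shows "rl a f (t + h) = integral {0..h} (\<lambda>s. (t + h - s) powr (a - 1) * f s) / Gamma a + rl a (\<lambda>s. f (s + h)) t"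
proof -
  have "integral {h..t + h} (\<lambda>s. (t + h - s) powr (a - 1) * f s) =
      integral {0..t} (\<lambda>s. (t - s) powr (a - 1) * f (s + h))"
    using integral_shift_real_ivl[of h h "t + h" "\<lambda>s. (t + h - s) powr (a - 1) * f s"] by simp
  then show ?thesis
    using assms by (subst integral_split_kernel[of a h "t + h" f]) (auto simp: rl_def add_divide_distrib)
qed

text \<open>One point has to be exempt: \<open>0 powr (\<gamma> - 1) = 0\<close>, so inequalities
  between kernels break down exactly at the singularity of the larger one.\<close>

lemma integral_le_off_point:
  fixes f g :: "real \<Rightarrow> real"
  assumes "f integrable_on {a..b}" "g integrable_on {a..b}"
    and le: "\<And>x. a \<le> x \<Longrightarrow> x \<le> b \<Longrightarrow> x \<noteq> c \<Longrightarrow> f x \<le> g x"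
  shows "integral {a..b} f \<le> integral {a..b} g"
proof -
  let ?f = "\<lambda>x. if x = c then g x else f x"
  have "integral {a..b} ?f = integral {a..b} f"
    by (rule integral_spike[of "{c}"]) auto
  moreover have "integral {a..b} ?f \<le> integral {a..b} g"
  proof (rule integral_le)
    show "?f integrable_on {a..b}"
      by (rule integrable_spike[OF assms(1), of "{c}"]) auto
    show "?f x \<le> g x" if "x \<in> {a..b}" for x using le[of x] that by simp
  qed fact
  ultimately show ?thesis by simp
qed

lemma first_zero:
  fixes d :: "real \<Rightarrow> real"
  assumes "continuous_on {0..S} d" "0 < d 0" "0 \<le> t" "t \<le> S" "d t \<le> 0"
  obtains t0 where "0 < t0" "t0 \<le> S" "d t0 = 0" "\<And>s. 0 \<le> s \<Longrightarrow> s < t0 \<Longrightarrow> 0 < d s"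
proof -
  have zero: "\<exists>r. 0 \<le> r \<and> r \<le> s \<and> d r = 0" if "0 \<le> s" "s \<le> S" "d s \<le> 0" for s
  proof -
    have "continuous_on {0..s} d" using assms(1) that by (auto elim: continuous_on_subset)
    then show ?thesis using IVT2'[of d s 0 0] that assms(2) by auto
  qed
  define Z where "Z = {r\<in>{0..S}. d r = 0}"
  have "closed Z"
    unfolding Z_def by (rule continuous_closed_preimage_constant[OF assms(1)]) simp
  moreover have "{0..S} \<inter> Z = Z" by (auto simp: Z_def)
  ultimately have "compact Z"
    using compact_Int_closed[of "{0..S}" Z] by simp
  moreover have "Z \<noteq> {}"
  proof -
    obtain r where "0 \<le> r" "r \<le> t" "d r = 0" using zero[OF assms(3-5)] by blast
    then have "r \<in> Z" using assms(4) by (simp add: Z_def)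
    then show ?thesis by blast
  qed
  ultimately obtain t0 where t0: "t0 \<in> Z" "\<And>r. r \<in> Z \<Longrightarrow> t0 \<le> r"
    using compact_attains_inf by metis
  have "0 < d s" if s: "0 \<le> s" "s < t0" for s
  proof (rule ccontr)
    assume "\<not> 0 < d s"
    moreover have "s \<le> S" using t0(1) that by (simp add: Z_def)
    ultimately obtain r where "0 \<le> r" "r \<le> s" "d r = 0" using zero[of s] s by auto
    then show False using t0(2)[of r] \<open>s \<le> S\<close> that by (simp add: Z_def)
  qed
  moreover have "t0 \<noteq> 0" using t0(1) assms(2) by (auto simp: Z_def)
  ultimately show ?thesis using t0(1) that[of t0] by (auto simp: Z_def)
qed

text \<open>Log-convexity of the kernel: when time advances from \<open>t\<close> to \<open>t0\<close>, contributions from the more distant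
  past lose less of their weight.\<close>

lemma kernel_ratio:
  fixes t t0 s \<gamma> :: real
  assumes "\<gamma> < 1" "0 < t" "t \<le> t0"
  shows "s \<le> 0 \<Longrightarrow> (t / t0) powr (1 - \<gamma>) * (t - s) powr (\<gamma> - 1) \<le> (t0 - s) powr (\<gamma> - 1)"
    and "0 \<le> s \<Longrightarrow> s < t \<Longrightarrow> (t0 - s) powr (\<gamma> - 1) \<le> (t / t0) powr (1 - \<gamma>) * (t - s) powr (\<gamma> - 1)"
proof -
  have eq: "(t0 - s) powr (\<gamma> - 1) = ((t - s) / (t0 - s)) powr (1 - \<gamma>) * (t - s) powr (\<gamma> - 1)" if "s < t"
  proof -
    have "(t - s) powr (1 - \<gamma>) * (t - s) powr (\<gamma> - 1) = 1"
      using that by (simp flip: powr_add)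
    moreover have "(t0 - s) powr (\<gamma> - 1) = 1 / (t0 - s) powr (1 - \<gamma>)"
      using powr_minus_divide[of "t0 - s" "1 - \<gamma>"] by simp
    ultimately show ?thesis
      using that assms by (simp add: powr_divide)
  qed
  {
    assume s: "s \<le> 0"
    then have "t / t0 \<le> (t - s) / (t0 - s)"
      using assms mult_right_mono_neg[of t t0 s] by (simp add: field_simps)
    then show "(t / t0) powr (1 - \<gamma>) * (t - s) powr (\<gamma> - 1) \<le> (t0 - s) powr (\<gamma> - 1)"
      using s assms by (subst eq) (auto intro!: mult_right_mono powr_mono2)
  next
    assume s: "0 \<le> s" "s < t"
    then have "(t - s) / (t0 - s) \<le> t / t0"
      using assms mult_right_mono[of t t0 s] by (simp add: field_simps)
    then show "(t0 - s) powr (\<gamma> - 1) \<le> (t / t0) powr (1 - \<gamma>) * (t - s) powr (\<gamma> - 1)"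
      using s assms by (subst eq) (auto intro!: mult_right_mono powr_mono2)
  }
qed

text \<open>Over a step of length e, a damping term with rate B can change a solution by at most a
  quarter of its size. A quarter suffices because the next proof compares it with 1/2.\<close>

lemma small_step_exists:
  fixes \<gamma> B t0 :: real
  assumes "0 < \<gamma>" "0 \<le> B" "0 < t0"
  obtains e where "0 < e" "e \<le> t0" "B * e powr \<gamma> / Gamma (\<gamma> + 1) \<le> 1 / 4"
proof -
  define c where "c = Gamma (\<gamma> + 1) / (4 * (B + 1))"
  have G: "0 < Gamma (\<gamma> + 1)" using assms by (intro Gamma_real_pos) simp
  then have c: "0 < c" using assms by (simp add: c_def)
  define e where "e = min t0 (c powr (1 / \<gamma>))"
  have "e powr \<gamma> \<le> (c powr (1 / \<gamma>)) powr \<gamma>"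
    using assms c by (intro powr_mono2) (auto simp: e_def)
  also have "\<dots> = c" using assms c by (simp add: powr_powr)
  finally have "B * e powr \<gamma> \<le> B * c" using assms by (intro mult_left_mono)
  also have "\<dots> \<le> 1 / 4 * Gamma (\<gamma> + 1)" using G assms by (simp add: c_def field_simps)
  finally have "B * e powr \<gamma> / Gamma (\<gamma> + 1) \<le> 1 / 4" using G by (simp add: pos_divide_le_eq)
  then show ?thesis using that[of e] assms c by (simp add: e_def)
qed

text \<open>Suppose d first vanishes at t0, and let x maximise d on a short interval that ends at
  t0. With \<rho> = (x / t0) powr (1 - \<gamma>), the forcing at t0 is at least the share \<rho> of
  its value at x, whereas the damping accumulated up to x keeps at most that share, by
  \<open>kernel_ratio\<close>. Hence d t0 is at least \<rho> * d x minus the damping added on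
  [x, t0]; the latter is at most d x / 4, while \<rho> is at least 1/2. The hypothesis on q says
  that t powr (1 - \<gamma>) * q t does not decrease.\<close>

lemma volterra_positive_of_growing_forcing:
  fixes d q e :: "real \<Rightarrow> real"
  assumes \<gamma>: "0 < \<gamma>" "\<gamma> < 1" and c: "continuous_on {0..S} d" "continuous_on {0..S} e"
    and "0 \<le> B" "0 < d 0"
    and eq: "\<And>t. 0 \<le> t \<Longrightarrow> t \<le> S \<Longrightarrow> d t = q t - rl \<gamma> e t"
    and q: "\<And>s t. 0 < s \<Longrightarrow> s \<le> t \<Longrightarrow> t \<le> S \<Longrightarrow> (s / t) powr (1 - \<gamma>) * q s \<le> q t"
    and e: "\<And>t. 0 \<le> t \<Longrightarrow> t \<le> S \<Longrightarrow> 0 \<le> d t \<Longrightarrow> 0 \<le> e t \<and> e t \<le> B * d t"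
    and t: "0 \<le> t" "t \<le> S"
  shows "0 < d t"
proof (rule ccontr)
  assume "\<not> 0 < d t"
  then obtain t0 where t0: "0 < t0" "t0 \<le> S" "d t0 = 0" "\<And>s. 0 \<le> s \<Longrightarrow> s < t0 \<Longrightarrow> 0 < d s"
    using first_zero[OF c(1) assms(6) t] by (metis linorder_not_less)
  \<comment> \<open>With h at most t0 / 2 the quotient x / t0, and hence \<rho>, is at least
    1/2.\<close>
  obtain h where h: "0 < h" "h \<le> t0 / 2" "B * h powr \<gamma> / Gamma (\<gamma> + 1) \<le> 1 / 4"
    using small_step_exists[of \<gamma> B "t0 / 2"] assms t0 by auto
  have "\<exists>x\<in>{t0 - h..t0}. \<forall>y\<in>{t0 - h..t0}. d y \<le> d x"
    using h t0 by (intro continuous_attains_sup continuous_on_subset[OF c(1)]) auto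
  then obtain x where x: "t0 - h \<le> x" "x \<le> t0" "\<And>y. t0 - h \<le> y \<Longrightarrow> y \<le> t0 \<Longrightarrow> d y \<le> d x" by auto
  have dx: "0 < d x" using x(3)[of "t0 - h"] t0(4)[of "t0 - h"] h by linarith
  have x0: "0 < x" "x < t0" "x \<le> S" using x h t0 dx by (auto simp: less_le)
  have nn: "0 \<le> e s" "e s \<le> B * d s" if "0 \<le> s" "s \<le> t0" for s
    using e[of s] t0(2,3) t0(4)[of s] that by (cases "s = t0"; force)+
  define \<rho> where "\<rho> = (x / t0) powr (1 - \<gamma>)"
  have "1 / 2 \<le> x / t0" using x h t0 by (simp add: field_simps)
  then have "(1 / 2) powr (1 - \<gamma>) \<le> \<rho>"
    unfolding \<rho>_def using \<gamma> by (intro powr_mono2) auto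
  moreover have "(1 / 2) powr 1 \<le> (1 / 2 :: real) powr (1 - \<gamma>)"
    using \<gamma> by (intro powr_mono') auto
  ultimately have \<rho>: "1 / 2 \<le> \<rho>" by simp
  have G: "0 < Gamma \<gamma>" using \<gamma> by simp
  have ct0: "continuous_on {0..t0} e" and cx: "continuous_on {0..x} e"
    using c(2) t0 x0 by (auto elim: continuous_on_subset)
  let ?K = "\<lambda>t s. (t - s) powr (\<gamma> - 1) * e s"
  have "integral {0..x} (?K t0) \<le> integral {0..x} (\<lambda>s. \<rho> * ?K x s)"
  proof (rule integral_le_off_point[where c = x])
    show "?K t0 integrable_on {0..x}"
      using x0 by (intro integrable_kernel \<gamma> cx) auto
    show "(\<lambda>s. \<rho> * ?K x s) integrable_on {0..x}"
      by (intro integrable_on_mult_right integrable_kernel \<gamma> cx) auto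
    fix s assume "0 \<le> s" "s \<le> x" "s \<noteq> x"
    then have "?K t0 s \<le> \<rho> * (x - s) powr (\<gamma> - 1) * e s"
      unfolding \<rho>_def using nn[of s] x0 \<gamma> by (intro mult_right_mono kernel_ratio) auto
    then show "?K t0 s \<le> \<rho> * ?K x s" by (simp only: mult.assoc)
  qed
  also have "\<dots> = Gamma \<gamma> * (\<rho> * rl \<gamma> e x)"
    using G by (simp add: rl_def)
  finally have 1: "integral {0..x} (?K t0) \<le> Gamma \<gamma> * (\<rho> * rl \<gamma> e x)" .
  have cs: "continuous_on {0..t0 - x} (\<lambda>s. e (s + x))"
    using x0 by (intro continuous_on_compose2[OF ct0] continuous_intros) auto
  have "rl \<gamma> (\<lambda>s. e (s + x)) (t0 - x) \<le> rl \<gamma> (\<lambda>_. B * d x) (t0 - x)"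
  proof (rule rl_mono[OF \<gamma>(1) cs continuous_on_const])
    fix s assume s: "0 \<le> s" "s \<le> t0 - x"
    have "e (s + x) \<le> B * d (s + x)" using nn(2)[of "s + x"] s x0 by simp
    also have "\<dots> \<le> B * d x" using x(3)[of "s + x"] s x(1) assms(5) by (intro mult_left_mono) auto
    finally show "e (s + x) \<le> B * d x" .
  qed
  also have "\<dots> = B * d x * (t0 - x) powr \<gamma> / Gamma (\<gamma> + 1)"
    using x0 \<gamma> by (simp add: rl_const)
  also have "\<dots> \<le> B * d x * h powr \<gamma> / Gamma (\<gamma> + 1)"
    using x(1) x0 \<gamma> dx assms(5) by (intro divide_right_mono mult_left_mono powr_mono2) (auto simp: Gamma_real_nonneg)
  also have "\<dots> = B * h powr \<gamma> / Gamma (\<gamma> + 1) * d x" by simp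
  also have "\<dots> \<le> 1 / 4 * d x"
    using h dx by (intro mult_right_mono) auto
  finally have 2: "rl \<gamma> (\<lambda>s. e (s + x)) (t0 - x) \<le> 1 / 4 * d x" .
  have "rl \<gamma> e t0 = integral {0..x} (?K t0) / Gamma \<gamma> + rl \<gamma> (\<lambda>s. e (s + x)) (t0 - x)"
    using rl_shift[of \<gamma> x "t0 - x" e] \<gamma> x0 ct0 by simp
  moreover have "integral {0..x} (?K t0) / Gamma \<gamma> \<le> \<rho> * rl \<gamma> e x"
    using 1 G by (simp add: pos_divide_le_eq mult.commute)
  ultimately have "rl \<gamma> e t0 \<le> \<rho> * rl \<gamma> e x + 1 / 4 * d x" using 2 by linarith
  moreover have "\<rho> * q x \<le> q t0"
    unfolding \<rho>_def using q[of x t0] x0 t0 by simp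
  moreover have "\<rho> * d x = \<rho> * q x - \<rho> * rl \<gamma> e x"
    using eq[of x] x0 by (simp add: right_diff_distrib)
  moreover have "1 / 2 * d x \<le> \<rho> * d x" using \<rho> dx by (intro mult_right_mono) auto
  moreover have "d t0 = q t0 - rl \<gamma> e t0" using eq[of t0] t0 by simp
  ultimately show False using dx t0(3) by linarith
qed

text \<open>The increment d of u over a time h equals the memory q of [0, h] minus the fractional
  integral of e, the drop of g over h. If g grows with u, then e is nonpositive as long as d is
  nonnegative, and q alone keeps d from vanishing. If g decreases with u, then e damps d, and
  \<open>volterra_positive_of_growing_forcing\<close> applies. Monotonicity of g is phrased along
  the values of u so that the lemma also fits a reflected solution.\<close>

lemma volterra_strict_increasing:
  fixes u g :: "real \<Rightarrow> real"
  assumes \<gamma>: "0 < \<gamma>" "\<gamma> < 1" and c: "continuous_on {0..S} u" "continuous_on {0..S} g"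
    and u: "\<And>t. 0 \<le> t \<Longrightarrow> t \<le> S \<Longrightarrow> u t = u0 + rl \<gamma> g t"
    and g: "\<And>t. 0 \<le> t \<Longrightarrow> t \<le> S \<Longrightarrow> 0 < g t"
    and B: "0 \<le> B" "\<And>s t. 0 \<le> s \<Longrightarrow> s \<le> S \<Longrightarrow> 0 \<le> t \<Longrightarrow> t \<le> S \<Longrightarrow> \<bar>g s - g t\<bar> \<le> B * \<bar>u s - u t\<bar>"
    and mon: "(\<forall>s\<in>{0..S}. \<forall>t\<in>{0..S}. u s \<le> u t \<longrightarrow> g s \<le> g t) \<or>
      (\<forall>s\<in>{0..S}. \<forall>t\<in>{0..S}. u s \<le> u t \<longrightarrow> g t \<le> g s)"
    and t: "0 \<le> t1" "t1 < t2" "t2 \<le> S"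
  shows "u t1 < u t2"
proof -
  define h where "h = t2 - t1"
  define d where "d = (\<lambda>t. u (t + h) - u t)"
  define q where "q = (\<lambda>t. integral {0..h} (\<lambda>s. (t + h - s) powr (\<gamma> - 1) * g s) / Gamma \<gamma>)"
  define e where "e = (\<lambda>t. g t - g (t + h))"
  define R where "R = S - h"
  have h: "0 < h" "0 \<le> R" "R + h = S" using t by (auto simp: h_def R_def)
  have G: "0 < Gamma \<gamma>" using \<gamma> by simp
  have gh: "continuous_on {0..h} g" using c(2) h by (auto elim: continuous_on_subset)
  have cs: "continuous_on {0..R} (\<lambda>t. f (t + h))" "continuous_on {0..R} f"
    if "continuous_on {0..S} f" for f :: "real \<Rightarrow> real"
    using that h by (auto intro!: continuous_on_compose2[OF that] continuous_intros elim: continuous_on_subset)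
  have dc: "continuous_on {0..R} d" and ec: "continuous_on {0..R} e"
    unfolding d_def e_def by (intro continuous_intros cs c)+
  obtain m where m: "0 < m" "\<And>t. 0 \<le> t \<Longrightarrow> t \<le> S \<Longrightarrow> m \<le> g t"
  proof -
    have "\<exists>x\<in>{0..S}. \<forall>y\<in>{0..S}. g x \<le> g y"
      by (rule continuous_attains_inf) (use c t in auto)
    then show ?thesis using that g by (meson atLeastAtMost_iff)
  qed
  have deq: "d t = q t - rl \<gamma> e t" if tt: "0 \<le> t" "t \<le> R" for t
  proof -
    have "continuous_on {0..t + h} g" using c(2) tt h by (auto elim: continuous_on_subset)
    then have "rl \<gamma> g (t + h) = q t + rl \<gamma> (\<lambda>s. g (s + h)) t"
      unfolding q_def using \<gamma> h tt by (intro rl_shift) auto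
    moreover have "rl \<gamma> e t = rl \<gamma> g t - rl \<gamma> (\<lambda>s. g (s + h)) t"
      unfolding e_def using tt
      by (intro rl_diff \<gamma> continuous_on_subset[OF cs(1)[OF c(2)]] continuous_on_subset[OF cs(2)[OF c(2)]]) auto
    ultimately show ?thesis using u[of t] u[of "t + h"] tt h by (simp add: d_def)
  qed
  have qpos: "0 < q t" if "0 < t" for t
  proof -
    have "integral {0..h} (\<lambda>s. (t + h) powr (\<gamma> - 1) * m) \<le> integral {0..h} (\<lambda>s. (t + h - s) powr (\<gamma> - 1) * g s)"
    proof (rule integral_le)
      show "(\<lambda>s. (t + h - s) powr (\<gamma> - 1) * g s) integrable_on {0..h}"
        using that by (intro integrable_kernel \<gamma> gh) auto
      fix s assume s: "s \<in> {0..h}"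
      show "(t + h) powr (\<gamma> - 1) * m \<le> (t + h - s) powr (\<gamma> - 1) * g s"
        using s that m(1) m(2)[of s] h \<gamma> by (intro mult_mono powr_mono2') auto
    qed auto
    moreover have "0 < (t + h) powr (\<gamma> - 1) * m * h" using m h that by simp
    ultimately show ?thesis using G h by (simp add: q_def mult_ac)
  qed
  have "0 < d 0"
  proof -
    have "0 < m * h powr \<gamma> / Gamma (\<gamma> + 1)" using m h \<gamma> by (simp add: Gamma_real_pos)
    also have "\<dots> = rl \<gamma> (\<lambda>_. m) h" using rl_const[of \<gamma> h m] \<gamma> h by simp
    also have "\<dots> \<le> rl \<gamma> g h"
      using m(2) h by (intro rl_mono \<gamma> gh continuous_intros) auto
    finally show ?thesis using u[of h] u[of 0] h by (simp add: d_def)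
  qed
  have "0 < d t1"
  proof (cases "\<forall>s\<in>{0..S}. \<forall>t\<in>{0..S}. u s \<le> u t \<longrightarrow> g t \<le> g s")
    case True
    show ?thesis
    proof (rule volterra_positive_of_growing_forcing[OF \<gamma> dc ec B(1) \<open>0 < d 0\<close> deq])
      fix s t assume st: "0 < s" "s \<le> t" "t \<le> R"
      have "integral {0..h} (\<lambda>r. (s / t) powr (1 - \<gamma>) * ((s + h - r) powr (\<gamma> - 1) * g r)) \<le>
          integral {0..h} (\<lambda>r. (t + h - r) powr (\<gamma> - 1) * g r)"
      proof (rule integral_le)
        show "(\<lambda>r. (s / t) powr (1 - \<gamma>) * ((s + h - r) powr (\<gamma> - 1) * g r)) integrable_on {0..h}"
          using st by (intro integrable_on_mult_right integrable_kernel \<gamma> gh) auto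
        show "(\<lambda>r. (t + h - r) powr (\<gamma> - 1) * g r) integrable_on {0..h}"
          using st by (intro integrable_kernel \<gamma> gh) auto
        fix r assume r: "r \<in> {0..h}"
        \<comment> \<open>In shifted time the memory sits at r - h \<le> 0, the side of
          \<open>kernel_ratio\<close> on which the weight fades slowly.\<close>
        have "(s / t) powr (1 - \<gamma>) * (s - (r - h)) powr (\<gamma> - 1) \<le> (t - (r - h)) powr (\<gamma> - 1)"
          using st r \<gamma> by (intro kernel_ratio) auto
        then have "(s / t) powr (1 - \<gamma>) * (s + h - r) powr (\<gamma> - 1) * g r \<le> (t + h - r) powr (\<gamma> - 1) * g r"
          using g[of r] r h by (intro mult_right_mono) (auto simp: algebra_simps)
        then show "(s / t) powr (1 - \<gamma>) * ((s + h - r) powr (\<gamma> - 1) * g r) \<le> (t + h - r) powr (\<gamma> - 1) * g r"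
          by (simp only: mult.assoc)
      qed
      then show "(s / t) powr (1 - \<gamma>) * q s \<le> q t"
        using G by (simp add: q_def divide_right_mono)
    next
      fix t assume tt: "0 \<le> t" "t \<le> R" "0 \<le> d t"
      then have "g (t + h) \<le> g t" using True h by (auto simp: d_def)
      moreover have "\<bar>g t - g (t + h)\<bar> \<le> B * \<bar>u t - u (t + h)\<bar>"
        using tt h by (intro B(2)) auto
      ultimately show "0 \<le> e t \<and> e t \<le> B * d t"
        using tt by (auto simp: e_def d_def)
    qed (use t in \<open>auto simp: R_def h_def\<close>)
  next
    case False
    with mon have mono: "\<And>s t. s \<in> {0..S} \<Longrightarrow> t \<in> {0..S} \<Longrightarrow> u s \<le> u t \<Longrightarrow> g s \<le> g t" by blast
    show ?thesis
    proof (rule ccontr)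
      assume "\<not> 0 < d t1"
      moreover have "t1 \<le> R" using t by (simp add: R_def h_def)
      ultimately obtain t0 where t0: "0 < t0" "t0 \<le> R" "d t0 = 0" "\<And>s. 0 \<le> s \<Longrightarrow> s < t0 \<Longrightarrow> 0 < d s"
        using first_zero[OF dc \<open>0 < d 0\<close> t(1)] by (metis linorder_not_less)
      have "0 \<le> rl \<gamma> (\<lambda>s. - e s) t0"
      proof (rule rl_nonneg[OF \<gamma>(1)])
        show "continuous_on {0..t0} (\<lambda>s. - e s)"
          using ec t0 by (auto intro!: continuous_intros elim: continuous_on_subset)
        fix s assume s: "0 \<le> s" "s \<le> t0"
        then have "0 \<le> d s" using t0(3) t0(4)[of s] by (cases "s = t0") auto
        then show "0 \<le> - e s" using mono[of s "s + h"] s t0 h by (auto simp: d_def e_def)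
      qed
      then show False using deq[of t0] qpos[of t0] t0 by (simp add: rl_minus)
    qed
  qed
  then show ?thesis by (simp add: d_def h_def)
qed

text \<open>With z = u - u0, the function g is the derivative of \<open>rl (1 - \<gamma>) z\<close>.
  Formally this is the integral of (t - s) powr (- \<gamma>) / \<Gamma>(1 - \<gamma>) against the
  measure dz, and bounding the kernel below by its value at s = 0 gives the claim. The proof works
  with the integrated form of this idea: dz is replaced by the difference of z and its delay
  Z.\<close>

lemma volterra_rate_lower_bound:
  fixes u g :: "real \<Rightarrow> real"
  assumes \<gamma>: "0 < \<gamma>" "\<gamma> < 1" and c: "continuous_on {0..t} u" "continuous_on {0..t} g" and "0 < t"
    and u: "\<And>s. 0 \<le> s \<Longrightarrow> s \<le> t \<Longrightarrow> u s = u0 + rl \<gamma> g s"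
    and mono: "\<And>r s. 0 \<le> r \<Longrightarrow> r \<le> s \<Longrightarrow> s \<le> t \<Longrightarrow> u r \<le> u s"
  shows "(u t - u0) * (t powr (- \<gamma>) / Gamma (1 - \<gamma>)) \<le> g t"
proof (rule ccontr)
  define k where "k = t powr (- \<gamma>) / Gamma (1 - \<gamma>)"
  define z where "z = (\<lambda>s. u s - u0)"
  have zc: "continuous_on {0..t} z" unfolding z_def by (intro continuous_intros c)
  have z0: "z 0 = 0" using u[of 0] \<open>0 < t\<close> by (simp add: z_def)
  have G: "0 < Gamma (1 - \<gamma>)" using \<gamma> by simp
  have inv: "rl (1 - \<gamma>) z s = integral {0..s} g" if "0 \<le> s" "s \<le> t" for s
    using caputo_inverse_rl[OF \<gamma> c \<open>0 < t\<close>, of u0] u that unfolding z_def by auto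
  define H where "H = (\<lambda>x. integral {0..x} (\<lambda>s. g s - k * z s))"
  have le: "H a \<le> H t" if a: "0 \<le> a" "a < t" for a
  proof -
    define \<delta> where "\<delta> = t - a"
    \<comment> \<open>Z is z delayed by \<delta>, starting from 0. Its fractional integrals at t are
      those of z at a, whatever the order, so increments of \<open>rl b z\<close> from a to t become
      integrals of z - Z, which is nonnegative because u is monotone.\<close>
    define Z where "Z = (\<lambda>s. z (max 0 (s - \<delta>)))"
    have Zc: "continuous_on {0..t} Z"
      unfolding Z_def using a by (intro continuous_on_compose2[OF zc] continuous_intros) (auto simp: \<delta>_def)
    have ac: "continuous_on {0..a} g" "continuous_on {0..a} z"
      using a c zc by (auto elim: continuous_on_subset)
    have ZI: "rl b Z t = rl b z a" if "0 < b" for b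
    proof -
      have "rl b Z (a + \<delta>) = integral {0..\<delta>} (\<lambda>s. (a + \<delta> - s) powr (b - 1) * Z s) / Gamma b + rl b (\<lambda>s. Z (s + \<delta>)) a"
        using that a Zc by (intro rl_shift) (auto simp: \<delta>_def)
      moreover have "integral {0..\<delta>} (\<lambda>s. (a + \<delta> - s) powr (b - 1) * Z s) = integral {0..\<delta>} (\<lambda>s. 0)"
        by (rule integral_cong) (auto simp: Z_def z0 max_def)
      moreover have "rl b (\<lambda>s. Z (s + \<delta>)) a = rl b z a"
        by (rule rl_cong) (auto simp: Z_def)
      ultimately show ?thesis by (simp add: \<delta>_def)
    qed
    have dnn: "0 \<le> z s - Z s" if "0 \<le> s" "s \<le> t" for s
      using mono[of "max 0 (s - \<delta>)" s] that a by (auto simp: Z_def z_def \<delta>_def)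
    have dc: "continuous_on {0..t} (\<lambda>s. z s - Z s)" by (intro continuous_intros zc Zc)
    have "integral {0..t} (\<lambda>s. t powr (- \<gamma>) * (z s - Z s)) \<le> integral {0..t} (\<lambda>s. (t - s) powr (1 - \<gamma> - 1) * (z s - Z s))"
    proof (rule integral_le_off_point[where c = t])
      show "(\<lambda>s. t powr (- \<gamma>) * (z s - Z s)) integrable_on {0..t}"
        by (intro integrable_continuous_real continuous_intros dc zc Zc)
      show "(\<lambda>s. (t - s) powr (1 - \<gamma> - 1) * (z s - Z s)) integrable_on {0..t}"
        using \<gamma> by (intro integrable_kernel dc) auto
      fix s assume "0 \<le> s" "s \<le> t" "s \<noteq> t"
      then show "t powr (- \<gamma>) * (z s - Z s) \<le> (t - s) powr (1 - \<gamma> - 1) * (z s - Z s)"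
        using dnn[of s] \<gamma> by (intro mult_right_mono) (auto intro!: powr_mono2')
    qed
    then have "k * rl 1 (\<lambda>s. z s - Z s) t \<le> rl (1 - \<gamma>) (\<lambda>s. z s - Z s) t"
      unfolding rl_one using G by (simp add: k_def rl_def divide_right_mono)
    then have "k * (rl 1 z t - rl 1 Z t) \<le> rl (1 - \<gamma>) z t - rl (1 - \<gamma>) Z t"
      using \<gamma> by (simp add: rl_diff zc Zc)
    then have "k * (rl 1 z t - rl 1 z a) \<le> integral {0..t} g - integral {0..a} g"
      using \<gamma> a by (simp add: ZI inv)
    moreover have "H x = integral {0..x} g - k * rl 1 z x"
      if "continuous_on {0..x} g" "continuous_on {0..x} z" for x
    proof -
      have "H x = integral {0..x} g - integral {0..x} (\<lambda>s. k * z s)"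
        unfolding H_def by (intro integral_diff integrable_continuous_real continuous_intros that)
      then show ?thesis by (simp add: rl_one)
    qed
    ultimately show ?thesis using ac c zc by (simp add: right_diff_distrib)
  qed
  assume "\<not> (u t - u0) * (t powr (- \<gamma>) / Gamma (1 - \<gamma>)) \<le> g t"
  then have neg: "g t - k * z t < 0" by (simp add: k_def z_def mult_ac)
  \<comment> \<open>If the left derivative of H at t were negative, H would exceed H t just before
    t, against \<open>le\<close>.\<close>
  have "(H has_real_derivative (g t - k * z t)) (at t within {0..t})"
    unfolding H_def using \<open>0 < t\<close> by (intro integral_has_real_derivative continuous_intros c zc) auto
  from has_real_derivative_neg_dec_left[OF this neg]
  obtain d where d: "0 < d" "\<And>h. 0 < h \<Longrightarrow> t - h \<in> {0..t} \<Longrightarrow> h < d \<Longrightarrow> H t < H (t - h)" by blast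
  define h where "h = min (d / 2) t"
  have "H t < H (t - h)" using d(1) \<open>0 < t\<close> by (intro d(2)) (auto simp: h_def)
  moreover have "H (t - h) \<le> H t" using d(1) \<open>0 < t\<close> by (intro le) (auto simp: h_def)
  ultimately show False by simp
qed

section \<open>Continuation of solutions bounded away from zero and infinity\<close>

text \<open>Clamping the argument to [m / 2, 2 * M] makes the nonlinearity globally Lipschitz, so
  the clamped equation has a solution v up to T + 1. It agrees with u before T by uniqueness, and
  the margins m / 2 and 2 * M keep the clamp inactive a little beyond T, which contradicts
  maximality. Because of the memory, v is solved from time 0 and not continued from T.\<close>

lemma volterra_clamped_extension:
  assumes \<gamma>: "0 < \<gamma>" "\<gamma> < 1" and max: "maximal_positive_solution \<gamma> (\<lambda>t x. A * x powr p) u0 (ereal T) u"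
    and "0 < m" and bd: "\<And>t. t \<in> Ico0 (ereal T) \<Longrightarrow> m \<le> u t \<and> u t \<le> M"
  shows False
proof -
  have Fc: "continuous_on {0<..} (\<lambda>x. A * x powr p)" by (intro continuous_intros) auto
  have pos: "positive_solution \<gamma> (\<lambda>t x. A * x powr p) u0 (ereal T) u"
    using max by (simp add: maximal_positive_solution_def)
  then have T: "0 < ereal T" by (simp add: positive_solution_def)
  then have T0: "0 < T" by simp
  note iff = positive_solution_iff_volterra[OF \<gamma> _ Fc]
  have uc: "continuous_on (Ico0 (ereal T)) u"
    and u: "\<And>t. t \<in> Ico0 (ereal T) \<Longrightarrow> u t = u0 + rl \<gamma> (\<lambda>s. A * u s powr p) t"
    using pos iff[OF T] by auto
  have "m \<le> M" using bd[of 0] T0 by (force simp: Ico0_def)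
  define F where "F = (\<lambda>x. A * (max (m / 2) (min (2 * M) x)) powr p)"
  have F_eq: "F x = A * x powr p" if "m / 2 \<le> x" "x \<le> 2 * M" for x
    using that by (simp add: F_def)
  obtain B where B: "0 \<le> B" "\<And>x y. m / 2 \<le> x \<Longrightarrow> x \<le> 2 * M \<Longrightarrow> m / 2 \<le> y \<Longrightarrow> y \<le> 2 * M \<Longrightarrow>
      \<bar>x powr p - y powr p\<bar> \<le> B * \<bar>x - y\<bar>"
    using powr_Lipschitz[of "m / 2" "2 * M" p] \<open>0 < m\<close> by auto
  have FB: "\<bar>F x - F y\<bar> \<le> \<bar>A\<bar> * B * \<bar>x - y\<bar>" for x y
  proof -
    let ?x = "max (m / 2) (min (2 * M) x)" and ?y = "max (m / 2) (min (2 * M) y)"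
    have "\<bar>F x - F y\<bar> = \<bar>A\<bar> * \<bar>?x powr p - ?y powr p\<bar>"
      by (simp add: F_def flip: right_diff_distrib abs_mult)
    also have "\<dots> \<le> \<bar>A\<bar> * (B * \<bar>?x - ?y\<bar>)"
      using \<open>m \<le> M\<close> \<open>0 < m\<close> by (intro mult_left_mono B) auto
    also have "\<dots> \<le> \<bar>A\<bar> * (B * \<bar>x - y\<bar>)"
      using B(1) by (intro mult_left_mono) auto
    finally show ?thesis by (simp only: mult.assoc)
  qed
  have FC: "continuous_on UNIV F"
    unfolding F_def using \<open>0 < m\<close> by (intro continuous_intros) auto
  obtain v where vc: "continuous_on {0..T + 1} v"
    and v: "\<And>t. 0 \<le> t \<Longrightarrow> t \<le> T + 1 \<Longrightarrow> v t = u0 + rl \<gamma> (\<lambda>s. F (v s)) t"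
    using volterra_exists[of \<gamma> "\<bar>A\<bar> * B" "T + 1" F u0] \<gamma> B(1) T0 FB FC by auto
  have uF: "u t = u0 + rl \<gamma> (\<lambda>s. F (u s)) t" if t: "t \<in> Ico0 (ereal T)" for t
  proof -
    have "rl \<gamma> (\<lambda>s. A * u s powr p) t = rl \<gamma> (\<lambda>s. F (u s)) t"
    proof (rule rl_cong)
      fix s assume "0 < s" "s \<le> t"
      then have "m \<le> u s" "u s \<le> M" using bd Ico0_down[OF t, of s] by auto
      then show "A * u s powr p = F (u s)" using F_eq[of "u s"] \<open>0 < m\<close> \<open>m \<le> M\<close> by simp
    qed
    then show ?thesis using u[OF t] by simp
  qed
  have vu: "v t = u t" if t: "t \<in> Ico0 (ereal T)" for t
  proof (rule volterra_unique[of \<gamma> "\<bar>A\<bar> * B" t v u F u0 t])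
    have tT: "0 \<le> t" "t < T" using t by (auto simp: Ico0_def)
    show "continuous_on {0..t} v" using vc tT by (auto elim: continuous_on_subset)
    show "continuous_on {0..t} u" using uc Icc_subset_Ico0[OF t] by (rule continuous_on_subset)
    show "v s = u0 + rl \<gamma> (\<lambda>s. F (v s)) s" if "0 \<le> s" "s \<le> t" for s
      using v[of s] that tT by simp
    show "u s = u0 + rl \<gamma> (\<lambda>s. F (u s)) s" if "0 \<le> s" "s \<le> t" for s
      using uF Ico0_down[OF t that] by blast
    show "0 \<le> t" "t \<le> t" using tT by auto
  qed (use \<gamma> B FB FC in auto)
  have isC: "isCont v T"
    by (rule continuous_on_interior[OF vc]) (use T0 in auto)
  then have lim: "(v \<longlongrightarrow> v T) (at_left T)"
    unfolding isCont_def by (rule tendsto_mono[rotated]) (simp add: at_le)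
  have ev: "\<forall>\<^sub>F t in at_left T. m \<le> v t \<and> v t \<le> M"
    using eventually_at_left_real[OF T0]
  proof (rule eventually_mono)
    fix t assume "t \<in> {0<..<T}"
    then have "t \<in> Ico0 (ereal T)" by (simp add: Ico0_def)
    then show "m \<le> v t \<and> v t \<le> M" using vu bd by simp
  qed
  have "m \<le> v T"
    by (rule tendsto_lowerbound[OF lim eventually_mono[OF ev]]) auto
  moreover have "v T \<le> M"
    by (rule tendsto_upperbound[OF lim eventually_mono[OF ev]]) auto
  ultimately have vT: "m / 2 < v T" "v T < 2 * M" using \<open>0 < m\<close> by auto
  have "\<forall>\<^sub>F t in at T. m / 2 < v t \<and> v t < 2 * M"
    using order_tendstoD(1)[OF _ vT(1)] order_tendstoD(2)[OF _ vT(2)] isC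
    unfolding isCont_def by (intro eventually_conj) blast+
  then obtain d where d: "0 < d" "\<And>t. t \<noteq> T \<Longrightarrow> \<bar>t - T\<bar> < d \<Longrightarrow> m / 2 < v t \<and> v t < 2 * M"
    unfolding eventually_at dist_real_def by auto
  \<comment> \<open>The bound d keeps the clamp inactive, and 1 stays inside the interval where v
    solves its equation.\<close>
  define T' where "T' = T + min d 1"
  have T': "ereal T < ereal T'" "0 < ereal T'" using d(1) T0 by (auto simp: T'_def)
  have vb: "m / 2 \<le> v t" "v t \<le> 2 * M" if t: "t \<in> Ico0 (ereal T')" for t
  proof -
    consider "t \<in> Ico0 (ereal T)" | "t = T" | "T < t" "\<bar>t - T\<bar> < d"
      using t unfolding Ico0_def T'_def by fastforce
    then have "m / 2 \<le> v t \<and> v t \<le> 2 * M"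
    proof cases
      case 1
      then show ?thesis using bd[OF 1] vu[OF 1] \<open>0 < m\<close> by auto
    next
      case 2
      then show ?thesis using vT by simp
    next
      case 3
      then show ?thesis using d(2)[of t] by simp
    qed
    then show "m / 2 \<le> v t" "v t \<le> 2 * M" by auto
  qed
  have "positive_solution \<gamma> (\<lambda>t x. A * x powr p) u0 (ereal T') v"
    unfolding iff[OF T'(2)]
  proof (intro conjI ballI)
    show "continuous_on (Ico0 (ereal T')) v"
      by (rule continuous_on_subset[OF vc]) (auto simp: Ico0_def T'_def)
    fix t assume t: "t \<in> Ico0 (ereal T')"
    show "0 < v t" using vb[OF t] \<open>0 < m\<close> by simp
    have "rl \<gamma> (\<lambda>s. F (v s)) t = rl \<gamma> (\<lambda>s. A * v s powr p) t"
    proof (rule rl_cong)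
      fix s assume "0 < s" "s \<le> t"
      then have "s \<in> Ico0 (ereal T')" using Ico0_down[OF t] by simp
      then show "F (v s) = A * v s powr p" using F_eq vb by simp
    qed
    then show "v t = u0 + rl \<gamma> (\<lambda>s. A * v s powr p) t"
      using v[of t] t by (simp add: Ico0_def T'_def min_def split: if_splits)
  qed
  then show False
    using max T'(1) vu unfolding maximal_positive_solution_def by blast
qed

section \<open>Power nonlinearities\<close>

lemma le_root_powr:
  fixes x C t p b :: real
  assumes "0 < x" "0 < C" "0 < t" "0 < p" "x powr p \<le> C * t powr b"
  shows "x \<le> C powr (1 / p) * t powr (b / p)"
proof -
  have "x = (x powr p) powr (1 / p)" using assms by (simp add: powr_powr)
  also have "\<dots> \<le> (C * t powr b) powr (1 / p)" using assms by (intro powr_mono2) auto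
  also have "\<dots> = C powr (1 / p) * t powr (b / p)" using assms by (simp add: powr_mult powr_powr)
  finally show ?thesis .
qed

lemma root_powr_le:
  fixes x C t p b :: real
  assumes "0 < x" "0 < C" "0 < t" "0 < p" "C * t powr b \<le> x powr p"
  shows "C powr (1 / p) * t powr (b / p) \<le> x"
proof -
  have "C powr (1 / p) * t powr (b / p) = (C * t powr b) powr (1 / p)"
    using assms by (simp add: powr_mult powr_powr)
  also have "\<dots> \<le> (x powr p) powr (1 / p)" using assms by (intro powr_mono2) auto
  also have "\<dots> = x" using assms by (simp add: powr_powr)
  finally show ?thesis .
qed

section \<open>Monotonicity and rate inequality for the maximal solution\<close>

locale power_solution =
  fixes \<gamma> A p u0 :: real and Tb :: ereal and u :: "real \<Rightarrow> real"
  assumes \<gamma>: "0 < \<gamma>" "\<gamma> < 1"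
    and maximal: "maximal_positive_solution \<gamma> (\<lambda>t x. A * x powr p) u0 Tb u"
begin

lemma Tb_pos: "0 < Tb"
  using maximal by (simp add: maximal_positive_solution_def positive_solution_def)

lemma zero_in: "0 \<in> Ico0 Tb"
  using Tb_pos by (simp add: Ico0_def zero_ereal_def)

lemma volterra:
  "continuous_on (Ico0 Tb) u \<and> (\<forall>t\<in>Ico0 Tb. 0 < u t \<and> u t = u0 + rl \<gamma> (\<lambda>s. A * u s powr p) t)"
proof -
  have "continuous_on {0<..} (\<lambda>x. A * x powr p)" by (intro continuous_intros) auto
  from positive_solution_iff_volterra[OF \<gamma> Tb_pos this] show ?thesis
    using maximal unfolding maximal_positive_solution_def by blast
qed

lemma u_pos: "t \<in> Ico0 Tb \<Longrightarrow> 0 < u t"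
  using volterra by blast

lemma u_cont: "S \<in> Ico0 Tb \<Longrightarrow> continuous_on {0..S} u"
  using volterra Icc_subset_Ico0 continuous_on_subset by blast

lemma up_cont: "S \<in> Ico0 Tb \<Longrightarrow> continuous_on {0..S} (\<lambda>t. u t powr p)"
  using Icc_subset_Ico0 u_pos by (intro continuous_intros u_cont) fastforce+

lemma u_eq: "t \<in> Ico0 Tb \<Longrightarrow> u t = u0 + A * rl \<gamma> (\<lambda>s. u s powr p) t"
  using volterra unfolding rl_cmult by blast

lemma u_0: "u 0 = u0"
  using u_eq[OF zero_in] by simp

lemma u0_pos: "0 < u0"
  using u_pos[OF zero_in] u_0 by simp

lemma not_bounded:
  assumes "Tb = ereal T" "0 < m"
  shows "\<exists>t\<in>Ico0 Tb. u t < m \<or> M < u t"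
  using volterra_clamped_extension[OF \<gamma> maximal[unfolded assms(1)] assms(2), of M] assms(1)
  by (meson linorder_not_less)

lemma u_const: "A = 0 \<Longrightarrow> t \<in> Ico0 Tb \<Longrightarrow> u t = u0"
  using u_eq by simp

text \<open>Here \<sigma> is the sign of A. The function \<sigma> * u has a positive forcing in
  either case, so both directions of monotonicity come from one application of
  \<open>volterra_strict_increasing\<close>. On [0, t] the values of u stay in a compact subset of
  (0, \<infinity>), which yields the Lipschitz constant.\<close>

lemma strict_monotone:
  assumes "0 < \<sigma> * A" "\<bar>\<sigma>\<bar> = 1" "0 \<le> s" "s < t" "t \<in> Ico0 Tb"
  shows "\<sigma> * u s < \<sigma> * u t"
proof -
  have sub: "{0..t} \<subseteq> Ico0 Tb" using assms by (intro Icc_subset_Ico0)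
  have "\<exists>x\<in>{0..t}. \<forall>y\<in>{0..t}. u x \<le> u y"
    by (rule continuous_attains_inf) (use u_cont assms in auto)
  then obtain m where m: "0 < m" "\<And>x. 0 \<le> x \<Longrightarrow> x \<le> t \<Longrightarrow> m \<le> u x"
    using u_pos sub by (meson atLeastAtMost_iff subsetD)
  obtain M where M: "\<And>x. 0 \<le> x \<Longrightarrow> x \<le> t \<Longrightarrow> \<bar>u x\<bar> \<le> M"
    using continuous_on_Icc_bounded[OF u_cont[OF assms(5)]] by blast
  obtain B where B: "0 \<le> B" "\<And>x y. m \<le> x \<Longrightarrow> x \<le> M \<Longrightarrow> m \<le> y \<Longrightarrow> y \<le> M \<Longrightarrow> \<bar>x powr p - y powr p\<bar> \<le> B * \<bar>x - y\<bar>"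
    using powr_Lipschitz[OF m(1), of M p] by blast
  show ?thesis
  proof (rule volterra_strict_increasing[where g = "\<lambda>s. (\<sigma> * A) * u s powr p" and S = t and u = "\<lambda>t. \<sigma> * u t"
        and ?u0.0 = "\<sigma> * u0" and B = "\<bar>A\<bar> * B", OF \<gamma>])
    show "continuous_on {0..t} (\<lambda>t. \<sigma> * u t)" "continuous_on {0..t} (\<lambda>s. (\<sigma> * A) * u s powr p)"
      by (intro continuous_on_mult continuous_on_const u_cont up_cont assms(5))+
    fix x assume x: "0 \<le> x" "x \<le> t"
    then have x': "x \<in> Ico0 Tb" using sub by auto
    show "\<sigma> * u x = \<sigma> * u0 + rl \<gamma> (\<lambda>s. (\<sigma> * A) * u s powr p) x"
      using u_eq[OF x'] by (simp add: rl_cmult distrib_left mult.assoc)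
    show "0 < (\<sigma> * A) * u x powr p" using assms(1) u_pos[OF x'] by simp
    fix y assume y: "0 \<le> y" "y \<le> t"
    have "\<bar>u x powr p - u y powr p\<bar> \<le> B * \<bar>u x - u y\<bar>"
      using m(2)[OF x] m(2)[OF y] M[OF x] M[OF y] by (intro B(2)) auto
    then have "\<bar>A\<bar> * \<bar>u x powr p - u y powr p\<bar> \<le> \<bar>A\<bar> * (B * \<bar>u x - u y\<bar>)"
      by (intro mult_left_mono) auto
    moreover have "\<bar>\<sigma> * A * u x powr p - \<sigma> * A * u y powr p\<bar> = \<bar>A\<bar> * \<bar>u x powr p - u y powr p\<bar>"
      using assms(2) by (simp add: abs_mult flip: right_diff_distrib)
    moreover have "\<bar>\<sigma> * u x - \<sigma> * u y\<bar> = \<bar>u x - u y\<bar>"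
      using assms(2) by (simp add: abs_mult flip: right_diff_distrib)
    ultimately show "\<bar>\<sigma> * A * u x powr p - \<sigma> * A * u y powr p\<bar> \<le> \<bar>A\<bar> * B * \<bar>\<sigma> * u x - \<sigma> * u y\<bar>"
      by simp
  next
    have up: "u x powr p \<le> u y powr p" if "u x \<le> u y" "0 \<le> p" "x \<in> {0..t}" for x y
      using that u_pos sub by (intro powr_mono2) (auto simp: less_imp_le)
    have dn: "u y powr p \<le> u x powr p" if "u x \<le> u y" "p < 0" "x \<in> {0..t}" for x y
      using that u_pos sub by (intro powr_mono2') auto
    have s: "\<sigma> = 1 \<or> \<sigma> = - 1" using assms(2) by linarith
    \<comment> \<open>The forcing increases (weakly) with \<sigma> * u if p \<ge> 0 and \<sigma> =
      1, or p < 0 and \<sigma> = - 1; it decreases in the two other cases.\<close>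
    show "(\<forall>x\<in>{0..t}. \<forall>y\<in>{0..t}. \<sigma> * u x \<le> \<sigma> * u y \<longrightarrow> \<sigma> * A * u x powr p \<le> \<sigma> * A * u y powr p) \<or>
        (\<forall>x\<in>{0..t}. \<forall>y\<in>{0..t}. \<sigma> * u x \<le> \<sigma> * u y \<longrightarrow> \<sigma> * A * u y powr p \<le> \<sigma> * A * u x powr p)"
    proof (cases "0 \<le> p \<longleftrightarrow> \<sigma> = 1")
      case True
      have "u x powr p \<le> u y powr p" if "\<sigma> * u x \<le> \<sigma> * u y" "x \<in> {0..t}" "y \<in> {0..t}" for x y
        using True s up[of x y] dn[of y x] that by fastforce
      then show ?thesis using assms(1) by (auto intro: mult_left_mono)
    next
      case False
      have "u y powr p \<le> u x powr p" if "\<sigma> * u x \<le> \<sigma> * u y" "x \<in> {0..t}" "y \<in> {0..t}" for x y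
        using False s up[of y x] dn[of x y] that by fastforce
      then show ?thesis using assms(1) by (auto intro: mult_left_mono)
    qed
  qed (use assms B in auto)
qed

lemma increasing: "0 < A \<Longrightarrow> 0 \<le> s \<Longrightarrow> s < t \<Longrightarrow> t \<in> Ico0 Tb \<Longrightarrow> u s < u t"
  using strict_monotone[of 1 s t] by simp

lemma decreasing: "A < 0 \<Longrightarrow> 0 \<le> s \<Longrightarrow> s < t \<Longrightarrow> t \<in> Ico0 Tb \<Longrightarrow> u t < u s"
  using strict_monotone[of "- 1" s t] by simp

lemma nondecreasing: "0 < A \<Longrightarrow> 0 \<le> s \<Longrightarrow> s \<le> t \<Longrightarrow> t \<in> Ico0 Tb \<Longrightarrow> u s \<le> u t"
  using increasing[of s t] by (cases "s = t") auto

lemma nonincreasing: "A < 0 \<Longrightarrow> 0 \<le> s \<Longrightarrow> s \<le> t \<Longrightarrow> t \<in> Ico0 Tb \<Longrightarrow> u t \<le> u s"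
  using decreasing[of s t] by (cases "s = t") auto

lemma rate_bound:
  assumes "0 < \<sigma> * A" "\<bar>\<sigma>\<bar> = 1" "0 < t" "t \<in> Ico0 Tb"
  shows "\<sigma> * (u t - u0) * (t powr (- \<gamma>) / Gamma (1 - \<gamma>)) \<le> \<sigma> * A * u t powr p"
proof -
  have "(\<sigma> * u t - \<sigma> * u0) * (t powr (- \<gamma>) / Gamma (1 - \<gamma>)) \<le> \<sigma> * A * u t powr p"
  proof (rule volterra_rate_lower_bound[where g = "\<lambda>s. (\<sigma> * A) * u s powr p" and u = "\<lambda>t. \<sigma> * u t", OF \<gamma>])
    show "continuous_on {0..t} (\<lambda>t. \<sigma> * u t)" "continuous_on {0..t} (\<lambda>s. (\<sigma> * A) * u s powr p)"
      by (intro continuous_on_mult continuous_on_const u_cont up_cont assms(4))+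
    show "\<sigma> * u s = \<sigma> * u0 + rl \<gamma> (\<lambda>s. (\<sigma> * A) * u s powr p) s" if "0 \<le> s" "s \<le> t" for s
      using u_eq[OF Ico0_down[OF assms(4) that]] by (simp add: rl_cmult distrib_left mult.assoc)
    show "\<sigma> * u r \<le> \<sigma> * u s" if "0 \<le> r" "r \<le> s" "s \<le> t" for r s
      using strict_monotone[OF assms(1,2), of r s] Ico0_down[OF assms(4), of s] that by (cases "r = s") auto
  qed fact
  then show ?thesis by (simp add: right_diff_distrib)
qed

lemma rl_up_lower:
  assumes "t \<in> Ico0 Tb" "\<And>s. 0 \<le> s \<Longrightarrow> s \<le> t \<Longrightarrow> c \<le> u s powr p"
  shows "c * t powr \<gamma> / Gamma (\<gamma> + 1) \<le> rl \<gamma> (\<lambda>s. u s powr p) t"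
proof -
  have "rl \<gamma> (\<lambda>_. c) t \<le> rl \<gamma> (\<lambda>s. u s powr p) t"
    by (rule rl_mono[OF \<gamma>(1) _ up_cont[OF assms(1)] assms(2)]) auto
  then show ?thesis using rl_const[OF \<gamma>(1), of t c] assms(1) by (simp add: Ico0_def)
qed

text \<open>Such a solution never exceeds u0, so its continuation can fail only through values near
  0; being monotone, u then tends to 0.\<close>

lemma tendsto_0_if_decreasing:
  assumes "A < 0" "Tb = ereal T"
  shows "(u \<longlongrightarrow> 0) (at_left T)"
proof (rule order_tendstoI)
  have T: "0 < T" using Tb_pos assms by simp
  have in_Ico: "t \<in> Ico0 Tb" if "t \<in> {0<..<T}" for t
    using that assms by (simp add: Ico0_def)
  fix a :: real assume "a < 0"
  show "\<forall>\<^sub>F t in at_left T. a < u t"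
    using eventually_at_left_real[OF T]
    by (rule eventually_mono) (use in_Ico u_pos \<open>a < 0\<close> in \<open>fastforce intro: less_trans\<close>)
next
  have T: "0 < T" using Tb_pos assms by simp
  fix a :: real assume "0 < a"
  then obtain t1 where t1: "t1 \<in> Ico0 Tb" "u t1 < a \<or> u0 < u t1"
    using not_bounded[OF assms(2), of a u0] by blast
  moreover have "u t1 \<le> u0" using nonincreasing[OF assms(1), of 0 t1] t1(1) u_0 by (simp add: Ico0_def)
  ultimately have "u t1 < a" by simp
  have "t1 < T" using t1(1) assms by (simp add: Ico0_def)
  then have "\<forall>\<^sub>F t in at_left T. t \<in> {t1<..<T}" by (rule eventually_at_left_real)
  then show "\<forall>\<^sub>F t in at_left T. u t < a"
  proof (rule eventually_mono)
    fix t assume "t \<in> {t1<..<T}"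
    then have "t1 \<le> t" "t \<in> Ico0 Tb" using t1(1) assms by (auto simp: Ico0_def)
    then show "u t < a" using nonincreasing[OF assms(1), of t1 t] t1(1) \<open>u t1 < a\<close> by (simp add: Ico0_def)
  qed
qed

lemma Tb_cases: obtains T where "Tb = ereal T" "0 < T" | "Tb = \<infinity>"
  using Tb_pos by (cases Tb) auto

section \<open>Decreasing solutions, A < 0\<close>

text \<open>Since u \<le> u0 and p < 0, the pull towards 0 is at least as strong as at the start, so
  u stays below u0 - c * t powr \<gamma>, which cannot remain positive.\<close>

lemma decreasing_negative_exponent:
  assumes "A < 0" "p < 0"
  shows "\<exists>T. Tb = ereal T \<and> (u \<longlongrightarrow> 0) (at_left T) \<and> filterlim (\<lambda>t. A * u t powr p) at_bot (at_left T)"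
proof -
  define c where "c = - A * u0 powr p / Gamma (\<gamma> + 1)"
  have G: "0 < Gamma (\<gamma> + 1)" using \<gamma> by (intro Gamma_real_pos) simp
  have c: "0 < c" unfolding c_def using assms u0_pos G by (intro divide_pos_pos mult_pos_pos) auto
  have le: "c * t powr \<gamma> \<le> u0" if t: "t \<in> Ico0 Tb" for t
  proof -
    have "u0 powr p \<le> u s powr p" if "0 \<le> s" "s \<le> t" for s
      using nonincreasing[OF assms(1), of 0 s] u_0 that Ico0_down[OF t that] u_pos assms(2) by (intro powr_mono2') auto
    then have "u0 powr p * t powr \<gamma> / Gamma (\<gamma> + 1) \<le> rl \<gamma> (\<lambda>s. u s powr p) t"
      by (rule rl_up_lower[OF t])
    then have "- A * (u0 powr p * t powr \<gamma> / Gamma (\<gamma> + 1)) \<le> - A * rl \<gamma> (\<lambda>s. u s powr p) t"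
      using assms(1) by (intro mult_left_mono) auto
    then show ?thesis using u_eq[OF t] u_pos[OF t] by (simp add: c_def)
  qed
  have "Tb \<noteq> \<infinity>"
  proof
    assume inf: "Tb = \<infinity>"
    define t where "t = ((u0 + 1) / c) powr (1 / \<gamma>)"
    have "t powr \<gamma> = (u0 + 1) / c" using c u0_pos \<gamma> by (simp add: t_def powr_powr)
    moreover have "c * t powr \<gamma> \<le> u0" using inf by (intro le) (simp add: Ico0_def t_def)
    ultimately show False using c by simp
  qed
  then obtain T where T: "Tb = ereal T" "0 < T" using Tb_cases by metis
  have lim: "(u \<longlongrightarrow> 0) (at_left T)" using tendsto_0_if_decreasing[OF assms(1) T(1)] .
  have "filterlim (\<lambda>t. u t powr p) at_top (at_left T)"
    unfolding filterlim_at_top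
  proof
    fix Z :: real
    \<comment> \<open>The maximum with 1 makes \<open>Y powr (1 / p)\<close> a positive threshold
      also when Z \<le> 0.\<close>
    define Y where "Y = max Z 1"
    have "\<forall>\<^sub>F t in at_left T. u t < Y powr (1 / p)"
      using lim by (rule order_tendstoD) (simp add: Y_def)
    then show "\<forall>\<^sub>F t in at_left T. Z \<le> u t powr p"
      using eventually_at_left_real[OF T(2)]
    proof eventually_elim
      case (elim t)
      then have "0 < u t" using u_pos[of t] T by (simp add: Ico0_def)
      then have "(Y powr (1 / p)) powr p \<le> u t powr p"
        using elim assms(2) by (intro powr_mono2') auto
      then show ?case using assms(2) by (simp add: powr_powr Y_def)
    qed
  qed
  then have "filterlim (\<lambda>t. A * u t powr p) at_bot (at_left T)"
    using assms(1) by (intro filterlim_tendsto_neg_mult_at_bot[OF tendsto_const])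
  with T lim show ?thesis by blast
qed

lemma decreasing_zero_exponent:
  assumes "p = 0" "t \<in> Ico0 Tb"
  shows "u t = u0 + A * (t powr \<gamma> / Gamma (1 + \<gamma>))"
proof -
  have "rl \<gamma> (\<lambda>s. u s powr p) t = rl \<gamma> (\<lambda>_. 1) t"
  proof (rule rl_cong)
    fix s assume "0 < s" "s \<le> t"
    then have "0 < u s" using u_pos Ico0_down[OF assms(2), of s] by simp
    then show "u s powr p = 1" using assms by simp
  qed
  then show ?thesis
    using u_eq[OF assms(2)] rl_const[OF \<gamma>(1), of t 1] assms(2) by (simp add: Ico0_def add.commute)
qed

lemma decreasing_rate:
  assumes "A < 0" "0 < t" "t \<in> Ico0 Tb"
  shows "(u0 - u t) * (t powr (- \<gamma>) / Gamma (1 - \<gamma>)) \<le> - A * u t powr p"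
  using rate_bound[of "- 1" t] assms by simp

text \<open>At a finite end point u would tend to 0 and, as p > 0, so would the right side of
  \<open>decreasing_rate\<close>, while its left side tends to a positive number. The same
  inequality gives the lower decay bound. The upper bound holds because u decreases: by time t the
  integral equation has lost at least |A| * u(t)^p * t^\<gamma> / \<Gamma>(\<gamma> + 1), and it
  cannot lose more than u0.\<close>

lemma decreasing_positive_exponent:
  assumes "A < 0" "0 < p"
  shows "Tb = \<infinity> \<and> (\<exists>c1>0. \<exists>c2>0. \<forall>t\<ge>1. c1 * t powr (- (\<gamma> / p)) \<le> u t \<and> u t \<le> c2 * t powr (- (\<gamma> / p)))"
proof
  have G: "0 < Gamma (1 - \<gamma>)" "0 < Gamma (\<gamma> + 1)" using \<gamma> by (auto intro: Gamma_real_pos)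
  have "Tb \<noteq> ereal T" if "0 < T" for T
  proof
    assume T: "Tb = ereal T"
    have lim: "(u \<longlongrightarrow> 0) (at_left T)" using tendsto_0_if_decreasing[OF assms(1) T] .
    have ev: "\<forall>\<^sub>F t in at_left T. t \<in> {0<..<T}" using eventually_at_left_real[OF that] .
    have "((\<lambda>t. - A * u t powr p) \<longlongrightarrow> - A * 0 powr p) (at_left T)"
    proof (intro tendsto_mult tendsto_const tendsto_powr2 lim)
      show "\<forall>\<^sub>F t in at_left T. 0 \<le> u t"
        using ev by (rule eventually_mono) (use u_pos T in \<open>fastforce simp: Ico0_def intro: less_imp_le\<close>)
    qed (use assms in auto)
    moreover have "((\<lambda>t. (u0 - u t) * (t powr (- \<gamma>) / Gamma (1 - \<gamma>))) \<longlongrightarrow> (u0 - 0) * (T powr (- \<gamma>) / Gamma (1 - \<gamma>))) (at_left T)"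
      using that G by (intro tendsto_intros lim) auto
    moreover have "\<forall>\<^sub>F t in at_left T. (u0 - u t) * (t powr (- \<gamma>) / Gamma (1 - \<gamma>)) \<le> - A * u t powr p"
      using ev by (rule eventually_mono) (rule decreasing_rate[OF assms(1)], auto simp: T Ico0_def)
    ultimately have "(u0 - 0) * (T powr (- \<gamma>) / Gamma (1 - \<gamma>)) \<le> - A * 0 powr p"
      by (intro tendsto_le[of "at_left T"]) auto
    moreover have "0 < u0 * (T powr (- \<gamma>) / Gamma (1 - \<gamma>))"
      using u0_pos that G by simp
    ultimately show False by simp
  qed
  then show inf: "Tb = \<infinity>" using Tb_cases by metis
  have in_Ico: "t \<in> Ico0 Tb" if "0 \<le> t" for t using that inf by (simp add: Ico0_def)
  \<comment> \<open>C comes from \<open>decreasing_rate\<close> where u t < u0 / 2; elsewhere u0 / 2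
    itself serves as lower bound, as \<open>t powr (- (\<gamma> / p))\<close> is at most 1. D comes
    from the total loss being at most u0.\<close>
  define C where "C = u0 / 2 / Gamma (1 - \<gamma>) / - A"
  define D where "D = u0 * Gamma (\<gamma> + 1) / - A"
  have C: "0 < C" and D: "0 < D"
    unfolding C_def D_def using u0_pos G assms by (intro divide_pos_pos mult_pos_pos; simp)+
  show "\<exists>c1>0. \<exists>c2>0. \<forall>t\<ge>1. c1 * t powr (- (\<gamma> / p)) \<le> u t \<and> u t \<le> c2 * t powr (- (\<gamma> / p))"
  proof (rule exI[of _ "min (u0 / 2) (C powr (1 / p))"], intro conjI, use u0_pos C in simp,
      rule exI[of _ "D powr (1 / p)"], intro conjI, use D in simp, intro allI impI conjI)
    fix t :: real assume t: "1 \<le> t"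
    then have t0: "0 < t" and tI: "t \<in> Ico0 Tb" using in_Ico by auto
    show "min (u0 / 2) (C powr (1 / p)) * t powr (- (\<gamma> / p)) \<le> u t"
    proof (cases "u0 / 2 \<le> u t")
      case True
      have "min (u0 / 2) (C powr (1 / p)) * t powr (- (\<gamma> / p)) \<le> u0 / 2 * 1"
      proof (rule mult_mono)
        show "t powr (- (\<gamma> / p)) \<le> 1"
          using t \<gamma> assms powr_mono[of "- (\<gamma> / p)" 0 t] by simp
      qed (use u0_pos in auto)
      then show ?thesis using True by simp
    next
      case False
      have "u0 / 2 * (t powr (- \<gamma>) / Gamma (1 - \<gamma>)) \<le> (u0 - u t) * (t powr (- \<gamma>) / Gamma (1 - \<gamma>))"
        using False G by (intro mult_right_mono) auto
      also have "\<dots> \<le> - A * u t powr p" by (rule decreasing_rate[OF assms(1) t0 tI])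
      finally have "u0 / 2 * (t powr (- \<gamma>) / Gamma (1 - \<gamma>)) / - A \<le> u t powr p"
        using assms(1) by (subst pos_divide_le_eq) (simp_all add: mult.commute)
      then have "C * t powr (- \<gamma>) \<le> u t powr p" by (simp add: C_def)
      then have "C powr (1 / p) * t powr (- \<gamma> / p) \<le> u t"
        using u_pos[OF tI] C t0 assms(2) by (intro root_powr_le)
      moreover have "min (u0 / 2) (C powr (1 / p)) * t powr (- (\<gamma> / p)) \<le> C powr (1 / p) * t powr (- (\<gamma> / p))"
        by (intro mult_right_mono) auto
      ultimately show ?thesis by simp
    qed
    have "u t powr p * t powr \<gamma> / Gamma (\<gamma> + 1) \<le> rl \<gamma> (\<lambda>s. u s powr p) t"
      using nonincreasing[OF assms(1)] tI u_pos assms(2) by (intro rl_up_lower powr_mono2) (auto simp: less_imp_le)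
    then have "- A * (u t powr p * t powr \<gamma> / Gamma (\<gamma> + 1)) \<le> - A * rl \<gamma> (\<lambda>s. u s powr p) t"
      using assms(1) by (intro mult_left_mono) auto
    also have "\<dots> \<le> u0" using u_eq[OF tI] u_pos[OF tI] by simp
    finally have le: "- A * (u t powr p * t powr \<gamma> / Gamma (\<gamma> + 1)) \<le> u0" .
    have "u t powr p \<le> D * t powr (- \<gamma>)"
    proof -
      have "y \<le> v * g / a * inverse x" if "a * (y * x / g) \<le> v" "0 < a" "0 < x" "0 < g" for a x y v g :: real
        using that by (simp add: field_simps)
      from this[OF le] show ?thesis
        using assms(1) G t0
        by (simp add: D_def powr_minus)
    qed
    then have "u t \<le> D powr (1 / p) * t powr (- \<gamma> / p)"
      using u_pos[OF tI] D t0 assms(2) by (intro le_root_powr)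
    then show "u t \<le> D powr (1 / p) * t powr (- (\<gamma> / p))" by simp
  qed
qed

section \<open>Increasing solutions, A > 0: sublinear and linear growth\<close>

lemma increasing_rate:
  assumes "0 < A" "0 < t" "t \<in> Ico0 Tb"
  shows "(u t - u0) * (t powr (- \<gamma>) / Gamma (1 - \<gamma>)) \<le> A * u t powr p"
  using rate_bound[of 1 t] assms by simp

text \<open>Forget the memory before s and freeze u at the value u s afterwards. Crude as it is,
  this bound has the right scaling for both the sublinear growth and the blow-up rate.\<close>

lemma growth:
  assumes "0 < A" "0 \<le> p" "0 \<le> s" "s \<le> t" "t \<in> Ico0 Tb"
  shows "A * u s powr p * (t - s) powr \<gamma> / Gamma (\<gamma> + 1) \<le> u t"
proof -
  have shift: "s \<le> r + s" "r + s \<in> Ico0 Tb" if "0 \<le> r" "r \<le> t - s" for r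
    using that assms(3) Ico0_down[OF assms(5), of "r + s"] by auto
  have "u s powr p * (t - s) powr \<gamma> / Gamma (\<gamma> + 1) = rl \<gamma> (\<lambda>_. u s powr p) (t - s)"
    using assms(4) \<gamma> by (simp add: rl_const)
  also have "\<dots> \<le> rl \<gamma> (\<lambda>r. u (r + s) powr p) (t - s)"
  proof (rule rl_mono[OF \<gamma>(1) continuous_on_const])
    show "continuous_on {0..t - s} (\<lambda>r. u (r + s) powr p)"
      using assms(3) by (intro continuous_on_compose2[OF up_cont[OF assms(5)]] continuous_intros) auto
    fix r assume r: "0 \<le> r" "r \<le> t - s"
    then show "u s powr p \<le> u (r + s) powr p"
      using nondecreasing[OF assms(1,3) shift[OF r]] u_pos[OF Ico0_down[OF assms(5,3,4)]] assms(2)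
      by (intro powr_mono2) auto
  qed
  also have "\<dots> \<le> rl \<gamma> (\<lambda>r. u r powr p) t"
  proof -
    have "0 \<le> integral {0..s} (\<lambda>r. (t - r) powr (\<gamma> - 1) * u r powr p)"
      using assms(4)
      by (intro integral_nonneg integrable_kernel \<gamma> up_cont Ico0_down[OF assms(5,3)]) auto
    then show ?thesis
      using rl_shift[of \<gamma> s "t - s" "\<lambda>r. u r powr p"] \<gamma> assms(3,4) up_cont[OF assms(5)] by simp
  qed
  finally have "A * (u s powr p * (t - s) powr \<gamma> / Gamma (\<gamma> + 1)) \<le> A * rl \<gamma> (\<lambda>r. u r powr p) t"
    using assms(1) by (intro mult_left_mono) auto
  then show ?thesis using u_eq[OF assms(5)] u0_pos by simp
qed


text \<open>The exponent \<kappa> balances the powers: inserting t^\<kappa> into the fractional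
  integral of u^p gives the exponent \<kappa> * p + \<gamma> = \<kappa>. Once u exceeds 2 * u0,
  \<open>increasing_rate\<close> gives the upper bound, which also rules out a finite end point. For
  p \<le> 0 the power u^p is smallest at the end of [0, t], and this gives the lower bound; for 0 <
  p < 1 a minimum of the normalised solution is examined instead.\<close>

lemma increasing_subcritical:
  assumes "0 < A" "p < 1"
  shows "Tb = \<infinity> \<and> (\<exists>c1>0. \<exists>c2>0. \<forall>t\<ge>1. c1 * t powr (\<gamma> / (1 - p)) \<le> u t \<and> u t \<le> c2 * t powr (\<gamma> / (1 - p)))"
proof
  have G: "0 < Gamma (1 - \<gamma>)" "0 < Gamma (\<gamma> + 1)" using \<gamma> by (auto intro: Gamma_real_pos)
  define \<kappa> where "\<kappa> = \<gamma> / (1 - p)"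
  have \<kappa>: "0 < \<kappa>" "\<kappa> * p + \<gamma> = \<kappa>" using \<gamma> assms by (auto simp: \<kappa>_def field_simps)
  define C where "C = 2 * A * Gamma (1 - \<gamma>)"
  define D where "D = C powr (1 / (1 - p))"
  have C: "0 < C" and D: "0 < D" using assms G by (auto simp: C_def D_def)
  have powr_one_minus: "x powr (1 - p) = x / x powr p" if "0 < x" for x
    using that by (simp add: powr_diff)
  have up: "u t \<le> max (2 * u0) (D * t powr \<kappa>)" if t: "0 < t" "t \<in> Ico0 Tb" for t
  proof (cases "u t \<le> 2 * u0")
    case False
    have "u t / 2 * (t powr (- \<gamma>) / Gamma (1 - \<gamma>)) \<le> (u t - u0) * (t powr (- \<gamma>) / Gamma (1 - \<gamma>))"
      using False G by (intro mult_right_mono) auto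
    also have "\<dots> \<le> A * u t powr p" by (rule increasing_rate[OF assms(1) t])
    finally have "u t powr (1 - p) \<le> C * t powr \<gamma>"
      using u_pos[OF t(2)] t G by (simp add: C_def powr_one_minus powr_minus field_simps)
    then have "u t \<le> C powr (1 / (1 - p)) * t powr (\<gamma> / (1 - p))"
      using u_pos[OF t(2)] C t assms(2) by (intro le_root_powr) auto
    then show ?thesis by (simp add: D_def \<kappa>_def)
  qed auto
  have "Tb \<noteq> ereal T" if T0: "0 < T" for T
  proof
    assume T: "Tb = ereal T"
    obtain t where t: "t \<in> Ico0 Tb" "u t < u0 \<or> max (2 * u0) (D * T powr \<kappa>) < u t"
      using not_bounded[OF T u0_pos] by blast
    have tT: "0 \<le> t" "t < T" using t(1) T by (auto simp: Ico0_def)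
    have "u0 \<le> u t" using nondecreasing[OF assms(1), of 0 t] t(1) tT u_0 by simp
    moreover have "u t \<le> max (2 * u0) (D * T powr \<kappa>)"
    proof (cases "t = 0")
      case True
      then show ?thesis using u_0 u0_pos by simp
    next
      case False
      have "D * t powr \<kappa> \<le> D * T powr \<kappa>"
        using tT D \<kappa> by (intro mult_left_mono powr_mono2) auto
      then show ?thesis using up[of t] False t(1) tT by auto
    qed
    ultimately show False using t(2) by linarith
  qed
  then show inf: "Tb = \<infinity>" using Tb_cases by metis
  have in_Ico: "t \<in> Ico0 Tb" if "0 \<le> t" for t using that inf by (simp add: Ico0_def)
  have upper: "u t \<le> max (2 * u0) D * t powr \<kappa>" if t: "1 \<le> t" for t
  proof -
    have "1 \<le> t powr \<kappa>" using t \<kappa> by (simp add: ge_one_powr_ge_zero)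
    then have "2 * u0 \<le> max (2 * u0) D * t powr \<kappa>"
      using mult_mono[of "2 * u0" "max (2 * u0) D" 1 "t powr \<kappa>"] u0_pos by simp
    moreover have "D * t powr \<kappa> \<le> max (2 * u0) D * t powr \<kappa>" by (intro mult_right_mono) auto
    ultimately have "max (2 * u0) (D * t powr \<kappa>) \<le> max (2 * u0) D * t powr \<kappa>" by (rule max.boundedI)
    moreover have "u t \<le> max (2 * u0) (D * t powr \<kappa>)" using t by (intro up in_Ico) auto
    ultimately show ?thesis by linarith
  qed
  have "\<exists>c1>0. \<forall>t\<ge>1. c1 * t powr \<kappa> \<le> u t"
  proof (cases "p \<le> 0")
    case True
    define c where "c = A / Gamma (\<gamma> + 1)"
    have c: "0 < c" using assms G by (simp add: c_def)
    have "c powr (1 / (1 - p)) * t powr \<kappa> \<le> u t" if t: "1 \<le> t" for t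
    proof -
      have tI: "t \<in> Ico0 Tb" and ut: "0 < u t" using in_Ico u_pos t by auto
      have "u t powr p * t powr \<gamma> / Gamma (\<gamma> + 1) \<le> rl \<gamma> (\<lambda>s. u s powr p) t"
      proof (rule rl_up_lower[OF tI])
        fix s assume s: "0 \<le> s" "s \<le> t"
        then show "u t powr p \<le> u s powr p"
          using nondecreasing[OF assms(1) s tI] u_pos[OF in_Ico[of s]] True by (intro powr_mono2') auto
      qed
      then have "A * (u t powr p * t powr \<gamma> / Gamma (\<gamma> + 1)) \<le> A * rl \<gamma> (\<lambda>s. u s powr p) t"
        using assms(1) by (intro mult_left_mono) auto
      also have "\<dots> \<le> u t" using u_eq[OF tI] u0_pos by simp
      finally have "c * t powr \<gamma> \<le> u t powr (1 - p)"
        using ut by (simp add: c_def powr_one_minus field_simps)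
      then show ?thesis
        unfolding \<kappa>_def using ut c t assms(2) by (intro root_powr_le) auto
    qed
    moreover have "0 < c powr (1 / (1 - p))" using c by simp
    ultimately show ?thesis by blast
  next
    case False
    define c where "c = A / Gamma (\<gamma> + 1) * 2 powr (- \<kappa>)"
    define c1 where "c1 = min (u0 * 2 powr (- \<kappa>)) (c powr (1 / (1 - p)))"
    have c: "0 < c" "0 < c1" using assms G u0_pos by (auto simp: c_def c1_def)
    have "c1 * t powr \<kappa> \<le> u t" if t: "1 \<le> t" for t
    proof -
      \<comment> \<open>u is normalised by the expected rate. At the minimum x of y on [1, t],
        \<open>growth\<close> from x / 2 to x bounds y x below by a multiple of
        \<open>y x powr p\<close>, and p < 1 turns this into a constant.\<close>
      define y where "y = (\<lambda>t. u t * t powr (- \<kappa>))"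
      have y: "u s = y s * s powr \<kappa>" if "0 < s" for s
        using that by (simp add: y_def powr_minus)
      have "\<exists>x\<in>{1..t}. \<forall>s\<in>{1..t}. y x \<le> y s"
      proof (rule continuous_attains_inf)
        show "continuous_on {1..t} y"
          unfolding y_def
        proof (intro continuous_on_mult continuous_on_powr continuous_on_id continuous_on_const)
          show "continuous_on {1..t} u"
            by (rule continuous_on_subset[OF u_cont[OF in_Ico[of t]]]) (use t in auto)
        qed auto
      qed (use t in auto)
      then obtain x where x: "1 \<le> x" "x \<le> t" "\<And>s. 1 \<le> s \<Longrightarrow> s \<le> t \<Longrightarrow> y x \<le> y s" by auto
      have ypos: "0 < y x" using u_pos[OF in_Ico[of x]] x by (simp add: y_def)
      \<comment> \<open>For x < 2 the point x / 2 leaves [1, t]; up to x = 2 the bound u \<ge> u0 is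
        used.\<close>
      have "c1 \<le> y x"
      proof (cases "x \<le> 2")
        case True
        have "u0 * 2 powr (- \<kappa>) \<le> u x * x powr (- \<kappa>)"
          using nondecreasing[OF assms(1), of 0 x] in_Ico[of x] u_0 u0_pos True x \<kappa>
          by (intro mult_mono powr_mono2') auto
        then show ?thesis by (simp add: c1_def y_def)
      next
        case False
        have "(y x * (x / 2) powr \<kappa>) powr p \<le> u (x / 2) powr p"
          unfolding y[of "x / 2", OF divide_pos_pos[OF less_le_trans[OF zero_less_one x(1)] zero_less_numeral]]
          using x(3)[of "x / 2"] False x ypos \<open>\<not> p \<le> 0\<close>
          by (intro powr_mono2 mult_right_mono) auto
        then have "A * (y x * (x / 2) powr \<kappa>) powr p * (x - x / 2) powr \<gamma> / Gamma (\<gamma> + 1)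
            \<le> A * u (x / 2) powr p * (x - x / 2) powr \<gamma> / Gamma (\<gamma> + 1)"
          using assms(1) G by (intro divide_right_mono mult_right_mono mult_left_mono) auto
        also have "\<dots> \<le> u x"
          using x in_Ico \<open>\<not> p \<le> 0\<close> by (intro growth assms) auto
        also have "\<dots> = y x * x powr \<kappa>" using y x by simp
        finally have "A * (y x * (x / 2) powr \<kappa>) powr p * (x / 2) powr \<gamma> / Gamma (\<gamma> + 1) \<le> y x * x powr \<kappa>"
          by simp
        moreover have "(y x * (x / 2) powr \<kappa>) powr p * (x / 2) powr \<gamma> = y x powr p * (x powr \<kappa> * 2 powr (- \<kappa>))"
        proof -
          have "(y x * (x / 2) powr \<kappa>) powr p * (x / 2) powr \<gamma> = y x powr p * (x / 2) powr (\<kappa> * p + \<gamma>)"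
            using ypos x(1) by (simp add: powr_mult powr_powr powr_add)
          also have "(x / 2) powr (\<kappa> * p + \<gamma>) = x powr \<kappa> * 2 powr (- \<kappa>)"
            using powr_divide[of x 2 \<kappa>] x(1) by (simp only: \<kappa>(2) powr_minus divide_inverse)
          finally show ?thesis .
        qed
        moreover have "c * y x powr p * x powr \<kappa> = A * (y x powr p * (x powr \<kappa> * 2 powr (- \<kappa>))) / Gamma (\<gamma> + 1)"
          by (simp add: c_def)
        ultimately have "c * y x powr p * x powr \<kappa> \<le> y x * x powr \<kappa>"
          by (simp only: mult.assoc)
        then have "c * y x powr p \<le> y x"
          using x(1) by (simp add: mult_le_cancel_right)
        \<comment> \<open>The factor \<open>1 powr \<gamma>\<close> puts the inequality into the
          shape of \<open>root_powr_le\<close> with t = 1.\<close>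
        then have "c * 1 powr \<gamma> \<le> y x powr (1 - p)"
          using ypos by (simp add: powr_one_minus field_simps)
        then have "c powr (1 / (1 - p)) * 1 powr (\<gamma> / (1 - p)) \<le> y x"
          using ypos c assms(2) by (intro root_powr_le) auto
        then show ?thesis by (simp add: c1_def)
      qed
      also have "y x \<le> y t" using x t by simp
      finally have "c1 * t powr \<kappa> \<le> y t * t powr \<kappa>" by (intro mult_right_mono) auto
      then show ?thesis using y[of t] t by simp
    qed
    then show ?thesis using c by blast
  qed
  moreover have "0 < max (2 * u0) D" using D by simp
  ultimately show "\<exists>c1>0. \<exists>c2>0. \<forall>t\<ge>1. c1 * t powr (\<gamma> / (1 - p)) \<le> u t \<and> u t \<le> c2 * t powr (\<gamma> / (1 - p))"
    unfolding \<kappa>_def[symmetric] using upper by blast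
qed

text \<open>In the norm weighted by exp (- l t), each fractional integration gains the factor
  \<open>l powr (- \<gamma>)\<close>. This controls the remainder of the Neumann series
  below.\<close>

lemma iterated_rl_bound:
  assumes "continuous_on {0..S} f" "0 < l" "\<And>t. 0 \<le> t \<Longrightarrow> t \<le> S \<Longrightarrow> \<bar>f t\<bar> \<le> M"
  shows "continuous_on {0..S} ((rl \<gamma> ^^ n) f) \<and>
    (\<forall>t\<in>{0..S}. \<bar>(rl \<gamma> ^^ n) f t\<bar> \<le> M * (l powr (- \<gamma>)) ^ n * exp (l * t))"
proof (induction n)
  case 0
  have "\<bar>f t\<bar> \<le> M * exp (l * t)" if "0 \<le> t" "t \<le> S" for t
  proof -
    have "\<bar>f t\<bar> \<le> M * 1" using assms(3)[OF that] by simp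
    also have "\<dots> \<le> M * exp (l * t)"
      using assms(2) that assms(3)[OF that] by (intro mult_left_mono) auto
    finally show ?thesis .
  qed
  then show ?case using assms(1) by simp
next
  case (Suc n)
  let ?R = "(rl \<gamma> ^^ n) f" and ?C = "M * (l powr (- \<gamma>)) ^ n"
  have "\<bar>rl \<gamma> ?R t\<bar> \<le> ?C * l powr (- \<gamma>) * exp (l * t)" if t: "0 \<le> t" "t \<le> S" for t
  proof -
    have M: "0 \<le> M" using assms(3)[OF t] by linarith
    have "\<bar>rl \<gamma> ?R t\<bar> \<le> rl \<gamma> (\<lambda>s. ?C * exp (l * s)) t"
    proof (rule rl_abs_le[OF \<gamma>(1)])
      show "continuous_on {0..t} ?R" using Suc t by (auto elim: continuous_on_subset)
      show "continuous_on {0..t} (\<lambda>s. ?C * exp (l * s))" by (intro continuous_intros)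
      show "\<bar>?R s\<bar> \<le> ?C * exp (l * s)" if "0 \<le> s" "s \<le> t" for s using Suc that t by auto
    qed
    also have "\<dots> \<le> ?C * (l powr (- \<gamma>) * exp (l * t))"
      unfolding rl_cmult using M t assms(2) \<gamma> by (intro mult_left_mono rl_exp_le) auto
    finally show ?thesis by (simp only: mult.assoc)
  qed
  moreover have "continuous_on {0..S} (rl \<gamma> ?R)" using Suc by (intro continuous_on_rl \<gamma>) auto
  ultimately show ?case by (simp add: mult_ac)
qed

text \<open>Substituting the equation into itself n times yields n terms of the Neumann series,
  which \<open>rl_powr\<close> identifies as Mittag-Leffler terms, plus A^n times the n-fold
  fractional integral of u. The weight l makes the latter decay like 2^(- n).\<close>

lemma linear_mittag_leffler:
  assumes "p = 1" "t \<in> Ico0 Tb"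
  shows "u t = u0 * mittag_leffler \<gamma> (A * t powr \<gamma>)"
proof (cases "t = 0")
  case True
  have "(\<Sum>n. 0 ^ n / Gamma (real n * \<gamma> + 1)) = (\<Sum>n\<in>{0}. 0 ^ n / Gamma (real n * \<gamma> + 1))"
    by (rule suminf_finite) auto
  then have "mittag_leffler \<gamma> 0 = 1" by (simp add: mittag_leffler_def)
  then show ?thesis using True u_0 by simp
next
  case False
  define a where "a = (\<lambda>s k. (A * s powr \<gamma>) ^ k / Gamma (real k * \<gamma> + 1))"
  have t0: "0 < t" using False assms by (simp add: Ico0_def)
  obtain M where M: "0 < M" "\<And>s. 0 \<le> s \<Longrightarrow> s \<le> t \<Longrightarrow> \<bar>u s\<bar> \<le> M"
    using continuous_on_Icc_bounded[OF u_cont[OF assms(2)]] by blast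
  obtain l where l: "0 < l" "\<bar>A\<bar> * l powr (- \<gamma>) \<le> 1 / 2"
    using weight_exists[OF \<gamma>(1), of "\<bar>A\<bar>"] by auto
  let ?R = "\<lambda>n. (rl \<gamma> ^^ n) u"
  have R: "continuous_on {0..t} (?R n)" "\<bar>?R n t\<bar> \<le> M * (l powr (- \<gamma>)) ^ n * exp (l * t)" for n
    using iterated_rl_bound[OF u_cont[OF assms(2)] l(1) M(2), of n] t0 by auto
  have eq: "u s = u0 + A * rl \<gamma> u s" if s: "0 \<le> s" "s \<le> t" for s
  proof -
    have "rl \<gamma> (\<lambda>s. u s powr p) s = rl \<gamma> u s"
    proof (rule rl_cong)
      fix r assume "0 < r" "r \<le> s"
      then have "0 < u r" using u_pos Ico0_down[OF assms(2), of r] s by simp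
      then show "u r powr p = u r" using assms(1) by simp
    qed
    then show ?thesis using u_eq[OF Ico0_down[OF assms(2) s]] by simp
  qed
  have partial: "u s = (\<Sum>k<n. u0 * a s k) + A ^ n * ?R n s" if "0 < s" "s \<le> t" for n s
    using that
  proof (induction n arbitrary: s)
    case (Suc n)
    have c: "continuous_on {0..s} (\<lambda>s. (A * s powr \<gamma>) ^ k / Gamma (real k * \<gamma> + 1))" for k
    proof -
      have "Gamma (real k * \<gamma> + 1) > 0" using \<gamma> by (intro Gamma_real_pos add_nonneg_pos) auto
      then have "Gamma (real k * \<gamma> + 1) \<noteq> 0" by linarith
      then show ?thesis using \<gamma> by (intro continuous_intros continuous_on_powr') auto
    qed
    have ca: "continuous_on {0..s} (\<lambda>s. u0 * a s k)" for k
      unfolding a_def by (intro continuous_on_mult continuous_on_const c)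
    have cR: "continuous_on {0..s} (?R n)"
      by (rule continuous_on_subset[OF R(1)]) (use Suc.prems in auto)
    have term_eq: "A * rl \<gamma> (\<lambda>s. u0 * a s k) s = u0 * a s (Suc k)" for k
    proof -
      have "rl \<gamma> (\<lambda>s. u0 * a s k) s = rl \<gamma> (\<lambda>s. (u0 * A ^ k / Gamma (real k * \<gamma> + 1)) * s powr (real k * \<gamma>)) s"
        by (rule rl_cong) (simp add: a_def power_mult_distrib powr_power mult.commute)
      also have "\<dots> = (u0 * A ^ k / Gamma (real k * \<gamma> + 1)) * (Gamma (real k * \<gamma> + 1) / Gamma (\<gamma> + real k * \<gamma> + 1) * s powr (\<gamma> + real k * \<gamma>))"
        unfolding rl_cmult using \<gamma> Suc.prems by (subst rl_powr) auto
      also have "\<dots> = u0 * A ^ k / Gamma (\<gamma> + real k * \<gamma> + 1) * s powr (\<gamma> + real k * \<gamma>)"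
      proof -
        have "Gamma (real k * \<gamma> + 1) > 0" using \<gamma> by (intro Gamma_real_pos add_nonneg_pos) auto
        moreover have "x / g * (g / h * y) = x / h * y" if "0 < g" for x g h y :: real using that by simp
        ultimately show ?thesis by blast
      qed
      also have "s powr (\<gamma> + real k * \<gamma>) = (s powr \<gamma>) ^ Suc k"
        using Suc.prems by (simp add: powr_power powr_add mult.commute)
      also have "\<gamma> + real k * \<gamma> + 1 = real (Suc k) * \<gamma> + 1" by (simp add: distrib_right)
      finally show ?thesis by (simp add: a_def power_mult_distrib)
    qed
    have "u s = u0 + A * rl \<gamma> u s" using eq Suc.prems by simp
    also have "rl \<gamma> u s = rl \<gamma> (\<lambda>s. (\<Sum>k<n. u0 * a s k) + A ^ n * ?R n s) s"
      by (rule rl_cong) (use Suc in auto)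
    also have "\<dots> = (\<Sum>k<n. rl \<gamma> (\<lambda>s. u0 * a s k) s) + A ^ n * ?R (Suc n) s"
    proof -
      have "rl \<gamma> (\<lambda>s. (\<Sum>k<n. u0 * a s k) + A ^ n * ?R n s) s =
          rl \<gamma> (\<lambda>s. \<Sum>k<n. u0 * a s k) s + rl \<gamma> (\<lambda>s. A ^ n * ?R n s) s"
        by (intro rl_add \<gamma> continuous_on_sum ca continuous_on_mult continuous_on_const cR)
      also have "rl \<gamma> (\<lambda>s. \<Sum>k<n. u0 * a s k) s = (\<Sum>k<n. rl \<gamma> (\<lambda>s. u0 * a s k) s)"
        by (intro rl_sum \<gamma> ca)
      finally show ?thesis by (simp only: rl_cmult funpow.simps o_apply)
    qed
    also have "A * \<dots> = (\<Sum>k<n. u0 * a s (Suc k)) + A ^ Suc n * ?R (Suc n) s"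
      unfolding distrib_left sum_distrib_left term_eq by simp
    also have "u0 + \<dots> = (\<Sum>k<Suc n. u0 * a s k) + A ^ Suc n * ?R (Suc n) s"
      unfolding sum.lessThan_Suc_shift by (simp add: a_def)
    finally show ?case .
  qed simp
  have "(\<lambda>n. A ^ n * ?R n t) \<longlonglongrightarrow> 0"
  proof (rule Lim_null_comparison)
    show "(\<lambda>n. M * exp (l * t) * (1 / 2) ^ n) \<longlonglongrightarrow> 0"
      by (intro tendsto_mult_right_zero LIMSEQ_power_zero) simp
    have "norm (A ^ n * ?R n t) \<le> M * exp (l * t) * (1 / 2) ^ n" for n
    proof -
      have "norm (A ^ n * ?R n t) \<le> \<bar>A\<bar> ^ n * (M * (l powr (- \<gamma>)) ^ n * exp (l * t))"
        using mult_left_mono[OF R(2)[of n], of "\<bar>A\<bar> ^ n"] by (simp add: abs_mult power_abs)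
      also have "\<dots> = M * exp (l * t) * (\<bar>A\<bar> * l powr (- \<gamma>)) ^ n"
        by (simp add: power_mult_distrib)
      also have "\<dots> \<le> M * exp (l * t) * (1 / 2) ^ n"
        using l M by (intro mult_left_mono power_mono) auto
      finally show ?thesis .
    qed
    then show "\<forall>\<^sub>F n in sequentially. norm (A ^ n * ?R n t) \<le> M * exp (l * t) * (1 / 2) ^ n"
      by (intro always_eventually allI)
  qed
  moreover have eqn: "(\<Sum>k<n. u0 * a t k) = u t - A ^ n * ?R n t" for n
    using partial[OF t0 order_refl, of n] by linarith
  ultimately have "(\<lambda>n. u t - A ^ n * ?R n t) \<longlonglongrightarrow> u t - 0" by (intro tendsto_intros)
  then have "(\<lambda>k. u0 * a t k) sums u t"
    unfolding sums_def eqn by simp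
  then have "(\<lambda>k. inverse u0 * (u0 * a t k)) sums (inverse u0 * u t)" by (rule sums_mult)
  moreover have "(\<lambda>k. inverse u0 * (u0 * a t k)) = a t"
    using u0_pos by (simp add: fun_eq_iff mult.assoc[symmetric])
  ultimately have "a t sums (u t / u0)" by (simp add: divide_inverse mult.commute)
  then show ?thesis using u0_pos by (simp add: mittag_leffler_def a_def sums_iff)
qed

end

section \<open>Blow-up for superlinear growth\<close>

lemma nonincreasing_bounded_tendsto:
  fixes V :: "real \<Rightarrow> real"
  assumes "\<And>x y. X \<le> x \<Longrightarrow> x \<le> y \<Longrightarrow> V y \<le> V x" "\<And>x. X \<le> x \<Longrightarrow> m \<le> V x"
  obtains L where "(V \<longlongrightarrow> L) at_top"
proof
  define L where "L = Inf (V ` {X..})"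
  have bdd: "bdd_below (V ` {X..})" using assms(2) by (intro bdd_belowI[of _ m]) auto
  show "(V \<longlongrightarrow> L) at_top"
  proof (rule order_tendstoI)
    fix a assume "a < L"
    moreover have "L \<le> V x" if "X \<le> x" for x
      unfolding L_def using that bdd by (intro cInf_lower) auto
    ultimately show "\<forall>\<^sub>F x in at_top. a < V x"
      by (intro eventually_mono[OF eventually_ge_at_top[of X]]) force
  next
    fix a assume "L < a"
    then obtain z where "X \<le> z" "V z < a"
      unfolding L_def using cInf_lessD[of "V ` {X..}" a] by auto
    then show "\<forall>\<^sub>F x in at_top. V x < a"
      by (intro eventually_mono[OF eventually_ge_at_top[of z]]) (use assms(1) le_less_trans in blast)
  qed
qed

text \<open>Splitting a step at which \<open>V\<close> drops into \<open>n\<close> equal parts, one of the parts is a drop too. Hence after the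
  drop \<open>V\<close> cannot increase over rational multiples of the step, nor, by continuity, over any step.\<close>

lemma single_sign_change_tendsto:
  fixes V :: "real \<Rightarrow> real"
  assumes "continuous_on {x0..} V"
    and bd: "\<And>x. x0 \<le> x \<Longrightarrow> m \<le> V x" "\<And>x. x0 \<le> x \<Longrightarrow> V x \<le> M"
    and drop: "\<And>x a y. x0 \<le> x \<Longrightarrow> 0 < a \<Longrightarrow> V (x + a) < V x \<Longrightarrow> x \<le> y \<Longrightarrow> V (y + a) \<le> V y"
  obtains L where "(V \<longlongrightarrow> L) at_top"
proof (cases "\<exists>x a. x0 \<le> x \<and> 0 < a \<and> V (x + a) < V x")
  case False
  then have mono: "V x \<le> V y" if "x0 \<le> x" "x \<le> y" for x y
  proof (cases "x = y")
    case neq: False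
    then have "\<not> V (x + (y - x)) < V x"
      using False that by (metis diff_gt_0_iff_gt order_le_less)
    then show ?thesis by simp
  qed simp
  obtain L where "((\<lambda>x. - V x) \<longlongrightarrow> L) at_top"
    by (rule nonincreasing_bounded_tendsto[of x0 "\<lambda>x. - V x" "- M"]) (use mono bd in auto)
  then have "((\<lambda>x. - (- V x)) \<longlongrightarrow> - L) at_top" by (rule tendsto_minus)
  then show ?thesis using that by simp
next
  case True
  then obtain x1 a where a: "x0 \<le> x1" "0 < a" "V (x1 + a) < V x1" by blast
  have small: "V (y + a / real n) \<le> V y" if n: "0 < n" and y: "x1 + a \<le> y" for n y
  proof -
    have "\<exists>i<n. V (x1 + real (Suc i) * (a / real n)) < V (x1 + real i * (a / real n))"
    proof (rule ccontr)
      assume no: "\<not> ?thesis"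
      have "V x1 \<le> V (x1 + real i * (a / real n))" if "i \<le> n" for i
        using that
      proof (induction i)
        case (Suc i)
        then have "V x1 \<le> V (x1 + real i * (a / real n))" by simp
        also have "\<dots> \<le> V (x1 + real (Suc i) * (a / real n))" using no Suc.prems by (meson Suc_le_lessD not_less)
        finally show ?case .
      qed simp
      from this[of n] show False using a n by simp
    qed
    then obtain i where i: "i < n" "V (x1 + real (Suc i) * (a / real n)) < V (x1 + real i * (a / real n))" by blast
    have step: "x1 + real (Suc i) * (a / real n) = x1 + real i * (a / real n) + a / real n"
      by (simp add: distrib_right add_divide_distrib)
    have "real i * (a / real n) \<le> real n * (a / real n)" using i a by (intro mult_right_mono) auto
    then have "x1 + real i * (a / real n) \<le> y" using n y by simp
    moreover have "0 \<le> real i * (a / real n)" using a(2) by simp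
    then have "x0 \<le> x1 + real i * (a / real n)" using a(1) by linarith
    ultimately show ?thesis
      using drop[of "x1 + real i * (a / real n)" "a / real n" y] i(2) a(2) n unfolding step by simp
  qed
  have multiple: "V (y + real k * (a / real n)) \<le> V y" if n: "0 < n" and y: "x1 + a \<le> y" for n k y
  proof (induction k)
    case (Suc k)
    have "V (y + real k * (a / real n) + a / real n) \<le> V (y + real k * (a / real n))"
      using a y by (intro small n) (simp add: add_increasing2)
    also have "\<dots> \<le> V y" by (rule Suc)
    finally show ?case by (simp add: distrib_right add_divide_distrib add_ac)
  qed simp
  have decr: "V z \<le> V y" if yz: "x1 + a \<le> y" "y \<le> z" for y z
  proof (rule LIMSEQ_le_const2)
    define \<delta> where "\<delta> = (z - y) / a"
    \<comment> \<open>The quotients of k n and \<open>Suc n\<close> approximate \<delta> from below,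
      so k n steps of length a / Suc n lead from y almost to z.\<close>
    define k where "k = (\<lambda>n. nat \<lfloor>real (Suc n) * \<delta>\<rfloor>)"
    have \<delta>: "0 \<le> \<delta>" "\<delta> * a = z - y" using yz a by (auto simp: \<delta>_def)
    have "(\<lambda>n. real (k n) / real (Suc n)) \<longlonglongrightarrow> \<delta>"
    proof (rule tendsto_sandwich)
      have k: "real (Suc n) * \<delta> - 1 \<le> real (k n)" "real (k n) \<le> real (Suc n) * \<delta>" for n
        using \<delta>(1) unfolding k_def by (simp_all add: of_nat_nat)
      show "\<forall>\<^sub>F n in sequentially. \<delta> - 1 / real (Suc n) \<le> real (k n) / real (Suc n)"
      proof (intro always_eventually allI)
        fix n
        have "\<delta> - 1 / real (Suc n) = (real (Suc n) * \<delta> - 1) / real (Suc n)"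
          by (simp add: diff_divide_distrib)
        also have "\<dots> \<le> real (k n) / real (Suc n)" by (intro divide_right_mono k) simp
        finally show "\<delta> - 1 / real (Suc n) \<le> real (k n) / real (Suc n)" .
      qed
      show "\<forall>\<^sub>F n in sequentially. real (k n) / real (Suc n) \<le> \<delta>"
        using k(2) by (intro always_eventually allI) (subst pos_divide_le_eq, simp_all only: of_nat_0_less_iff zero_less_Suc mult.commute)
      have "(\<lambda>n. \<delta> - 1 / real (Suc n)) \<longlonglongrightarrow> \<delta> - 0"
        by (intro tendsto_diff tendsto_const LIMSEQ_Suc[OF lim_const_over_n])
      then show "(\<lambda>n. \<delta> - 1 / real (Suc n)) \<longlonglongrightarrow> \<delta>" by simp
    qed auto
    then have "(\<lambda>n. y + real (k n) / real (Suc n) * a) \<longlonglongrightarrow> y + \<delta> * a" by (intro tendsto_intros)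
    then have lim: "(\<lambda>n. y + real (k n) * (a / real (Suc n))) \<longlonglongrightarrow> z" using \<delta> by simp
    show "(\<lambda>n. V (y + real (k n) * (a / real (Suc n)))) \<longlonglongrightarrow> V z"
      by (rule continuous_on_tendsto_compose[OF assms(1) lim]) (use a yz in \<open>auto intro!: always_eventually add_increasing2\<close>)
    show "\<exists>N. \<forall>n\<ge>N. V (y + real (k n) * (a / real (Suc n))) \<le> V y"
      using multiple[OF _ yz(1)] by blast
  qed
  show ?thesis
    by (rule nonincreasing_bounded_tendsto[of "x1 + a" V m]) (use decr bd a that in auto)
qed

context power_solution
begin

section \<open>Two-sided control of the blow-up rate\<close>

text \<open>The weight vanishes at T' < Tb rather than at Tb, which is not yet known to be finite;
  its product with u then has a maximum, at x say. \<open>growth\<close> from x to the midpoint of x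
  and T' bounds a multiple of the p-th power of this maximum by the maximum itself, and p > 1 turns
  this into a bound independent of T'.\<close>

lemma blowup_bound:
  assumes "0 < A" "1 < p"
  obtains M where "0 < M"
    "\<And>T' t. T' \<in> Ico0 Tb \<Longrightarrow> 0 \<le> t \<Longrightarrow> t \<le> T' \<Longrightarrow> u t * (T' - t) powr (\<gamma> / (p - 1)) \<le> M"
proof
  define \<beta> where "\<beta> = \<gamma> / (p - 1)"
  have \<beta>: "0 < \<beta>" "\<beta> * p = \<beta> + \<gamma>" using \<gamma> assms by (auto simp: \<beta>_def field_simps)
  define c where "c = A / Gamma (\<gamma> + 1)"
  \<comment> \<open>M0 solves \<open>c * M0 powr (p - 1) = 2 powr (\<beta> * p)\<close>, the extreme
    case of the inequality reached at the maximum; the power of 2 comes from halving the remaining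
    time.\<close>
  define M0 where "M0 = (2 powr (\<beta> * p) / c) powr (1 / (p - 1))"
  have c: "0 < c" using assms \<gamma> by (auto simp: c_def intro!: divide_pos_pos Gamma_real_pos)
  then show "0 < M0" by (simp add: M0_def)
  fix T' t assume T': "T' \<in> Ico0 Tb" and t: "0 \<le> t" "t \<le> T'"
  let ?y = "\<lambda>t. u t * (T' - t) powr \<beta>"
  have "\<exists>x\<in>{0..T'}. \<forall>s\<in>{0..T'}. ?y s \<le> ?y x"
  proof (rule continuous_attains_sup)
    show "continuous_on {0..T'} ?y"
      using \<beta>(1) by (intro continuous_on_mult u_cont[OF T'] continuous_on_powr' continuous_on_diff
          continuous_on_id continuous_on_const) auto
  qed (use t in auto)
  then obtain x where x: "0 \<le> x" "x \<le> T'" "\<And>s. 0 \<le> s \<Longrightarrow> s \<le> T' \<Longrightarrow> ?y s \<le> ?y x" by auto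
  have "?y x \<le> M0"
  proof (cases "x = T'")
    case True
    then show ?thesis by (simp add: M0_def)
  next
    case False
    define h where "h = (T' - x) / 2"
    have h: "0 < h" "T' - x = 2 * h" using False x(1,2) by (auto simp: h_def)
    then have h': "T' - (x + h) = h" "x + h \<le> T'" by linarith+
    have ux: "0 < u x" using u_pos[OF Ico0_down[OF T' x(1,2)]] .
    define N where "N = ?y x"
    have N: "0 < N" "N = u x * (2 * h) powr \<beta>" using ux h by (simp_all add: N_def)
    have "A * u x powr p * (x + h - x) powr \<gamma> / Gamma (\<gamma> + 1) \<le> u (x + h)"
      using assms x(1) h h' by (intro growth Ico0_down[OF T']) auto
    then have "c * u x powr p * h powr \<gamma> \<le> u (x + h)" by (simp add: c_def)
    then have "c * u x powr p * h powr \<gamma> * h powr \<beta> \<le> u (x + h) * h powr \<beta>" by (intro mult_right_mono) auto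
    also have "\<dots> \<le> N" using x(3)[of "x + h"] x(1) h h' by (simp add: N_def)
    finally have "c * u x powr p * h powr (\<beta> * p) \<le> N" using \<beta> by (simp add: powr_add mult_ac)
    moreover have "N powr p = u x powr p * (2 powr (\<beta> * p) * h powr (\<beta> * p))"
      using ux h by (simp add: N(2) powr_mult powr_powr)
    ultimately have "c * N powr p \<le> 2 powr (\<beta> * p) * N"
      by (simp add: mult_ac)
    moreover have "N powr p = N powr (p - 1) * N" using N(1) by (simp add: powr_diff)
    ultimately have "c * N powr (p - 1) \<le> 2 powr (\<beta> * p)"
      using N(1) by (simp add: mult.assoc[symmetric])
    then have "N powr (p - 1) \<le> 2 powr (\<beta> * p) / c * 1 powr 0"
      using c by (simp add: pos_le_divide_eq mult.commute)
    then have "N \<le> (2 powr (\<beta> * p) / c) powr (1 / (p - 1)) * 1 powr (0 / (p - 1))"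
      using N(1) c assms by (intro le_root_powr) auto
    then show ?thesis by (simp add: M0_def N_def)
  qed
  then show "u t * (T' - t) powr (\<gamma> / (p - 1)) \<le> M0"
    unfolding \<beta>_def[symmetric] using x(3)[OF t] by linarith
qed

text \<open>At t = 0 the bound reads u0 * T' powr (\<gamma> / (p - 1)) \<le> M, which limits
  T'.\<close>

lemma finite_blowup_time:
  assumes "0 < A" "1 < p"
  obtains T where "Tb = ereal T" "0 < T"
proof -
  obtain M where M: "0 < M"
    "\<And>T' t. T' \<in> Ico0 Tb \<Longrightarrow> 0 \<le> t \<Longrightarrow> t \<le> T' \<Longrightarrow> u t * (T' - t) powr (\<gamma> / (p - 1)) \<le> M"
    using blowup_bound[OF assms] by blast
  have "Tb \<noteq> \<infinity>"
  proof
    assume inf: "Tb = \<infinity>"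
    define T' where "T' = ((M + 1) / u0) powr ((p - 1) / \<gamma>)"
    have "T' powr (\<gamma> / (p - 1)) = (M + 1) / u0"
      using M(1) u0_pos assms \<gamma> by (simp add: T'_def powr_powr)
    moreover have "u 0 * (T' - 0) powr (\<gamma> / (p - 1)) \<le> M"
      by (rule M(2)) (auto simp: inf Ico0_def T'_def)
    ultimately show False using u_0 u0_pos by simp
  qed
  then show ?thesis using Tb_cases that by metis
qed

text \<open>The scaled function \<open>l powr \<beta> * u (l * t)\<close> solves the same equation with initial value \<open>l powr \<beta> * u0\<close>,
  while the shifted function \<open>u (t + h)\<close> solves it with an additional decreasing forcing term.\<close>

lemma shifted_le_scaled:
  fixes l h S t2 t :: real
  defines "\<beta> \<equiv> \<gamma> / (p - 1)"
  defines "D \<equiv> \<lambda>t. u (t + h) - l powr \<beta> * u (l * t)"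
  assumes "0 < A" "1 < p" "0 < l" "0 \<le> h" "S + h \<in> Ico0 Tb" "l * S \<in> Ico0 Tb"
    and t2: "0 \<le> t2" "\<And>s. 0 \<le> s \<Longrightarrow> s \<le> t2 \<Longrightarrow> 0 \<le> D s" "D t2 \<le> 0"
    and t: "t2 \<le> t" "t \<le> S"
  shows "D t \<le> 0"
proof -
  have \<beta>: "0 < \<beta>" "\<beta> * p = \<beta> + \<gamma>" using \<gamma> assms(3,4) by (auto simp: \<beta>_def field_simps)
  have S: "0 \<le> S" using t t2 by simp
  have G: "0 < Gamma \<gamma>" using \<gamma> by simp
  define v where "v = (\<lambda>t. u (t + h))"
  define z where "z = (\<lambda>t. l powr \<beta> * u (l * t))"
  define g where "g = (\<lambda>t. A * (v t powr p - z t powr p))"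
  define q where "q = (\<lambda>t. integral {0..h} (\<lambda>s. (t + h - s) powr (\<gamma> - 1) * u s powr p) / Gamma \<gamma>)"
  have in1: "s + h \<in> Ico0 Tb" and in2: "l * s \<in> Ico0 Tb" if "0 \<le> s" "s \<le> S" for s
    using Ico0_down[OF assms(7), of "s + h"] Ico0_down[OF assms(8), of "l * s"] that assms(5,6) by auto
  have vpos: "0 < v s" and zpos: "0 < z s" if "0 \<le> s" "s \<le> S" for s
    using u_pos in1[OF that] in2[OF that] assms(5) by (auto simp: v_def z_def)
  have vc: "continuous_on {0..S} v"
    unfolding v_def using assms(6)
    by (intro continuous_on_compose2[OF u_cont[OF assms(7)]] continuous_intros) auto
  have zc: "continuous_on {0..S} z"
    unfolding z_def using assms(5)
    by (intro continuous_on_mult continuous_on_const continuous_on_compose2[OF u_cont[OF assms(8)]] continuous_on_id) auto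
  have vpc: "continuous_on {0..S} (\<lambda>s. v s powr p)" and zpc: "continuous_on {0..S} (\<lambda>s. z s powr p)"
    using vpos zpos by (intro continuous_on_powr vc zc continuous_on_const; force)+
  have gc: "continuous_on {0..S} g"
    unfolding g_def by (intro continuous_intros vpc zpc continuous_on_diff)
  have Dc: "continuous_on {0..S} D" unfolding D_def using vc zc by (auto simp: v_def z_def intro: continuous_on_diff)
  have D_eq: "D s = u0 - l powr \<beta> * u0 + A * q s + rl \<gamma> g s" if s: "0 \<le> s" "s \<le> S" for s
  proof -
    have sub: "{0..s} \<subseteq> {0..S}" using s by auto
    have "v s = u0 + A * (q s + rl \<gamma> (\<lambda>s. v s powr p) s)"
      using u_eq[OF in1[OF s]] rl_shift[OF \<gamma>(1) assms(6) s(1) up_cont[OF in1[OF s]]] by (simp add: v_def q_def)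
    moreover have "z s = l powr \<beta> * u0 + A * rl \<gamma> (\<lambda>s. z s powr p) s"
    proof -
      have "rl \<gamma> (\<lambda>s. z s powr p) s = rl \<gamma> (\<lambda>s. l powr (\<beta> * p) * (\<lambda>r. u r powr p) (l * s)) s"
      proof (rule rl_cong)
        fix r assume "0 < r" "r \<le> s"
        then have "0 < u (l * r)" using s by (intro u_pos in2) auto
        then show "z r powr p = l powr (\<beta> * p) * u (l * r) powr p"
          using assms(5) by (simp add: z_def powr_mult powr_powr)
      qed
      also have "\<dots> = l powr (\<beta> * p) * (l powr (- \<gamma>) * rl \<gamma> (\<lambda>r. u r powr p) (l * s))"
        unfolding rl_cmult using rl_scale[OF assms(5) s(1), of \<gamma> "\<lambda>r. u r powr p"] by simp
      also have "\<dots> = l powr \<beta> * rl \<gamma> (\<lambda>r. u r powr p) (l * s)"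
        using assms(5) \<beta> by (simp add: powr_add powr_minus)
      finally show ?thesis using u_eq[OF in2[OF s]] by (simp add: z_def distrib_left)
    qed
    moreover have "rl \<gamma> g s = A * (rl \<gamma> (\<lambda>s. v s powr p) s - rl \<gamma> (\<lambda>s. z s powr p) s)"
      unfolding g_def rl_cmult
      by (subst rl_diff[OF \<gamma>(1) continuous_on_subset[OF vpc sub] continuous_on_subset[OF zpc sub]]) simp
    ultimately show ?thesis by (simp add: D_def v_def z_def algebra_simps)
  qed
  have q_mono: "q s \<le> q t2" if s: "t2 \<le> s" "s \<le> S" for s
  proof -
    have uh: "continuous_on {0..h} (\<lambda>s. u s powr p)"
      using in1[of 0] S assms(6) by (intro up_cont) auto
    have "integral {0..h} (\<lambda>r. (s + h - r) powr (\<gamma> - 1) * u r powr p) \<le> integral {0..h} (\<lambda>r. (t2 + h - r) powr (\<gamma> - 1) * u r powr p)"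
    proof (rule integral_le_off_point[where c = "t2 + h"])
      show "(\<lambda>r. (s + h - r) powr (\<gamma> - 1) * u r powr p) integrable_on {0..h}"
        "(\<lambda>r. (t2 + h - r) powr (\<gamma> - 1) * u r powr p) integrable_on {0..h}"
        using s t2(1) by (intro integrable_kernel \<gamma> uh; simp)+
      show "(s + h - r) powr (\<gamma> - 1) * u r powr p \<le> (t2 + h - r) powr (\<gamma> - 1) * u r powr p"
        if "0 \<le> r" "r \<le> h" "r \<noteq> t2 + h" for r
        using that s t2(1) \<gamma> by (intro mult_right_mono powr_mono2') auto
    qed
    then show ?thesis using G by (simp add: q_def divide_right_mono)
  qed
  obtain B where B: "0 \<le> B" "\<And>s. 0 \<le> s \<Longrightarrow> s \<le> S \<Longrightarrow> 0 \<le> D s \<Longrightarrow> g s \<le> B * D s"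
  proof -
    \<comment> \<open>By monotonicity the shifted solution is at least u h and the scaled one at
      least its initial value, so m bounds both from below.\<close>
    define m where "m = min (u h) (l powr \<beta> * u0)"
    obtain Mv where Mv: "\<And>s. 0 \<le> s \<Longrightarrow> s \<le> S \<Longrightarrow> \<bar>v s\<bar> \<le> Mv" using continuous_on_Icc_bounded[OF vc] by blast
    obtain Mz where Mz: "\<And>s. 0 \<le> s \<Longrightarrow> s \<le> S \<Longrightarrow> \<bar>z s\<bar> \<le> Mz" using continuous_on_Icc_bounded[OF zc] by blast
    have m: "0 < m" using u0_pos u_pos[OF in1[of 0]] S assms(5) by (simp add: m_def)
    obtain B where B: "0 \<le> B" "\<And>x y. m \<le> x \<Longrightarrow> x \<le> max Mv Mz \<Longrightarrow> m \<le> y \<Longrightarrow> y \<le> max Mv Mz \<Longrightarrow> \<bar>x powr p - y powr p\<bar> \<le> B * \<bar>x - y\<bar>"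
      using powr_Lipschitz[OF m, of "max Mv Mz" p] by blast
    have "g s \<le> A * B * D s" if s: "0 \<le> s" "s \<le> S" "0 \<le> D s" for s
    proof -
      have "u h \<le> v s" unfolding v_def using nondecreasing[OF assms(3,6) _ in1[OF s(1,2)]] s(1) by simp
      moreover have "u 0 \<le> u (l * s)"
        using nondecreasing[OF assms(3) order_refl _ in2[OF s(1,2)]] s(1) assms(5) by simp
      then have "l powr \<beta> * u0 \<le> z s" unfolding z_def using u_0 by (intro mult_left_mono) auto
      ultimately have "\<bar>v s powr p - z s powr p\<bar> \<le> B * \<bar>v s - z s\<bar>"
        using Mv[OF s(1,2)] Mz[OF s(1,2)] by (intro B(2)) (auto simp: m_def)
      also have "\<bar>v s - z s\<bar> = D s" using s(3) by (simp add: D_def v_def z_def)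
      finally have "v s powr p - z s powr p \<le> B * D s" by linarith
      then have "g s \<le> A * (B * D s)" unfolding g_def using assms(3) by (intro mult_left_mono) auto
      then show ?thesis by (simp only: mult.assoc)
    qed
    then show ?thesis using that[of "A * B"] B(1) assms(3) by simp
  qed
  have g_sign: "0 \<le> g s" if "0 \<le> s" "s \<le> S" "0 \<le> D s" for s
    using that vpos zpos assms(3,4) unfolding g_def D_def v_def z_def
    by (intro mult_nonneg_nonneg) (auto intro!: powr_mono2 simp: less_imp_le)
  have g_sign': "g s \<le> 0" if "0 \<le> s" "s \<le> S" "D s \<le> 0" for s
  proof -
    have "v s powr p \<le> z s powr p"
      using that vpos[OF that(1,2)] assms(4) by (intro powr_mono2) (auto simp: D_def v_def z_def)
    then show ?thesis using assms(3) by (simp add: g_def mult_nonneg_nonpos)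
  qed
  \<comment> \<open>The positive part of D after t2, with time restarted there; it will satisfy a
    Gronwall inequality without forcing.\<close>
  define E where "E = (\<lambda>r. max 0 (D (r + t2)))"
  define R where "R = S - t2"
  have R: "0 \<le> t - t2" "t - t2 \<le> R" using t by (auto simp: R_def)
  have sh: "continuous_on {0..R} (\<lambda>r. f (r + t2))" if "continuous_on {0..S} f" for f :: "real \<Rightarrow> real"
    using t2(1) by (intro continuous_on_compose2[OF that] continuous_intros) (auto simp: R_def)
  have Ec: "continuous_on {0..R} E"
    unfolding E_def by (intro continuous_on_max continuous_on_const sh Dc)
  have E_le: "E r \<le> B * rl \<gamma> E r" if r: "0 \<le> r" "r \<le> R" for r
  proof -
    have Er: "continuous_on {0..r} E" and gr: "continuous_on {0..r} (\<lambda>r. g (r + t2))"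
      using r by (auto intro: continuous_on_subset[OF Ec] continuous_on_subset[OF sh[OF gc]])
    have rS: "t2 \<le> r + t2" "r + t2 \<le> S" "0 \<le> r + t2" using r t2(1) by (auto simp: R_def)
    have gt2: "continuous_on {0..t2} g"
      using t by (intro continuous_on_subset[OF gc]) auto
    let ?K = "\<lambda>t s. (t - s) powr (\<gamma> - 1) * g s"
    have i1: "?K (r + t2) integrable_on {0..t2}" "?K t2 integrable_on {0..t2}"
      using rS(1) by (intro integrable_kernel \<gamma> gt2; simp)+
    \<comment> \<open>Before t2 the difference D, and with it g, is nonnegative, so the fading of
      this part of the history can only lower D.\<close>
    have "integral {0..t2} (?K (r + t2)) \<le> integral {0..t2} (?K t2)"
    proof (rule integral_le_off_point[OF i1, of t2])
      fix s assume s: "0 \<le> s" "s \<le> t2" "s \<noteq> t2"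
      show "?K (r + t2) s \<le> ?K t2 s"
        using s r(1) \<gamma> g_sign[of s] t2(2)[of s] t by (intro mult_right_mono powr_mono2') auto
    qed
    then have 1: "integral {0..t2} (?K (r + t2)) / Gamma \<gamma> \<le> rl \<gamma> g t2"
      using G by (simp add: rl_def divide_right_mono)
    have "rl \<gamma> (\<lambda>r. g (r + t2)) r \<le> rl \<gamma> (\<lambda>s. B * E s) r"
    proof (rule rl_mono[OF \<gamma>(1) gr continuous_on_mult[OF continuous_on_const Er]])
      fix s assume "0 \<le> s" "s \<le> r"
      then have s: "0 \<le> s + t2" "s + t2 \<le> S" using rS t2(1) by auto
      show "g (s + t2) \<le> B * E s"
      proof (cases "0 \<le> D (s + t2)")
        case True
        then show ?thesis using B(2)[OF s True] by (simp add: E_def)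
      next
        case False
        then have "g (s + t2) \<le> 0" using g_sign'[OF s] by simp
        also have "0 \<le> B * E s" using B(1) by (simp add: E_def)
        finally show ?thesis .
      qed
    qed
    then have 2: "rl \<gamma> (\<lambda>r. g (r + t2)) r \<le> B * rl \<gamma> E r" by (simp only: rl_cmult)
    have "continuous_on {0..r + t2} g"
      using rS by (intro continuous_on_subset[OF gc]) auto
    then have "rl \<gamma> g (r + t2) = integral {0..t2} (?K (r + t2)) / Gamma \<gamma> + rl \<gamma> (\<lambda>r. g (r + t2)) r"
      by (rule rl_shift[OF \<gamma>(1) t2(1) r(1)])
    moreover have "D t2 = u0 - l powr \<beta> * u0 + A * q t2 + rl \<gamma> g t2"
      using t t2(1) by (intro D_eq) auto
    moreover have "A * q (r + t2) \<le> A * q t2" using q_mono[OF rS(1,2)] assms(3) by simp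
    ultimately have "D (r + t2) \<le> B * rl \<gamma> E r"
      using D_eq[OF rS(3,2)] 1 2 t2(3) by linarith
    moreover have "0 \<le> B * rl \<gamma> E r"
      using B(1) by (intro mult_nonneg_nonneg rl_nonneg \<gamma> Er) (auto simp: E_def)
    ultimately show ?thesis by (simp add: E_def)
  qed
  have "E (t - t2) = 0"
    by (rule rl_gronwall[OF \<gamma>(1) B(1) Ec _ E_le R]) (auto simp: E_def)
  then show ?thesis by (simp add: E_def max_def split: if_splits)
qed


text \<open>The scaled solution with initial value \<open>u h\<close> dominates the shift of \<open>u\<close> by \<open>h\<close>, so it blows up first;
  comparing the two blow-up times gives the claim.\<close>

lemma weighted_ge_initial:
  assumes "0 < A" "1 < p" "Tb = ereal T" "0 \<le> h" "h < T"
  shows "u0 * T powr (\<gamma> / (p - 1)) \<le> u h * (T - h) powr (\<gamma> / (p - 1))"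
proof -
  define \<beta> where "\<beta> = \<gamma> / (p - 1)"
  have \<beta>: "0 < \<beta>" using \<gamma> assms by (simp add: \<beta>_def)
  have T0: "0 < T" using assms by simp
  have in_Ico: "s \<in> Ico0 Tb \<longleftrightarrow> 0 \<le> s \<and> s < T" for s using assms(3) by (simp add: Ico0_def)
  \<comment> \<open>This l scales the initial value u0 to u h.\<close>
  define l where "l = (u h / u0) powr (1 / \<beta>)"
  have uh: "0 < u h" using u_pos[of h] in_Ico[of h] assms(4,5) by blast
  have l: "0 < l" "l powr \<beta> = u h / u0" using uh u0_pos \<beta> by (auto simp: l_def powr_powr)
  have "T \<le> l * (T - h)"
  proof (rule ccontr)
    assume "\<not> T \<le> l * (T - h)"
    then have less: "l * (T - h) < T" by simp
    \<comment> \<open>While the shifted solution runs up to T, the scaled one only uses times up to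
      l * (T - h) < T, where u is bounded; so C would bound u on [0, T).\<close>
    define C where "C = max (u (l * (T - h)) * l powr \<beta>) (u h)"
    have "u t \<le> C" if t: "0 \<le> t" "t < T" for t
    proof (cases "t \<le> h")
      case True
      then show ?thesis using nondecreasing[OF assms(1) t(1) True] assms(4,5) by (simp add: C_def in_Ico)
    next
      case False
      define s where "s = t - h"
      have s: "0 \<le> s" "s + h = t" "s < T - h" using False t by (auto simp: s_def)
      have ls: "l * s \<le> l * (T - h)" using s l by (intro mult_left_mono) auto
      have ls': "l * s < T" using ls less by linarith
      \<comment> \<open>Here t2 = 0, since both functions start from the value u h.\<close>
      have "u (s + h) - l powr (\<gamma> / (p - 1)) * u (l * s) \<le> 0"
        by (rule shifted_le_scaled[OF assms(1,2) l(1) assms(4), of s 0 s])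
          (use s t l u_0 u0_pos ls' in \<open>auto simp: in_Ico \<beta>_def\<close>)
      moreover have "u (l * s) \<le> u (l * (T - h))"
        using s l ls less by (intro nondecreasing assms) (auto simp: in_Ico)
      ultimately have "u t \<le> l powr \<beta> * u (l * (T - h))"
        using s(2) mult_left_mono[of "u (l * s)" "u (l * (T - h))" "l powr \<beta>"] by (simp add: \<beta>_def)
      then show ?thesis by (simp add: C_def mult.commute)
    qed
    moreover have "u0 \<le> u t" if "0 \<le> t" "t < T" for t
      using nondecreasing[OF assms(1), of 0 t] that u_0 by (simp add: in_Ico)
    ultimately show False using not_bounded[OF assms(3) u0_pos, of C] by (meson in_Ico not_le)
  qed
  then have "T powr \<beta> \<le> (l * (T - h)) powr \<beta>" using T0 \<beta> by (intro powr_mono2) auto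
  also have "\<dots> = u h / u0 * (T - h) powr \<beta>" using l assms by (simp add: powr_mult)
  finally have "u0 * T powr \<beta> \<le> u0 * (u h / u0 * (T - h) powr \<beta>)" using u0_pos by (intro mult_left_mono) auto
  then show ?thesis using u0_pos by (simp add: \<beta>_def)
qed

text \<open>The upper bound is the limit of \<open>blowup_bound\<close> as T' tends to T, and the
  lower bound is \<open>weighted_ge_initial\<close>. For convergence, an increment of V over a is a
  positive multiple of the difference in \<open>shifted_le_scaled\<close> with l = exp a; once that
  difference has become negative it stays nonpositive, which is the hypothesis of
  \<open>single_sign_change_tendsto\<close>.\<close>

lemma weighted_tendsto:
  assumes "0 < A" "1 < p" "Tb = ereal T"
  obtains L M where "0 < L" "((\<lambda>t. u t * (T - t) powr (\<gamma> / (p - 1))) \<longlongrightarrow> L) (at_left T)"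
    "\<And>t. 0 \<le> t \<Longrightarrow> t < T \<Longrightarrow> u t * (T - t) powr (\<gamma> / (p - 1)) \<le> M"
proof -
  define \<beta> where "\<beta> = \<gamma> / (p - 1)"
  have \<beta>: "0 < \<beta>" using \<gamma> assms by (simp add: \<beta>_def)
  have T0: "0 < T" using assms Tb_pos by simp
  have in_Ico: "s \<in> Ico0 Tb \<longleftrightarrow> 0 \<le> s \<and> s < T" for s using assms(3) by (simp add: Ico0_def)
  define W where "W = (\<lambda>t. u t * (T - t) powr \<beta>)"
  obtain M where "0 < M" and M: "\<And>T' t. T' \<in> Ico0 Tb \<Longrightarrow> 0 \<le> t \<Longrightarrow> t \<le> T' \<Longrightarrow> u t * (T' - t) powr \<beta> \<le> M"
    using blowup_bound[OF assms(1,2), folded \<beta>_def] by blast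
  have W_le: "W t \<le> M" if t: "0 \<le> t" "t < T" for t
  proof (rule tendsto_upperbound)
    show "((\<lambda>T'. u t * (T' - t) powr \<beta>) \<longlongrightarrow> W t) (at_left T)"
      unfolding W_def using t by (intro tendsto_intros) auto
    show "\<forall>\<^sub>F T' in at_left T. u t * (T' - t) powr \<beta> \<le> M"
      using eventually_at_left_real[OF t(2)] by (rule eventually_mono) (use t in \<open>auto intro!: M simp: in_Ico\<close>)
  qed auto
  define m where "m = u0 * T powr \<beta>"
  have m: "0 < m" using u0_pos T0 by (simp add: m_def)
  have W_ge: "m \<le> W t" if "0 \<le> t" "t < T" for t
    using weighted_ge_initial[OF assms that] by (simp add: W_def m_def \<beta>_def)
  define time where "time = (\<lambda>x. T - exp (- x))"
  \<comment> \<open>The logarithmic time that corresponds to t = 0.\<close>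
  define x0 where "x0 = - ln T"
  have time: "0 \<le> time x" "time x < T" if "x0 \<le> x" for x
  proof -
    have "exp (- x) \<le> exp (ln T)" using that by (subst exp_le_cancel_iff) (simp add: x0_def)
    then show "0 \<le> time x" "time x < T" using T0 by (auto simp: time_def)
  qed
  define V where "V = (\<lambda>x. W (time x))"
  have uc: "continuous_on {0..<T} u"
    using volterra in_Ico by (auto elim!: continuous_on_subset)
  have Wc: "continuous_on {0..<T} W"
    unfolding W_def by (intro continuous_on_mult uc continuous_on_powr continuous_intros) auto
  have Vc: "continuous_on {x0..} V"
    unfolding V_def
  proof (rule continuous_on_compose2[OF Wc])
    show "continuous_on {x0..} time" unfolding time_def by (intro continuous_intros)
    show "time ` {x0..} \<subseteq> {0..<T}" using time by auto
  qed
  have drop: "V (y + a) \<le> V y" if x: "x0 \<le> x" and a: "0 < a" and lt: "V (x + a) < V x" and y: "x \<le> y" for x a y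
  proof -
    define l where "l = exp a"
    \<comment> \<open>With this h the shifted and the scaled solution both blow up at time T /
      l.\<close>
    define h where "h = T - T / l"
    have l: "1 < l" using a by (simp add: l_def)
    have h: "0 \<le> h" "h < T" using l T0 by (simp_all add: h_def field_simps)
    define D where "D = (\<lambda>t. u (t + h) - l powr \<beta> * u (l * t))"
    \<comment> \<open>At time \<open>\<tau> r\<close> the shift reads u at
      \<open>time (r + a)\<close> and the scaling reads it at \<open>time r\<close>, so D compares V
      at r + a with V at r.\<close>
    define \<tau> where "\<tau> = (\<lambda>x. time (x + a) - h)"
    have \<tau>: "\<tau> r + h = time (r + a)" "l * \<tau> r = time r" for r
      using l by (simp_all add: \<tau>_def time_def h_def l_def exp_diff exp_add exp_minus field_simps)
    have DV: "D (\<tau> r) = exp (\<beta> * (r + a)) * (V (r + a) - V r)" for r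
    proof -
      have "exp (- r) powr \<beta> = exp (- (\<beta> * r))" for r by (simp add: exp_powr_real mult.commute)
      then have uV: "u (time r) = exp (\<beta> * r) * V r" for r
        by (simp add: V_def W_def time_def exp_minus)
      have "l powr \<beta> = exp (\<beta> * a)" by (simp add: l_def exp_powr_real mult.commute)
      then show ?thesis
        unfolding D_def \<tau> uV by (simp add: distrib_left exp_add right_diff_distrib)
    qed
    have \<tau>0: "0 \<le> \<tau> r" if "x0 \<le> r" for r
      using time(1)[OF that] \<tau>(2)[of r] l by (metis less_trans zero_less_mult_pos linorder_not_le mult_pos_neg zero_less_one)
    have \<tau>_mono: "\<tau> x \<le> \<tau> y" using y by (simp add: \<tau>_def time_def)
    have lim: "\<tau> y + h \<in> Ico0 Tb" "l * \<tau> y \<in> Ico0 Tb"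
      unfolding \<tau> in_Ico using time[of "y + a"] time[of y] x y a by auto
    have "D (\<tau> x) < 0" unfolding DV using lt by (simp add: mult_pos_neg)
    \<comment> \<open>As l = T / (T - h), this amounts to W h \<ge> W 0.\<close>
    have D0: "0 \<le> D 0"
    proof -
      have "l powr \<beta> * (T - h) powr \<beta> = T powr \<beta>"
        using l T0 by (simp add: h_def flip: powr_mult)
      moreover have "u0 * T powr \<beta> \<le> u h * (T - h) powr \<beta>"
        using weighted_ge_initial[OF assms h] by (simp add: \<beta>_def)
      ultimately have "(l powr \<beta> * u0) * (T - h) powr \<beta> \<le> u h * (T - h) powr \<beta>"
        by (simp add: mult_ac)
      then show ?thesis using h u_0 by (simp add: D_def mult_le_cancel_right)
    qed
    have Dc: "continuous_on {0..\<tau> y} D"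
    proof -
      have "continuous_on {0..\<tau> y} (\<lambda>t. u (t + h))"
        by (rule continuous_on_compose2[OF u_cont[OF lim(1)]]) (use h in \<open>auto intro!: continuous_intros\<close>)
      moreover have "continuous_on {0..\<tau> y} (\<lambda>t. u (l * t))"
        by (rule continuous_on_compose2[OF u_cont[OF lim(2)]]) (use l in \<open>auto intro!: continuous_intros\<close>)
      ultimately show ?thesis unfolding D_def by (intro continuous_intros)
    qed
    \<comment> \<open>t2 is the first zero of D, which is 0 if D vanishes at once; it comes no later
      than \<open>\<tau> x\<close>, where D is negative.\<close>
    obtain t2 where t2: "0 \<le> t2" "\<And>s. 0 \<le> s \<Longrightarrow> s \<le> t2 \<Longrightarrow> 0 \<le> D s" "D t2 \<le> 0" "t2 \<le> \<tau> x"
    proof (cases "D 0 = 0")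
      case True
      have "0 \<le> D s" if "0 \<le> s" "s \<le> 0" for s using that True by simp
      then show ?thesis using that[of 0] True \<tau>0[OF x] by simp
    next
      case False
      then obtain t0 where t0: "0 < t0" "D t0 = 0" "\<And>s. 0 \<le> s \<Longrightarrow> s < t0 \<Longrightarrow> 0 < D s"
        using first_zero[OF Dc _ \<tau>0[OF x] \<tau>_mono] D0 \<open>D (\<tau> x) < 0\<close> by (metis less_eq_real_def)
      have "t0 \<le> \<tau> x" using t0(3)[OF \<tau>0[OF x]] \<open>D (\<tau> x) < 0\<close> by (meson linorder_not_le less_asym)
      moreover have "0 \<le> D s" if "0 \<le> s" "s \<le> t0" for s
        using t0(2) t0(3)[of s] that by (cases "s = t0") auto
      ultimately show ?thesis using that[of t0] t0 by simp
    qed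
    have "D (\<tau> y) \<le> 0"
      unfolding D_def \<beta>_def
      by (rule shifted_le_scaled[OF assms(1,2) _ h(1) lim, of t2])
        (use t2 \<tau>_mono l in \<open>simp_all add: D_def \<beta>_def\<close>)
    then show ?thesis unfolding DV by (simp add: mult_le_0_iff)
  qed
  obtain L where L: "(V \<longlongrightarrow> L) at_top"
  proof (rule single_sign_change_tendsto[OF Vc _ _ drop])
    show "m \<le> V x" "V x \<le> M" if "x0 \<le> x" for x
      using time[OF that] W_ge W_le by (auto simp: V_def)
  qed
  have "m \<le> L"
  proof (rule tendsto_lowerbound[OF L])
    show "\<forall>\<^sub>F x in at_top. m \<le> V x"
      using eventually_ge_at_top[of x0] by (rule eventually_mono) (use time W_ge in \<open>auto simp: V_def\<close>)
  qed simp
  moreover have "(W \<longlongrightarrow> L) (at_left T)"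
  proof -
    have "filterlim (\<lambda>t. T - t) (at_right 0) (at_left T)"
      unfolding filterlim_at
    proof
      have "((\<lambda>t. T - t) \<longlongrightarrow> T - T) (at_left T)" by (intro tendsto_intros)
      then show "((\<lambda>t. T - t) \<longlongrightarrow> 0) (at_left T)" by simp
      show "\<forall>\<^sub>F t in at_left T. T - t \<in> {0<..} \<and> T - t \<noteq> 0"
        using eventually_at_left_real[OF T0] by (rule eventually_mono) auto
    qed
    then have "filterlim (\<lambda>t. ln (T - t)) at_bot (at_left T)"
      by (rule filterlim_compose[OF ln_at_0])
    then have "filterlim (\<lambda>t. - ln (T - t)) at_top (at_left T)"
      by (simp add: filterlim_uminus_at_bot)
    then have "((\<lambda>t. V (- ln (T - t))) \<longlongrightarrow> L) (at_left T)"
      by (rule filterlim_compose[OF L])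
    moreover have "\<forall>\<^sub>F t in at_left T. V (- ln (T - t)) = W t"
      using eventually_at_left_real[OF T0] by (rule eventually_mono) (auto simp: V_def time_def)
    ultimately show ?thesis by (rule Lim_transform_eventually)
  qed
  ultimately show ?thesis
    using that[of L M] m W_le unfolding W_def \<beta>_def by simp
qed

section \<open>Identification of the blow-up constant\<close>

text \<open>The substitution y = (T - t) / (T - s) gives t - s = (\<epsilon> / y) * (1 - y). After u
  is written through its weighted version all remaining powers of \<epsilon> cancel, leaving the
  Beta density in y. The cut-off \<epsilon> / T corresponds to s = 0, and extension by zero fixes
  the domain for the limit \<epsilon> -> 0.\<close>

lemma kernel_integral_substitution:
  assumes "0 < t" "t < T" "0 < A" "1 < p" "Tb = ereal T"
  defines "\<beta> \<equiv> \<gamma> / (p - 1)" and "\<epsilon> \<equiv> T - t"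
  shows "((\<lambda>y. if y \<in> {\<epsilon> / T..1} then
            y powr (\<beta> - 1) * (1 - y) powr (\<gamma> - 1) * (u (T - \<epsilon> / y) * (\<epsilon> / y) powr \<beta>) powr p else 0)
          has_integral (\<epsilon> powr \<beta> * (Gamma \<gamma> * rl \<gamma> (\<lambda>s. u s powr p) t))) {0..1}"
proof -
  have \<beta>: "0 < \<beta>" "\<beta> * p = \<beta> + \<gamma>" using \<gamma> assms(4) by (auto simp: \<beta>_def field_simps)
  have in_Ico: "s \<in> Ico0 Tb \<longleftrightarrow> 0 \<le> s \<and> s < T" for s using assms(5) by (simp add: Ico0_def)
  have e: "0 < \<epsilon>" "\<epsilon> < T" "0 < T" using assms by (auto simp: \<epsilon>_def)
  define S where "S = {\<epsilon> / T..1}"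
  define G where "G = (\<lambda>y. T - \<epsilon> / y)"
  define f where "f = (\<lambda>s. (t - s) powr (\<gamma> - 1) * u s powr p)"
  have Spos: "0 < y" if "y \<in> S" for y using that e by (auto simp: S_def intro: less_le_trans[of 0 "\<epsilon> / T"])
  have der: "(G has_field_derivative \<epsilon> / y\<^sup>2) (at y within S)" if "y \<in> S" for y
    using Spos[OF that] unfolding G_def
    by (auto intro!: derivative_eq_intros simp: power2_eq_square)
  have inj: "inj_on G S"
  proof (rule inj_onI)
    fix x y assume "x \<in> S" "y \<in> S" "G x = G y"
    then show "x = y" using Spos[of x] Spos[of y] e by (simp add: G_def field_simps)
  qed
  have img: "G ` S = {0..t}"
  proof
    show "G ` S \<subseteq> {0..t}"
    proof
      fix s assume "s \<in> G ` S"
      then obtain y where y: "y \<in> S" "s = T - \<epsilon> / y" by (auto simp: G_def)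
      have y': "0 < y" "\<epsilon> / T \<le> y" "y \<le> 1" using y(1) Spos[OF y(1)] by (auto simp: S_def)
      have "\<epsilon> \<le> T * y" using y'(2) e(3) by (simp add: pos_divide_le_eq mult.commute)
      then have "\<epsilon> / y \<le> T" using y'(1) by (simp add: pos_divide_le_eq)
      moreover have "\<epsilon> * y \<le> \<epsilon>" using y'(3) e(1) by (intro mult_left_le) auto
      then have "\<epsilon> \<le> \<epsilon> / y" using y'(1) by (simp add: pos_le_divide_eq)
      ultimately have "\<epsilon> / y \<le> T" "\<epsilon> \<le> \<epsilon> / y" .
      then show "s \<in> {0..t}" using y(2) by (simp add: \<epsilon>_def)
    qed
    show "{0..t} \<subseteq> G ` S"
    proof
      fix s assume s: "s \<in> {0..t}"
      have "\<epsilon> / (T - s) \<in> S" using s assms(1,2) e by (simp add: S_def \<epsilon>_def divide_left_mono)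
      moreover have "G (\<epsilon> / (T - s)) = s" using s assms(1,2) e by (simp add: G_def)
      ultimately show "s \<in> G ` S" by (metis imageI)
    qed
  qed
  have "f absolutely_integrable_on {0..t}"
    unfolding f_def using assms(1,2) by (intro absolutely_integrable_kernel \<gamma> up_cont) (auto simp: in_Ico)
  then have "(\<lambda>y. \<bar>\<epsilon> / y\<^sup>2\<bar> * f (G y)) absolutely_integrable_on S \<and>
      integral S (\<lambda>y. \<bar>\<epsilon> / y\<^sup>2\<bar> * f (G y)) = integral {0..t} f"
    using has_absolute_integral_change_of_variables_1'[OF _ der inj, of f "integral {0..t} f"] img
    by (simp add: S_def)
  then have hi: "((\<lambda>y. \<bar>\<epsilon> / y\<^sup>2\<bar> * f (G y)) has_integral integral {0..t} f) S"
    using set_lebesgue_integral_eq_integral(1) has_integral_integral by metis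
  have "\<epsilon> powr \<beta> * (\<bar>\<epsilon> / y\<^sup>2\<bar> * f (G y)) =
      y powr (\<beta> - 1) * (1 - y) powr (\<gamma> - 1) * (u (T - \<epsilon> / y) * (\<epsilon> / y) powr \<beta>) powr p" if y: "y \<in> S" for y
  proof -
    have y0: "0 < y" "y \<le> 1" using Spos[OF y] y by (auto simp: S_def)
    have "G y \<in> {0..t}" using img y by blast
    then have up: "0 < u (G y)" using assms(2) by (intro u_pos) (auto simp: in_Ico)
    have "t - G y = \<epsilon> / y * (1 - y)" using y0 by (simp add: G_def \<epsilon>_def field_simps)
    then have fG: "f (G y) = (\<epsilon> / y) powr (\<gamma> - 1) * (1 - y) powr (\<gamma> - 1) * u (G y) powr p"
      unfolding f_def by (simp only: powr_mult)
    have pw: "(u (G y) * (\<epsilon> / y) powr \<beta>) powr p = u (G y) powr p * (\<epsilon> / y) powr (\<beta> + \<gamma>)"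
      using up y0 e by (simp add: powr_mult powr_powr \<beta>(2))
    have ep: "\<epsilon> powr \<beta> * (\<epsilon> / y\<^sup>2 * (\<epsilon> / y) powr (\<gamma> - 1)) = y powr (\<beta> - 1) * (\<epsilon> / y) powr (\<beta> + \<gamma>)"
    proof -
      define r where "r = \<epsilon> / y"
      have r: "0 < r" "\<epsilon> = r * y" using y0 e by (auto simp: r_def)
      have "\<epsilon> powr \<beta> * (\<epsilon> / y\<^sup>2 * r powr (\<gamma> - 1)) = r powr \<beta> * y powr \<beta> * (r / y * (r powr \<gamma> / r))"
        using r y0 by (simp add: powr_mult powr_diff power2_eq_square)
      also have "\<dots> = y powr (\<beta> - 1) * r powr (\<beta> + \<gamma>)"
        using r y0 by (simp add: powr_add powr_diff)
      finally show ?thesis by (simp add: r_def)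
    qed
    have alg: "E * (d * (q * b * v)) = a * b * (v * r)" if "E * (d * q) = a * r" for E d q a b v r :: real
    proof -
      have "E * (d * (q * b * v)) = (E * (d * q)) * (b * v)" by (simp only: mult_ac)
      then show ?thesis unfolding that by (simp only: mult_ac)
    qed
    have abs: "\<bar>\<epsilon> / y\<^sup>2\<bar> = \<epsilon> / y\<^sup>2" using e by simp
    have Gy: "T - \<epsilon> / y = G y" by (simp add: G_def)
    show ?thesis unfolding abs Gy pw fG by (rule alg[OF ep])
  qed
  then have "((\<lambda>y. y powr (\<beta> - 1) * (1 - y) powr (\<gamma> - 1) * (u (T - \<epsilon> / y) * (\<epsilon> / y) powr \<beta>) powr p)
      has_integral \<epsilon> powr \<beta> * integral {0..t} f) S"
    by (rule has_integral_eq[OF _ has_integral_mult_right[OF hi]])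
  moreover have "integral {0..t} f = Gamma \<gamma> * rl \<gamma> (\<lambda>s. u s powr p) t"
  proof -
    have "0 < Gamma \<gamma>" using \<gamma> by simp
    then have "Gamma \<gamma> \<noteq> 0" by linarith
    then show ?thesis by (simp add: rl_def f_def)
  qed
  moreover have "S \<subseteq> {0..1}" using Spos by (force simp: S_def)
  ultimately show ?thesis
    unfolding S_def[symmetric] by (simp only: has_integral_restrict)
qed

text \<open>Multiplied by (T - t) powr \<beta>, the integral equation passes to the limit: the term
  with u0 vanishes, and the weighted solution inside the Beta integral converges boundedly to L. The
  resulting equation has only one positive root.\<close>

lemma blowup_asymptotics:
  assumes "0 < A" "1 < p"
  shows "\<exists>T. Tb = ereal T \<and>
    u \<sim>[at_left T] (\<lambda>t. (Gamma (p * \<gamma> / (p - 1)) / (A * Gamma (\<gamma> / (p - 1)))) powr (1 / (p - 1))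
      * (T - t) powr (- (\<gamma> / (p - 1))))"
proof -
  obtain T where T: "Tb = ereal T" "0 < T" using finite_blowup_time[OF assms] .
  define \<beta> where "\<beta> = \<gamma> / (p - 1)"
  have \<beta>: "0 < \<beta>" "\<beta> * p = \<beta> + \<gamma>" "p * \<gamma> / (p - 1) = \<beta> + \<gamma>"
    using \<gamma> assms(2) by (auto simp: \<beta>_def field_simps)
  define W where "W = (\<lambda>t. u t * (T - t) powr \<beta>)"
  obtain L M where L: "0 < L" "(W \<longlongrightarrow> L) (at_left T)" and M: "\<And>t. 0 \<le> t \<Longrightarrow> t < T \<Longrightarrow> W t \<le> M"
    using weighted_tendsto[OF assms T(1)] unfolding W_def \<beta>_def by blast
  have in_Ico: "s \<in> Ico0 Tb \<longleftrightarrow> 0 \<le> s \<and> s < T" for s using T(1) by (simp add: Ico0_def)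
  have Wpos: "0 < W t" if "0 \<le> t" "t < T" for t using u_pos[of t] that by (simp add: W_def in_Ico)
  have G: "0 < Gamma \<gamma>" "0 < Gamma \<beta>" "0 < Gamma (\<beta> + \<gamma>)" using \<gamma> \<beta> by (auto intro: Gamma_real_pos)
  define k where "k = (\<lambda>y. y powr (\<beta> - 1) * (1 - y) powr (\<gamma> - 1))"
  have k: "(k has_integral Beta \<beta> \<gamma>) {0..1}"
    unfolding k_def using has_integral_Beta_real[of \<beta> \<gamma>] \<beta> \<gamma> by simp
  define F where "F = (\<lambda>t y. if y \<in> {(T - t) / T..1} then k y * W (T - (T - t) / y) powr p else 0)"
  \<comment> \<open>The limit L is known to exist, so one sequence suffices to compute it; the
    factor 1/2 keeps X 0 positive.\<close>
  define X where "X = (\<lambda>n. T - T / 2 / real (Suc n))"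
  have X: "0 < X n" "X n < T" for n
    using T(2) by (auto simp: X_def field_simps add_pos_nonneg)
  have "X \<longlonglongrightarrow> T - 0"
    unfolding X_def by (intro tendsto_diff tendsto_const LIMSEQ_Suc[OF lim_const_over_n])
  then have XT: "X \<longlonglongrightarrow> T" by simp
  then have Xl: "filterlim X (at_left T) sequentially"
    unfolding filterlim_at using X by (auto simp: less_imp_neq)
  have F_int: "(F (X n) has_integral ((T - X n) powr \<beta> * (Gamma \<gamma> * rl \<gamma> (\<lambda>s. u s powr p) (X n)))) {0..1}" for n
    using kernel_integral_substitution[OF X assms T(1), of n]
    unfolding F_def W_def k_def \<beta>_def by (simp cong: if_cong)
  have "(\<lambda>n. integral {0..1} (F (X n))) \<longlonglongrightarrow> integral {0..1} (\<lambda>y. L powr p * k y)"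
  proof (rule dominated_convergence(2))
    show "F (X n) integrable_on {0..1}" for n using F_int by blast
    show "(\<lambda>y. M powr p * k y) integrable_on {0..1}" using k by (intro integrable_on_mult_right) blast
    show "norm (F (X n) y) \<le> M powr p * k y" if "y \<in> {0..1}" for n y
    proof (cases "y \<in> {(T - X n) / T..1}")
      case True
      have "0 < (T - X n) / T" using X[of n] T(2) by simp
      then have y: "0 < y" using True by (auto simp: less_le_trans)
      then have "0 \<le> T - (T - X n) / y" "T - (T - X n) / y < T"
        using True X[of n] T(2) by (auto simp: field_simps)
      then have "W (T - (T - X n) / y) powr p \<le> M powr p"
        using Wpos M assms(2) by (intro powr_mono2) (auto simp: less_imp_le)
      then have "k y * W (T - (T - X n) / y) powr p \<le> k y * M powr p"
        by (intro mult_left_mono) (auto simp: k_def)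
      moreover have "0 \<le> k y * W (T - (T - X n) / y) powr p" by (simp add: k_def)
      ultimately show ?thesis unfolding F_def if_P[OF True] by (simp add: mult.commute)
    next
      case False
      then show ?thesis unfolding F_def if_not_P[OF False] by (simp add: k_def)
    qed
    show "(\<lambda>n. F (X n) y) \<longlonglongrightarrow> L powr p * k y" if y: "y \<in> {0..1}" for y
    proof (cases "y = 0")
      case True
      \<comment> \<open>At y = 0 the integrand is cut off, and k 0 = 0 because
        \<open>0 powr (\<beta> - 1) = 0\<close>.\<close>
      have "F (X n) y = 0" for n using True X[of n] T(2) by (simp add: F_def field_simps)
      then show ?thesis using True by (simp add: k_def)
    next
      case False
      then have y0: "0 < y" "y \<le> 1" using y by auto
      have "(\<lambda>n. T - (T - X n) / y) \<longlonglongrightarrow> T - (T - T) / y"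
        using y0 by (intro tendsto_intros XT) auto
      then have "filterlim (\<lambda>n. T - (T - X n) / y) (at_left T) sequentially"
        unfolding filterlim_at using X y0 by (auto simp: less_imp_neq)
      then have "(\<lambda>n. W (T - (T - X n) / y)) \<longlonglongrightarrow> L"
        by (rule filterlim_compose[OF L(2)])
      then have "(\<lambda>n. k y * W (T - (T - X n) / y) powr p) \<longlonglongrightarrow> k y * L powr p"
        using L(1) by (intro tendsto_intros) auto
      \<comment> \<open>For fixed y > 0 the cut-off (T - X n) / T eventually lies below y.\<close>
      moreover have "\<forall>\<^sub>F n in sequentially. k y * W (T - (T - X n) / y) powr p = F (X n) y"
      proof -
        have "(\<lambda>n. (T - X n) / T) \<longlonglongrightarrow> (T - T) / T" using T(2) by (intro tendsto_intros XT) auto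
        then have "\<forall>\<^sub>F n in sequentially. (T - X n) / T < y" by (rule order_tendstoD) (use y0 in simp)
        then show ?thesis by (rule eventually_mono) (use y0 in \<open>simp add: F_def\<close>)
      qed
      ultimately show ?thesis by (simp add: mult.commute Lim_transform_eventually)
    qed
  qed
  moreover have "integral {0..1} (\<lambda>y. L powr p * k y) = L powr p * Beta \<beta> \<gamma>"
    using has_integral_mult_right[OF k] by (rule integral_unique)
  ultimately have lim: "(\<lambda>n. integral {0..1} (F (X n))) \<longlonglongrightarrow> L powr p * Beta \<beta> \<gamma>" by (simp only:)
  have WX: "W (X n) = (T - X n) powr \<beta> * u0 + A / Gamma \<gamma> * integral {0..1} (F (X n))" for n
  proof -
    have "Gamma \<gamma> \<noteq> 0" using G by linarith
    moreover have "u (X n) = u0 + A * rl \<gamma> (\<lambda>s. u s powr p) (X n)"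
      using X[of n] by (intro u_eq) (simp add: in_Ico)
    ultimately show ?thesis
      unfolding integral_unique[OF F_int] by (simp add: W_def distrib_left distrib_right mult_ac)
  qed
  have "(\<lambda>n. W (X n)) \<longlonglongrightarrow> (T - T) powr \<beta> * u0 + A / Gamma \<gamma> * (L powr p * Beta \<beta> \<gamma>)"
    unfolding WX
  proof (intro tendsto_add tendsto_mult tendsto_const lim tendsto_powr2)
    show "(\<lambda>n. T - X n) \<longlonglongrightarrow> T - T" by (intro tendsto_intros XT)
    show "\<forall>\<^sub>F n in sequentially. 0 \<le> T - X n" using X by (simp add: less_imp_le)
  qed (use \<beta> in auto)
  moreover have "(\<lambda>n. W (X n)) \<longlonglongrightarrow> L" by (rule filterlim_compose[OF L(2) Xl])
  ultimately have "L = A / Gamma \<gamma> * (L powr p * Beta \<beta> \<gamma>)"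
    using LIMSEQ_unique by fastforce
  also have "\<dots> = L * (A * Gamma \<beta> / Gamma (\<beta> + \<gamma>) * L powr (p - 1))"
  proof -
    have "L powr p = L * L powr (p - 1)" using L(1) by (simp add: powr_diff)
    moreover have "a / g * (x * y * (b * g / c)) = x * (a * b / c * y)" if "0 < g" for a b c g x y :: real
      using that by simp
    ultimately show ?thesis using G(1) by (simp only: Beta_def)
  qed
  finally have "A * Gamma \<beta> / Gamma (\<beta> + \<gamma>) * L powr (p - 1) = 1"
    using L(1) by (metis less_irrefl mult_cancel_left1)
  then have "L powr (p - 1) = Gamma (\<beta> + \<gamma>) / (A * Gamma \<beta>)"
  proof -
    have "y = c / (a * b)" if "a * b / c * y = 1" "0 < a" "0 < b" "0 < c" for a b c y :: real
      using that by (simp add: field_simps)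
    then show "A * Gamma \<beta> / Gamma (\<beta> + \<gamma>) * L powr (p - 1) = 1 \<Longrightarrow> ?thesis"
      using assms(1) G by blast
  qed
  moreover have "L = (L powr (p - 1)) powr (1 / (p - 1))" using L(1) assms(2) by (simp add: powr_powr)
  ultimately have L_eq: "L = (Gamma (\<beta> + \<gamma>) / (A * Gamma \<beta>)) powr (1 / (p - 1))" by simp
  have "u \<sim>[at_left T] (\<lambda>t. L * (T - t) powr (- \<beta>))"
  proof (rule asymp_equivI')
    have "((\<lambda>t. W t / L) \<longlongrightarrow> L / L) (at_left T)" using L by (intro tendsto_intros) auto
    then have "((\<lambda>t. W t / L) \<longlongrightarrow> 1) (at_left T)" using L(1) by simp
    then show "((\<lambda>t. u t / (L * (T - t) powr (- \<beta>))) \<longlongrightarrow> 1) (at_left T)"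
    proof (rule Lim_transform_eventually)
      show "\<forall>\<^sub>F t in at_left T. W t / L = u t / (L * (T - t) powr (- \<beta>))"
        using eventually_at_left_real[OF T(2)]
        by (rule eventually_mono) (simp add: W_def powr_minus divide_inverse)
    qed
  qed
  then show ?thesis
    unfolding L_eq \<beta>(3) \<beta>_def[symmetric] using T(1) by blast
qed

end

theorem theorem3p1:
  fixes \<gamma> A p u0 :: real and Tb :: ereal and u :: "real \<Rightarrow> real"
  assumes "0 < \<gamma>" and "\<gamma> < 1" and "0 < u0"
    and "maximal_positive_solution \<gamma> (\<lambda>t x. A * x powr p) u0 Tb u"
  shows
    "(A = 0 \<longrightarrow> (\<forall>t \<in> Ico0 Tb. u t = u0)) \<and>
     (A > 0 \<longrightarrow> strict_mono_on {t. 0 < t \<and> ereal t < Tb} u) \<and>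
     (A < 0 \<longrightarrow> strict_antimono_on (Ico0 Tb) u) \<and>
     (A > 0 \<longrightarrow>
        (p > 1 \<longrightarrow>
           (\<exists>T. Tb = ereal T \<and>
              u \<sim>[at_left T] (\<lambda>t. (Gamma (p * \<gamma> / (p - 1)) / (A * Gamma (\<gamma> / (p - 1)))) powr (1 / (p - 1))
                                    * (T - t) powr (- (\<gamma> / (p - 1)))))) \<and>
        (p = 1 \<longrightarrow> (\<forall>t \<in> Ico0 Tb. u t = u0 * mittag_leffler \<gamma> (A * t powr \<gamma>))) \<and>
        (p < 1 \<longrightarrow>
           (\<exists>c1 > 0. \<exists>c2 > 0. \<forall>t \<ge> 1. ereal t < Tb \<and>
              c1 * t powr (\<gamma> / (1 - p)) \<le> u t \<and> u t \<le> c2 * t powr (\<gamma> / (1 - p))))) \<and>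
     (A < 0 \<longrightarrow>
        (p < 0 \<longrightarrow>
           (\<exists>T. Tb = ereal T \<and> (u \<longlongrightarrow> 0) (at_left T) \<and>
              filterlim (\<lambda>t. A * u t powr p) at_bot (at_left T))) \<and>
        (p = 0 \<longrightarrow> (\<forall>t \<in> Ico0 Tb. u t = u0 + A * (t powr \<gamma> / Gamma (1 + \<gamma>)))) \<and>
        (p > 0 \<longrightarrow>
           Tb = \<infinity> \<and>
           (\<exists>c1 > 0. \<exists>c2 > 0. \<forall>t \<ge> 1.
              c1 * t powr (- (\<gamma> / p)) \<le> u t \<and> u t \<le> c2 * t powr (- (\<gamma> / p)))))"
proof -
  interpret power_solution \<gamma> A p u0 Tb u
    using assms by unfold_locales
  have "strict_mono_on {t. 0 < t \<and> ereal t < Tb} u" if "0 < A"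
    using increasing[OF that] by (intro strict_mono_onI) (auto simp: Ico0_def)
  moreover have "strict_antimono_on (Ico0 Tb) u" if "A < 0"
    using decreasing[OF that] by (intro monotone_onI) (auto simp: Ico0_def)
  moreover have "\<exists>c1 > 0. \<exists>c2 > 0. \<forall>t \<ge> 1. ereal t < Tb \<and>
      c1 * t powr (\<gamma> / (1 - p)) \<le> u t \<and> u t \<le> c2 * t powr (\<gamma> / (1 - p))" if "0 < A" "p < 1"
    using increasing_subcritical[OF that] by simp
  ultimately show ?thesis
    using u_const blowup_asymptotics linear_mittag_leffler decreasing_negative_exponent
      decreasing_zero_exponent decreasing_positive_exponent
    by blast
qed

end
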